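(* Let $R_n$ (resp. $S_n$) denote the set of reciprocal (resp. skew-reciprocal) Littlewood polynomials of degree $n$ with square discriminant. Then each of $|R_{8n}|$, $|S_{8n}|$, $|R_{8n-2}|$, $|S_{8n-2}|$ is $\asymp 16^n\log n/\sqrt{n}$ as $n\to\infty$. More precisely: (a) $\displaystyle\lim_{n\to\infty}\frac{|R_{8n}|}{16^n\log n/\sqrt n}=\frac{\Gamma(1/4)^2}{4\sqrt2\,\pi^3}$ and $\displaystyle\lim_{n\to\infty}\frac{|S_{8n}|}{16^n\log n/\sqrt n}=\frac{1}{2\pi^{3/2}}$; (b) $|R_{8n-2}|\sim\frac12|R_{8n}|$ and $|S_{8n-2}|\sim\frac12|S_{8n}|$ as $n\to\infty$.
   Context: A Littlewood polynomial of degree $n$ is a monic polynomial $X^n+a_{n-1}X^{n-1}+\dots+a_0\in\mathbf Z[X]$ with all $a_i\in\{1,-1\}$. A polynomial $f$ of degree $n$ is reciprocal if $f(X)=X^nf(X^{-1})$, and skew-reciprocal if $f(X)=(-1)^{n(n-1)/2}X^nf(-X^{-1})$. "Square discriminant" means the discriminant of $f$ is the square of an integer. $f\asymp g$ means $g\ll f\ll g$; $f\sim g$ means $f(n)/g(n)\to1$. *)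

theory Defs
  imports "HOL-Analysis.Analysis" "HOL-Library.Landau_Symbols" "Subresultants.Resultant_Prelim"
begin

definition littlewood :: "nat \<Rightarrow> int poly \<Rightarrow> bool" where
  "littlewood n f \<longleftrightarrow> degree f = n \<and> lead_coeff f = 1 \<and> (\<forall>i<n. coeff f i \<in> {1, -1})"

text \<open>f(X) = X^n f(1/X), written coefficientwise (n = degree f).\<close>
definition reciprocal :: "int poly \<Rightarrow> bool" where
  "reciprocal f \<longleftrightarrow> (\<forall>i\<le>degree f. coeff f i = coeff f (degree f - i))"

text \<open>f(X) = (-1)^(n(n-1)/2) X^n f(-1/X), written coefficientwise:
  the coefficient of X^i on the right is (-1)^(n(n-1)/2) (-1)^(n-i) a_(n-i).\<close>
definition skew_reciprocal :: "int poly \<Rightarrow> bool" where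
  "skew_reciprocal f \<longleftrightarrow> (let n = degree f in
     \<forall>i\<le>n. coeff f i = (-1) ^ (n * (n - 1) div 2) * (-1) ^ (n - i) * coeff f (n - i))"

text \<open>Discriminant: (-1)^(n(n-1)/2) Res(f,f') / lc(f).  Exact division in Z.\<close>
definition discriminant :: "int poly \<Rightarrow> int" where
  "discriminant f = (let n = degree f in
     (-1) ^ (n * (n - 1) div 2) * resultant f (pderiv f) div lead_coeff f)"

definition square_disc :: "int poly \<Rightarrow> bool" where
  "square_disc f \<longleftrightarrow> (\<exists>k::int. discriminant f = k ^ 2)"

definition R_set :: "nat \<Rightarrow> int poly set" where
  "R_set n = {f. littlewood n f \<and> reciprocal f \<and> square_disc f}"

definition S_set :: "nat \<Rightarrow> int poly set" where
  "S_set n = {f. littlewood n f \<and> skew_reciprocal f \<and> square_disc f}"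

end

(* Let f have degree 2m and satisfy a_(m-j) = e^j a_(m+j), with e = 1 in the reciprocal and e = -1 in the
   skew-reciprocal case. Writing f(X) = X^m g(X + e/X) gives disc f = (A^2 - e C^2) disc(g)^2, where A and C
   are signed sums of the middle coefficients a_(m+j) with j even and odd, respectively. Since f is congruent
   to 1 + X + ... + X^(2m) modulo 2, disc f is nonzero, so it is a square iff A^2 - e C^2 is one, that is,
   iff C = 0, which is negligible, or (A, C) = (d (u^2 + e v^2), 2 d u v) up to signs, with d odd and u > v > 0
   coprime of opposite parity.

   For a random f the integers A and C are independent sums of signs, with Gaussian local limits of variance
   8N in degrees 8N and 8N - 2. Summing the Gaussian weight over d replaces it by a constant times
   sqrt N / (u^2 sqrt (phi(v/u))), where u^4 phi(v/u) = (A^2 + C^2) / d^2; summing this over the pairs with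
   u up to about N^(1/4) produces the factor log N and the constant integral of 1 / sqrt phi over [0, 1], which is
   an arctangent integral in the skew case and a lemniscate integral in the reciprocal case. *)
theory Submission
  imports Defs "Subresultants.Subresultant_Gcd" "HOL-Computational_Algebra.Computational_Algebra" "HOL-Real_Asymp.Real_Asymp" "HOL-Probability.Distributions"
begin

subsection \<open>Resultants and roots\<close>

text \<open>The degrees 0 and -2 modulo 8 are the even degrees in which squares can occur.
  \<open>A\<close> is odd, so a relation A^2 +- C^2 = k^2 forces 4 to divide \<open>C\<close>; but
  \<open>C\<close> is twice a sum of as many signs as there are odd \<open>j <= m\<close>, and that
  number is even only for \<open>m = 4N\<close> and \<open>m = 4N - 1\<close>. Both cases lead to
  the same lattice points, variance and limit law; the second has one free sign less, whence the
  factor 1/2.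

  The obstacle is that the main term beats the errors by a single logarithm only. With x = 4 sqrt N
  it has order x log x, while the sum over \<open>d\<close> is a Riemann sum with error O(1) for
  each pair (u, v), the line C = 0 costs O(sqrt N), and the pairs with u > sqrt x cost O(x). Hence
  the explicit inequalities: monotone Riemann sums up to u = sqrt x, where there are at most x
  pairs, and crude decay beyond. The density of coprime pairs of opposite parity enters through the
  sum of 1/k^2 over odd k, which is pi^2/8.\<close>

lemma prod_linear_factors:
  fixes rs :: "'a :: idom list"
  shows "degree (\<Prod>r\<leftarrow>rs. [:- r, 1:]) = length rs"
    and "lead_coeff (\<Prod>r\<leftarrow>rs. [:- r, 1:]) = 1"
    and "(\<Prod>r\<leftarrow>rs. [:- r, 1:]) \<noteq> 0"
    and "poly (\<Prod>r\<leftarrow>rs. [:- r, 1:]) x = (\<Prod>r\<leftarrow>rs. x - r)"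
proof -
  have 2: "lead_coeff (\<Prod>r\<leftarrow>rs. [:- r, 1:]) = 1" for rs :: "'a list"
    by (induction rs) (auto simp only: list.map prod_list.Cons prod_list.Nil lead_coeff_mult, auto)
  then have 3: "(\<Prod>r\<leftarrow>rs. [:- r, 1:]) \<noteq> 0" for rs :: "'a list"
    by (metis leading_coeff_0_iff zero_neq_one)
  show "lead_coeff (\<Prod>r\<leftarrow>rs. [:- r, 1:]) = 1" "(\<Prod>r\<leftarrow>rs. [:- r, 1:]) \<noteq> 0"
    by (fact 2 3)+
  show "degree (\<Prod>r\<leftarrow>rs. [:- r, 1:]) = length rs"
  proof (induction rs)
    case (Cons a rs)
    then show ?case
      using 3[of rs] by (simp only: list.map prod_list.Cons, subst degree_mult_eq) auto
  qed auto
  show "poly (\<Prod>r\<leftarrow>rs. [:- r, 1:]) x = (\<Prod>r\<leftarrow>rs. x - r)"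
    by (induction rs) (auto simp: algebra_simps)
qed

lemma complex_poly_split:
  fixes p :: "complex poly"
  obtains rs where "p = Polynomial.smult (lead_coeff p) (\<Prod>r\<leftarrow>rs. [:- r, 1:])" "length rs = degree p"
proof -
  obtain root where "Polynomial.smult (lead_coeff p) (\<Prod>i<degree p. [:- root i, 1:]) = p"
    using complex_poly_decompose' by blast
  moreover have "(\<Prod>i<degree p. [:- root i, 1:]) = (\<Prod>r\<leftarrow>map root [0..<degree p]. [:- r, 1:])"
    by (simp add: prod.distinct_set_conv_list[symmetric] o_def atLeast_upt)
  ultimately show ?thesis
    using that[of "map root [0..<degree p]"] by simp
qed

lemma prod_list_swap_diff:
  fixes rs ss :: "'a :: comm_ring_1 list"
  shows "(\<Prod>r\<leftarrow>rs. \<Prod>s\<leftarrow>ss. r - s)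
    = (-1) ^ (length rs * length ss) * (\<Prod>s\<leftarrow>ss. \<Prod>r\<leftarrow>rs. s - r)"
proof (induction rs)
  case (Cons a rs)
  have "(\<Prod>s\<leftarrow>ss. a - s) = (-1) ^ length ss * (\<Prod>s\<leftarrow>ss. s - a)" for a
    by (induction ss) (auto simp: algebra_simps)
  moreover have "(\<Prod>s\<leftarrow>ss. \<Prod>r\<leftarrow>a # rs. s - r)
      = (\<Prod>s\<leftarrow>ss. s - a) * (\<Prod>s\<leftarrow>ss. \<Prod>r\<leftarrow>rs. s - r)"
    by (induction ss) (auto simp: algebra_simps)
  ultimately show ?case
    using Cons by (simp add: power_add mult_ac)
next
  case Nil
  show ?case by (induction ss) auto
qed

text \<open>The resultant is the subresultant of index 0, so the Brown-Traub relations between the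
  subresultants of consecutive remainders specialise to one Euclidean step. They come in two forms,
  for an index equal to the degree of the remainder and for a smaller one; hence the case split on a
  constant remainder.\<close>

lemma resultant_mod:
  fixes F G :: "'a :: field poly"
  assumes "degree G \<le> degree F" "degree G > 0"
  shows "resultant F G = (-1) ^ (degree F * degree G)
    * lead_coeff G ^ (degree F - degree (F mod G)) * resultant G (F mod G)"
proof -
  define H where "H = F mod G"
  have G0: "G \<noteq> 0" and F0: "F \<noteq> 0"
    using assms by auto
  have lt: "degree H < degree G"
    unfolding H_def using degree_mod_less'[OF G0] assms by (cases "F mod G = 0") auto
  have eq: "F + (- (F div G)) * G = H"
    unfolding H_def by (simp add: minus_mult_div_eq_mod[symmetric] algebra_simps)
  have "[:resultant F G:] = [:(-1) ^ (degree F * degree G)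
      * lead_coeff G ^ (degree F - degree H) * resultant G H:]"
  proof (cases "degree H = 0")
    case True
    then obtain c where c: "H = [:c:]"
      by (metis degree_eq_zeroE)
    have "c ^ (degree G - 1) * c = c ^ degree G"
      using assms by (metis Suc_diff_1 power_Suc2)
    then show ?thesis
      using BT_lemma_1_13[OF eq assms(1)] lt True c
      by (simp add: subresultant_resultant mult_ac)
  next
    case False
    then show ?thesis
      using BT_lemma_1_12[OF eq assms(1), of 0] lt
      by (simp add: subresultant_resultant mult_ac)
  qed
  then show ?thesis
    by (simp add: H_def)
qed

text \<open>Poisson's product formula, by running the Euclidean algorithm on the two degrees. If
  \<open>g\<close> has the larger degree, it is reduced modulo \<open>f\<close>, which leaves its
  values at the roots of \<open>f\<close> unchanged. Otherwise \<open>f\<close> is reduced modulo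
  \<open>g\<close>, the induction hypothesis is applied at the roots of \<open>g\<close>, and
  exchanging the double product over both root lists brings back the roots of
  \<open>f\<close>.\<close>

lemma resultant_linear_factors:
  fixes g :: "complex poly"
  assumes "a \<noteq> 0"
  shows "resultant (Polynomial.smult a (\<Prod>r\<leftarrow>rs. [:- r, 1:])) g = a ^ degree g * (\<Prod>r\<leftarrow>rs. poly g r)"
  using assms
proof (induction "length rs + degree g" arbitrary: a rs g rule: less_induct)
  case less
  define f where "f = Polynomial.smult a (\<Prod>r\<leftarrow>rs. [:- r, 1:])"
  have lf: "lead_coeff f = a"
    unfolding f_def lead_coeff_smult prod_linear_factors(2) by simp
  have df: "degree f = length rs"
    using less.prems unfolding f_def degree_smult_eq prod_linear_factors(1) by simp
  have pf: "poly f x = a * (\<Prod>r\<leftarrow>rs. x - r)" for x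
    unfolding f_def poly_smult prod_linear_factors(4) by simp
  have f0: "poly f r = 0" if "r \<in> set rs" for r
    unfolding pf using that by auto
  consider "degree g = 0" | "degree f = 0" | "degree f > 0" "degree f < degree g"
    | "degree g > 0" "degree g \<le> degree f" by linarith
  then have "resultant f g = a ^ degree g * (\<Prod>r\<leftarrow>rs. poly g r)"
  proof cases
    case 1
    then obtain c where "g = [:c:]"
      by (metis degree_eq_zeroE)
    then show ?thesis
      using df by (simp add: prod_list_replicate map_replicate_const)
  next
    case 2
    then have "rs = []" "f = [:a:]"
      using df by (auto simp: f_def)
    then show ?thesis by simp
  next
    case 3
    then have "f \<noteq> 0" by auto
    define H where "H = g mod f"
    have "degree H < degree f"
      unfolding H_def using degree_mod_less'[of f g] 3 \<open>f \<noteq> 0\<close> by (cases "g mod f = 0") auto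
    then have "degree H < degree g"
      using 3 by linarith
    then have IH: "resultant f H = a ^ degree H * (\<Prod>r\<leftarrow>rs. poly H r)"
      using less.hyps[of rs H a] less.prems unfolding f_def by simp
    have "poly H r = poly g r" if "r \<in> set rs" for r
    proof -
      have "poly g r = poly (g div f * f + g mod f) r" by simp
      then show ?thesis using f0[OF that] unfolding H_def poly_add poly_mult by simp
    qed
    then have eq: "(\<Prod>r\<leftarrow>rs. poly H r) = (\<Prod>r\<leftarrow>rs. poly g r)"
      by (simp cong: map_cong)
    have "resultant f g = (-1) ^ (degree f * degree g) * resultant g f"
      by (rule resultant_swap)
    also have "resultant g f = (-1) ^ (degree g * degree f) * a ^ (degree g - degree H) * resultant f H"
      using resultant_mod[of f g] 3 lf unfolding H_def by simp
    finally show ?thesis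
      using \<open>degree H < degree g\<close>
      by (simp add: IH eq mult.commute[of "degree g"] power_add[symmetric] mult_ac flip: power_mult_distrib)
  next
    case 4
    then have "g \<noteq> 0" by auto
    define b where "b = lead_coeff g"
    obtain ss where ss: "g = Polynomial.smult b (\<Prod>r\<leftarrow>ss. [:- r, 1:])" "length ss = degree g"
      using complex_poly_split[of g] unfolding b_def by metis
    have b0: "b \<noteq> 0"
      using 4 unfolding b_def by auto
    have pg: "poly g x = b * (\<Prod>r\<leftarrow>ss. x - r)" for x
      by (subst ss(1)) (simp only: poly_smult prod_linear_factors(4))
    define H where "H = f mod g"
    have dH: "degree H < degree g"
      unfolding H_def using degree_mod_less'[of g f] 4 \<open>g \<noteq> 0\<close> by (cases "f mod g = 0") auto
    then have "resultant g H = b ^ degree H * (\<Prod>r\<leftarrow>ss. poly H r)"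
      using less.hyps[of ss H b] b0 ss 4 df by simp
    have "poly H r = poly f r" if "r \<in> set ss" for r
    proof -
      have "poly f r = poly (f div g * g + f mod g) r" by simp
      moreover have "poly g r = 0" unfolding pg using that by auto
      ultimately show ?thesis unfolding H_def poly_add poly_mult by simp
    qed
    then have eq: "(\<Prod>r\<leftarrow>ss. poly H r) = (\<Prod>r\<leftarrow>ss. poly f r)"
      by (simp cong: map_cong)
    have c: "(\<Prod>r\<leftarrow>xs. k * h r) = k ^ length xs * (\<Prod>r\<leftarrow>xs. h r)" for k :: complex and h xs
      by (induction xs) (auto simp: mult_ac)
    have "resultant f g = (-1) ^ (degree f * degree g) * b ^ (degree f - degree H) * resultant g H"
      using resultant_mod[of g f] 4 unfolding H_def b_def by simp
    also have "\<dots> = (-1) ^ (degree f * degree g) * b ^ degree f * (\<Prod>r\<leftarrow>ss. poly f r)"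
      using dH 4 \<open>resultant g H = _\<close> eq by (simp add: power_add[symmetric])
    also have "\<dots> = a ^ degree g * (b ^ length rs * ((-1) ^ (length rs * length ss) * (\<Prod>s\<leftarrow>ss. \<Prod>r\<leftarrow>rs. s - r)))"
      unfolding pf c ss(2) df by (simp add: mult_ac)
    also have "\<dots> = a ^ degree g * (\<Prod>r\<leftarrow>rs. poly g r)"
      unfolding pg c prod_list_swap_diff[of rs ss] by (simp add: mult.commute[of "length ss"])
    finally show ?thesis .
  qed
  then show ?case by (simp add: f_def)
qed

lemma resultant_monic_linear_factors:
  fixes g :: "complex poly"
  shows "resultant (\<Prod>r\<leftarrow>rs. [:- r, 1:]) g = (\<Prod>r\<leftarrow>rs. poly g r)"
  using resultant_linear_factors[of 1 rs g] by simp

subsection \<open>Discriminants of palindromic polynomials\<close>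

text \<open>Modulo 2 the multiple is the constant 1, and an odd leading coefficient survives the
  reduction, so the degrees over the field with two elements decide. Over the integers this becomes
  a look at the product of the leading coefficient of \<open>p\<close> with the last odd coefficient
  of the cofactor.\<close>

lemma dvd_odd_constant_mod_2:
  fixes p q :: "int poly"
  assumes "p dvd [:c:] + Polynomial.smult 2 q" "odd c" "odd (lead_coeff p)"
  shows "degree p = 0"
proof (rule ccontr)
  assume deg: "degree p \<noteq> 0"
  from assms(1) obtain s where s: "[:c:] + Polynomial.smult 2 q = p * s"
    by (elim dvdE)
  have cf: "even (coeff (p * s) i) \<longleftrightarrow> i \<noteq> 0" for i
    unfolding s[symmetric] using assms(2) by (cases i) auto
  have ex: "\<exists>j. odd (coeff s j)"
  proof (rule ccontr)
    assume "\<not> ?thesis"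
    then have "even (coeff (p * s) 0)"
      by (auto simp: coeff_mult)
    then show False using cf[of 0] by simp
  qed
  have fin: "finite {j. odd (coeff s j)}"
    by (rule finite_subset[of _ "{..degree s}"]) (auto intro: le_degree)
  define j where "j = Max {j. odd (coeff s j)}"
  have j: "odd (coeff s j)"
    using Max_in[OF fin] ex unfolding j_def by auto
  have jmax: "even (coeff s i)" if "i > j" for i
    using Max_ge[OF fin, of i] that unfolding j_def by force
  have "coeff (p * s) (degree p + j)
      = (\<Sum>i\<le>degree p + j. coeff p i * coeff s (degree p + j - i))"
    by (simp add: coeff_mult)
  also have "\<dots> = coeff p (degree p) * coeff s j
      + (\<Sum>i\<in>{..degree p + j} - {degree p}. coeff p i * coeff s (degree p + j - i))"
    by (subst sum.remove[of _ "degree p"]) auto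
  finally have eq: "coeff (p * s) (degree p + j) = \<dots>" .
  have "even (\<Sum>i\<in>{..degree p + j} - {degree p}. coeff p i * coeff s (degree p + j - i))"
  proof (rule dvd_sum)
    fix i assume "i \<in> {..degree p + j} - {degree p}"
    then consider "i < degree p" | "i > degree p" by force
    then show "even (coeff p i * coeff s (degree p + j - i))"
      by cases (auto simp: jmax coeff_eq_0)
  qed
  then have "odd (coeff (p * s) (degree p + j))"
    unfolding eq using j assms(3) by simp
  then show False
    using cf[of "degree p + j"] deg by simp
qed

text \<open>A common divisor of \<open>f\<close> and \<open>f'\<close> divides \<open>X ((X-1) f)' - (n+1) (X-1) f\<close>, which is
  congruent to the odd constant \<open>n+1\<close> modulo 2, since \<open>(X-1) f\<close> is congruent to \<open>X^(n+1) - 1\<close>.\<close>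

lemma resultant_pderiv_nonzero:
  fixes f :: "int poly"
  assumes "littlewood n f" "even n"
  shows "resultant f (pderiv f) \<noteq> 0"
proof
  assume "resultant f (pderiv f) = 0"
  then have deg: "degree (gcd f (pderiv f)) \<noteq> 0"
    by (simp add: resultant_0_gcd)
  define p where "p = gcd f (pderiv f)"
  define F where "F = [:-1, 1:] * f"
  define h where "h = monom 1 (n + 1) - (1 :: int poly)"
  have n: "degree f = n" "lead_coeff f = 1" "\<And>i. i < n \<Longrightarrow> coeff f i \<in> {1, -1}"
    using assms by (auto simp: littlewood_def)
  have "odd (coeff f i)" if "i \<le> n" for i
    using n(2) n(3)[of i] n(1) that by (cases "i = n") auto
  moreover have "coeff f i = 0" if "i > n" for i
    using that n(1) by (simp add: coeff_eq_0)
  ultimately have par: "odd (coeff f i) \<longleftrightarrow> i \<le> n" for i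
    by (metis even_zero not_le)
  have "even (coeff (F - h) i)" for i
  proof (cases i)
    case (Suc k)
    then show ?thesis
      using par[of k] par[of "Suc k"] by (cases "k = n") (auto simp: F_def h_def)
  qed (use par[of 0] in \<open>simp add: F_def h_def\<close>)
  then have "[:2:] dvd F - h"
    by (simp add: const_poly_dvd_iff)
  then obtain w where "F - h = [:2:] * w" by (elim dvdE)
  then have w: "F = h + Polynomial.smult 2 w"
    by (simp add: algebra_simps)
  define c where "c = int (n + 1)"
  have "[:0, 1:] * pderiv F - Polynomial.smult c F
      = [:c:] + Polynomial.smult 2 ([:0, 1:] * pderiv w - Polynomial.smult c w)"
  proof -
    have "pderiv h = monom c n"
      unfolding h_def c_def pderiv_diff pderiv_monom by simp
    then have "[:0, 1:] * pderiv h = monom c (n + 1)"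
      by (simp add: monom_Suc)
    then have "[:0, 1:] * pderiv h - Polynomial.smult c h = [:c:]"
      unfolding h_def by (simp add: smult_diff_right smult_monom)
    then show ?thesis
      unfolding w by (simp add: pderiv_add pderiv_smult algebra_simps smult_add_right smult_diff_right)
  qed
  moreover have "p dvd [:0, 1:] * pderiv F - Polynomial.smult c F"
  proof -
    have "p dvd f" "p dvd pderiv f"
      by (auto simp: p_def)
    moreover have "pderiv F = [:-1, 1:] * pderiv f + f * pderiv [:-1, 1:]"
      unfolding F_def by (rule pderiv_mult)
    ultimately show ?thesis
      unfolding F_def by (metis dvd_add dvd_diff dvd_mult dvd_mult2 dvd_smult)
  qed
  ultimately have "p dvd [:c:] + Polynomial.smult 2 ([:0, 1:] * pderiv w - Polynomial.smult c w)"
    by simp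
  moreover have "odd c"
    using assms by (simp add: c_def)
  moreover have "odd (lead_coeff p)"
  proof -
    have "p dvd f" by (simp add: p_def)
    then obtain s where "f = p * s" by (elim dvdE)
    then have "lead_coeff p * lead_coeff s = 1"
      using n(2) by (simp add: lead_coeff_mult)
    then show ?thesis
      by (metis dvd_mult2 odd_one)
  qed
  ultimately have "degree p = 0"
    by (rule dvd_odd_constant_mod_2)
  then show False
    using deg by (simp add: p_def)
qed

text \<open>The Dickson polynomials of the first kind with parameter \<open>e\<close>, characterised
  by D_j(X + e/X) = X^j + (e/X)^j. For \<open>e = 1\<close> they are the rescaled Chebyshev
  polynomials 2 T_j(X/2).\<close>

fun dickson :: "int \<Rightarrow> nat \<Rightarrow> int poly" where
  "dickson e 0 = [:2:]"
| "dickson e (Suc 0) = [:0, 1:]"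
| "dickson e (Suc (Suc j)) = [:0, 1:] * dickson e (Suc j) - Polynomial.smult e (dickson e j)"

lemma dickson_degree: "degree (dickson e j) \<le> j \<and> (j > 0 \<longrightarrow> coeff (dickson e j) j = 1)"
proof (induction e j rule: dickson.induct)
  case (3 e j)
  then show ?case
    by (auto simp: coeff_eq_0 intro!: degree_diff_le intro: le_trans[OF degree_smult_le])
qed auto

lemma dickson_eval:
  fixes x :: complex
  assumes "x \<noteq> 0"
  shows "poly (of_int_poly (dickson e j)) (x + of_int e / x) = x ^ j + (of_int e / x) ^ j"
proof (induction e j rule: dickson.induct)
  case (3 e j)
  have "poly (of_int_poly (dickson e (Suc (Suc j)))) (x + of_int e / x)
     = (x + of_int e / x) * (x ^ Suc j + (of_int e / x) ^ Suc j)
       - of_int e * (x ^ j + (of_int e / x) ^ j)"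
    using 3 by (simp add: of_int_poly_hom.hom_minus of_int_poly_hom.hom_mult of_int_hom.map_poly_hom_smult of_int_hom.map_poly_pCons_hom)
  also have "\<dots> = x ^ Suc (Suc j) + (of_int e / x) ^ Suc (Suc j)"
    using assms by (simp add: field_simps)
  finally show ?case .
qed auto

text \<open>\<open>f(X) = X^m g(X + e/X)\<close> with \<open>e = 1\<close> in the reciprocal and \<open>e = -1\<close> in the skew-reciprocal case.\<close>

definition half_poly :: "int \<Rightarrow> nat \<Rightarrow> int poly \<Rightarrow> int poly" where
  "half_poly e m f = [:coeff f m:] + (\<Sum>j=1..m. Polynomial.smult (coeff f (m + j)) (dickson e j))"

lemma half_poly_monic:
  assumes "lead_coeff f = 1" "degree f = 2 * m"
  shows "degree (half_poly e m f) = m" "lead_coeff (half_poly e m f) = 1"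
proof -
  have c: "coeff (dickson e j) i = 0" if "i > j" for i j
    using dickson_degree[of e j] that by (auto intro: coeff_eq_0)
  have "coeff (half_poly e m f) m = 1"
  proof (cases m)
    case 0
    then show ?thesis using assms by (simp add: half_poly_def)
  next
    case (Suc k)
    have "coeff (half_poly e m f) m = (\<Sum>j=1..m. coeff f (m + j) * coeff (dickson e j) m)"
      using Suc by (simp add: half_poly_def coeff_sum)
    also have "\<dots> = (\<Sum>j\<in>{m}. coeff f (m + j) * coeff (dickson e j) m)"
      using Suc by (intro sum.mono_neutral_right) (auto simp: c)
    also have "\<dots> = 1"
      using assms Suc dickson_degree[of e m] by (simp add: mult_2)
    finally show ?thesis .
  qed
  moreover have "degree (half_poly e m f) \<le> m"
    unfolding half_poly_def
    by (intro degree_add_le degree_sum_le)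
      (auto intro!: order.trans[OF degree_smult_le] order.trans[OF dickson_degree[THEN conjunct1]])
  moreover from calculation have "degree (half_poly e m f) \<ge> m"
    by (intro le_degree) auto
  ultimately show "degree (half_poly e m f) = m" "lead_coeff (half_poly e m f) = 1"
    by auto
qed

lemma half_poly_eval:
  fixes x :: complex
  assumes "x \<noteq> 0"
  shows "poly (of_int_poly (half_poly e m f)) (x + of_int e / x)
    = of_int (coeff f m) + (\<Sum>j=1..m. of_int (coeff f (m + j)) * (x ^ j + (of_int e / x) ^ j))"
  unfolding half_poly_def
  by (simp add: of_int_poly_hom.hom_add of_int_poly_hom.hom_sum of_int_hom.map_poly_hom_smult
      of_int_hom.map_poly_pCons_hom poly_sum dickson_eval[OF assms])

lemma poly_eq_half_poly:
  fixes x :: complex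
  assumes deg: "degree f = 2 * m"
    and sym: "\<And>j. j \<le> m \<Longrightarrow> coeff f (m - j) = e ^ j * coeff f (m + j)"
    and x: "x \<noteq> 0"
  shows "poly (of_int_poly f) x = x ^ m * poly (of_int_poly (half_poly e m f)) (x + of_int e / x)"
proof -
  let ?a = "\<lambda>i. of_int (coeff f i) :: complex"
  have "poly (of_int_poly f) x = (\<Sum>i\<le>2 * m. ?a i * x ^ i)"
    by (simp add: poly_altdef deg)
  also have "{..2 * m} = {..<m} \<union> ({m} \<union> {m + 1..2 * m})"
    by auto
  also have "(\<Sum>i\<in>{..<m} \<union> ({m} \<union> {m + 1..2 * m}). ?a i * x ^ i)
     = (\<Sum>i<m. ?a i * x ^ i) + (?a m * x ^ m + (\<Sum>i=m + 1..2 * m. ?a i * x ^ i))"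
    by (subst sum.union_disjoint) (auto simp: sum.union_disjoint)
  also have "(\<Sum>i<m. ?a i * x ^ i) = (\<Sum>j=1..m. ?a (m - j) * x ^ (m - j))"
    by (rule sum.reindex_bij_witness[of _ "\<lambda>j. m - j" "\<lambda>i. m - i"]) auto
  also have "\<dots> = (\<Sum>j=1..m. x ^ m * (?a (m + j) * (of_int e / x) ^ j))"
  proof (rule sum.cong)
    fix j assume "j \<in> {1..m}"
    then have "x ^ m = x ^ (m - j) * x ^ j"
      by (simp flip: power_add)
    then show "?a (m - j) * x ^ (m - j) = x ^ m * (?a (m + j) * (of_int e / x) ^ j)"
      using sym[of j] x \<open>j \<in> _\<close> by (simp add: power_divide)
  qed simp
  also have "(\<Sum>i=m + 1..2 * m. ?a i * x ^ i) = (\<Sum>j=1..m. x ^ m * (?a (m + j) * x ^ j))"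
    by (rule sum.reindex_bij_witness[of _ "\<lambda>j. m + j" "\<lambda>i. i - m"]) (auto simp flip: power_add)
  finally show ?thesis
    unfolding half_poly_eval[OF x]
    by (simp add: sum_distrib_left sum.distrib algebra_simps)
qed


text \<open>Each root s of \<open>g\<close> yields a pair r, e/r of roots of \<open>f\<close> with r
  + e/r = s. There f'(r) = r^m g'(s) (1 - e/r^2), and the product over the pair is, up to sign, (s^2
  - 4e) g'(s)^2. Multiplying over all s, the last factors give the squared resultant of
  \<open>g\<close> and g', while s^2 - 4e = (2w - s)(-2w - s) gives the values of \<open>g\<close>
  at 2w and -2w.\<close>

lemma resultant_pderiv_half_poly:
  assumes deg: "degree f = 2 * m" and lc: "lead_coeff f = 1" and m: "m > 0"
    and e: "e = 1 \<or> e = -1"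
    and sym: "\<And>j. j \<le> m \<Longrightarrow> coeff f (m - j) = e ^ j * coeff f (m + j)"
    and w: "w ^ 2 = (of_int e :: complex)"
  defines "g \<equiv> half_poly e m f"
  shows "of_int ((-1) ^ m * resultant f (pderiv f))
    = poly (of_int_poly g) (2 * w) * poly (of_int_poly g) (- (2 * w))
      * of_int (resultant g (pderiv g)) ^ 2"
proof -
  define fc gc :: "complex poly" where "fc = of_int_poly f" and "gc = of_int_poly g"
  define E :: complex where "E = of_int e"
  have E2: "E * E = 1" and E0: "E \<noteq> 0"
    using e by (auto simp: E_def)
  have g: "degree g = m" "lead_coeff g = 1"
    unfolding g_def using half_poly_monic[OF lc deg] by auto
  have gc: "degree gc = m" "lead_coeff gc = 1"
    using g by (auto simp: gc_def)
  obtain ss where ss': "gc = Polynomial.smult (lead_coeff gc) (\<Prod>s\<leftarrow>ss. [:- s, 1:])" "length ss = degree gc"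
    using complex_poly_split by blast
  have ss: "gc = (\<Prod>s\<leftarrow>ss. [:- s, 1:])" "length ss = m"
    using ss'(1)[unfolded gc(2) smult_1_left] ss'(2) gc(1) by simp_all
  have pgc: "poly gc x = (\<Prod>s\<leftarrow>ss. x - s)" for x
    by (simp only: ss(1) prod_linear_factors(4))
  have "\<exists>r. r ^ 2 - s * r + E = 0" for s
  proof -
    define D where "D = csqrt (s\<^sup>2 - 4 * E)"
    have "D\<^sup>2 = s\<^sup>2 - 4 * E"
      by (simp add: D_def)
    moreover have "((s + D) / 2) ^ 2 - s * ((s + D) / 2) + E = (D\<^sup>2 - (s\<^sup>2 - 4 * E)) / 4"
      by (simp add: power2_eq_square field_simps)
    ultimately have "((s + D) / 2) ^ 2 - s * ((s + D) / 2) + E = 0"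
      by simp
    then show ?thesis by blast
  qed
  then obtain \<rho> where \<rho>: "\<And>s. (\<rho> s) ^ 2 - s * \<rho> s + E = 0"
    by metis
  have \<rho>0: "\<rho> s \<noteq> 0" for s
    using \<rho>[of s] E0 by auto
  have \<rho>s: "\<rho> s + E / \<rho> s = s" for s
  proof -
    have "\<rho> s * \<rho> s + E = s * \<rho> s"
      using \<rho>[of s] by (simp add: power2_eq_square algebra_simps add_eq_0_iff)
    then show ?thesis
      using \<rho>0[of s] by (simp add: divide_simps)
  qed
  have feq: "poly fc x = x ^ m * poly gc (x + E / x)" if "x \<noteq> 0" for x
    unfolding fc_def gc_def E_def g_def using poly_eq_half_poly[OF deg sym that] by simp
  define rs where "rs = concat (map (\<lambda>s. [\<rho> s, E / \<rho> s]) ss)"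
  have rs_prod: "(\<Prod>r\<leftarrow>rs. F r) = (\<Prod>s\<leftarrow>ss. F (\<rho> s) * F (E / \<rho> s))" for F :: "complex \<Rightarrow> 'z :: comm_monoid_mult"
    unfolding rs_def by (induction ss) (auto simp: mult_ac)
  have rs_eval: "(\<Prod>r\<leftarrow>rs. x - r) = x ^ m * poly gc (x + E / x)" if "x \<noteq> 0" for x
  proof -
    have "(x - \<rho> s) * (x - E / \<rho> s) = x * (x + E / x - s)" for s
      using \<rho>0[of s] that by (subst (3) \<rho>s[of s, symmetric]) (simp add: field_simps)
    then have "(\<Prod>r\<leftarrow>rs. x - r) = (\<Prod>s\<leftarrow>ss. x * (x + E / x - s))"
      by (simp add: rs_prod)
    also have "\<dots> = x ^ length ss * (\<Prod>s\<leftarrow>ss. x + E / x - s)"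
      by (induction ss) (auto simp: mult_ac)
    finally show ?thesis
      by (simp add: ss(2) pgc)
  qed
  \<comment> \<open>Agreement at all nonzero points already identifies the polynomials, which yields
    the roots of \<open>f\<close> with the right multiplicities from those of
    \<open>g\<close>.\<close>
  have fc: "fc = (\<Prod>r\<leftarrow>rs. [:- r, 1:])"
  proof (rule ccontr)
    assume "\<not> ?thesis"
    then have "finite {x. poly (fc - (\<Prod>r\<leftarrow>rs. [:- r, 1:])) x = 0}"
      by (intro poly_roots_finite) auto
    moreover have "UNIV - {0} \<subseteq> {x. poly (fc - (\<Prod>r\<leftarrow>rs. [:- r, 1:])) x = 0}"
      using feq rs_eval unfolding poly_diff prod_linear_factors(4) by auto
    ultimately have "finite (UNIV :: complex set)"
      by (metis finite.emptyI finite_Diff2 finite.insertI finite_subset)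
    then show False
      using infinite_UNIV_char_0 by blast
  qed
  \<comment> \<open>In the product rule the derivative of x^m is multiplied by g(r + E/r) = 0, so
    only the chain rule term remains.\<close>
  have fder: "poly (pderiv fc) r = r ^ m * poly (pderiv gc) (r + E / r) * (1 - E / r\<^sup>2)"
    if "r \<noteq> 0" "poly gc (r + E / r) = 0" for r
  proof -
    have "((\<lambda>x. x ^ m * poly gc (x + E / x)) has_field_derivative
        r ^ m * poly (pderiv gc) (r + E / r) * (1 - E / r\<^sup>2)) (at r)"
      using that
      by (auto intro!: derivative_eq_intros DERIV_chain2[OF poly_DERIV] simp: power2_eq_square)
    then have "(poly fc has_field_derivative
        r ^ m * poly (pderiv gc) (r + E / r) * (1 - E / r\<^sup>2)) (at r)"
      by (rule has_field_derivative_transform_within_open[of _ _ _ "- {0}"]) (use that feq in auto)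
    then show ?thesis
      using DERIV_unique poly_DERIV by blast
  qed
  have pair: "poly (pderiv fc) (\<rho> s) * poly (pderiv fc) (E / \<rho> s)
      = E ^ m * (- E) * ((s\<^sup>2 - 4 * E) * poly (pderiv gc) s ^ 2)" if "s \<in> set ss" for s
  proof -
    have s0: "poly gc s = 0"
      unfolding ss prod_linear_factors(4) using that by auto
    define r where "r = \<rho> s"
    have r: "r \<noteq> 0" "r + E / r = s" "E / r + E / (E / r) = s" "E / r \<noteq> 0" "E / (E / r) = r"
      using \<rho>0[of s] \<rho>s[of s] E0 by (auto simp: r_def add_ac)
    define G where "G = poly (pderiv gc) s"
    have "poly (pderiv fc) r * poly (pderiv fc) (E / r)
        = (r ^ m * G * (1 - E / r\<^sup>2)) * ((E / r) ^ m * G * (1 - E / (E / r)\<^sup>2))"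
      using fder[of r] fder[of "E / r"] r s0 by (simp add: G_def)
    also have "\<dots> = (r * (E / r)) ^ m * G\<^sup>2 * ((1 - E / r\<^sup>2) * (1 - E / (E / r)\<^sup>2))"
      by (simp only: power_mult_distrib power2_eq_square) (simp only: mult_ac)
    also have "(1 - E / r\<^sup>2) * (1 - E / (E / r)\<^sup>2) = - E * ((r + E / r)\<^sup>2 - 4 * E)"
    proof -
      have "E / (E / r)\<^sup>2 = E * r\<^sup>2 / (E * E)"
        by (simp add: power_divide power2_eq_square)
      also have "\<dots> = E * r\<^sup>2" by (simp add: E2)
      finally have 1: "(1 - E / r\<^sup>2) * (1 - E / (E / r)\<^sup>2) = 1 + E * E - E * r\<^sup>2 - E / r\<^sup>2"
        using r(1) by (simp add: field_simps)
      have "- E * ((r + E / r)\<^sup>2 - 4 * E) = 2 * (E * E) - E * r\<^sup>2 - E * (E * E) / r\<^sup>2"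
        using r(1) by (simp add: field_simps power2_eq_square)
      then show ?thesis unfolding 1 E2 by simp
    qed
    finally show ?thesis
      using r by (simp add: G_def r_def mult_ac)
  qed
  have prod_const: "(\<Prod>s\<leftarrow>xs. k * h s) = k ^ length xs * (\<Prod>s\<leftarrow>xs. h s)" for k :: complex and h xs
    by (induction xs) (auto simp: mult_ac)
  have "resultant fc (pderiv fc) = (\<Prod>r\<leftarrow>rs. poly (pderiv fc) r)"
    by (subst (1) fc) (rule resultant_monic_linear_factors)
  also have "\<dots> = (\<Prod>s\<leftarrow>ss. E ^ m * (- E) * ((s\<^sup>2 - 4 * E) * poly (pderiv gc) s ^ 2))"
    unfolding rs_prod using pair by (simp cong: map_cong)
  also have "\<dots> = (E ^ m * (- E)) ^ m * (\<Prod>s\<leftarrow>ss. (s\<^sup>2 - 4 * E) * poly (pderiv gc) s ^ 2)"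
    unfolding prod_const ss(2) ..
  \<comment> \<open>The power of \<open>E\<close> has exponent m(m+1), which is even, and E^2 =
    1.\<close>
  also have "(E ^ m * (- E)) ^ m = (-1) ^ m"
  proof -
    have "E ^ m * (- E) = (-1) * E ^ (m + 1)"
      by simp
    then have "(E ^ m * (- E)) ^ m = (-1) ^ m * E ^ ((m + 1) * m)"
      by (simp only: power_mult_distrib power_mult)
    moreover have "E ^ ((m + 1) * m) = (E * E) ^ ((m + 1) * m div 2)"
      unfolding power2_eq_square[symmetric] power_mult[symmetric] by simp
    ultimately show ?thesis by (simp add: E2)
  qed
  also have "(\<Prod>s\<leftarrow>ss. (s\<^sup>2 - 4 * E) * poly (pderiv gc) s ^ 2)
     = poly gc (2 * w) * poly gc (- (2 * w)) * (\<Prod>s\<leftarrow>ss. poly (pderiv gc) s) ^ 2"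
  proof -
    have fac: "s\<^sup>2 - 4 * E = (2 * w - s) * (- (2 * w) - s)" for s
      using w by (simp add: E_def algebra_simps power2_eq_square)
    have "(\<Prod>s\<leftarrow>xs. (s\<^sup>2 - 4 * E) * h s ^ 2)
      = (\<Prod>s\<leftarrow>xs. 2 * w - s) * (\<Prod>s\<leftarrow>xs. - (2 * w) - s) * (\<Prod>s\<leftarrow>xs. h s) ^ 2" for xs and h :: "complex \<Rightarrow> complex"
      unfolding fac by (induction xs) (simp_all add: power_mult_distrib mult_ac)
    then show ?thesis
      unfolding pgc .
  qed
  also have "(\<Prod>s\<leftarrow>ss. poly (pderiv gc) s) = resultant gc (pderiv gc)"
    by (subst (2) ss) (rule resultant_monic_linear_factors[symmetric])
  finally have res: "resultant fc (pderiv fc) = (-1) ^ m * (poly gc (2 * w) * poly gc (- (2 * w))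
      * (resultant gc (pderiv gc)) ^ 2)" .
  have "(-1) ^ m * resultant fc (pderiv fc) = poly gc (2 * w) * poly gc (- (2 * w))
      * (resultant gc (pderiv gc)) ^ 2"
    unfolding res left_minus_one_mult_self ..
  then show ?thesis
    unfolding fc_def gc_def of_int_hom.map_poly_pderiv[symmetric] of_int_hom.resultant_hom by simp
qed

text \<open>If w^2 = e, then e/w = w, so the j-th Dickson polynomial takes the value 2 w^j at 2w.
  Even powers of w are powers of e and odd ones carry one further factor w; \<open>even_part\<close>
  and \<open>odd_part\<close> are the resulting coordinates of g(2w) with respect to 1 and
  w.\<close>

definition even_part :: "int \<Rightarrow> nat \<Rightarrow> int poly \<Rightarrow> int" where
  "even_part e m f = coeff f m + 2 * (\<Sum>j\<in>{j\<in>{1..m}. even j}. coeff f (m + j) * e ^ (j div 2))"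

definition odd_part :: "int \<Rightarrow> nat \<Rightarrow> int poly \<Rightarrow> int" where
  "odd_part e m f = 2 * (\<Sum>j\<in>{j\<in>{1..m}. odd j}. coeff f (m + j) * e ^ (j div 2))"

lemma half_poly_eval_double_sqrt:
  fixes w :: complex
  assumes "w ^ 2 = of_int e" "w \<noteq> 0"
  shows "poly (of_int_poly (half_poly e m f)) (2 * w)
    = of_int (even_part e m f) + w * of_int (odd_part e m f)"
proof -
  have ew: "of_int e / w = w"
    unfolding assms(1)[symmetric] using assms(2) by (simp add: power2_eq_square)
  have w1: "w ^ j = of_int e ^ (j div 2)" if "even j" for j
    using that by (elim evenE) (simp add: power_mult assms(1))
  have w2: "w ^ j = w * of_int e ^ (j div 2)" if "odd j" for j
    using that by (elim oddE) (simp add: power_mult assms(1))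
  have "poly (of_int_poly (half_poly e m f)) (2 * w) = of_int (coeff f m)
      + (\<Sum>j=1..m. of_int (coeff f (m + j)) * (2 * w ^ j))"
    using half_poly_eval[OF assms(2), of e m f] unfolding ew by (simp only: mult_2)
  also have "{1..m} = {j\<in>{1..m}. even j} \<union> {j\<in>{1..m}. odd j}"
    by auto
  also have "(\<Sum>j\<in>{j\<in>{1..m}. even j} \<union> {j\<in>{1..m}. odd j}. of_int (coeff f (m + j)) * (2 * w ^ j))
      = (\<Sum>j\<in>{j\<in>{1..m}. even j}. of_int (coeff f (m + j)) * (2 * of_int e ^ (j div 2)))
       + (\<Sum>j\<in>{j\<in>{1..m}. odd j}. of_int (coeff f (m + j)) * (2 * (w * of_int e ^ (j div 2))))"
    by (subst sum.union_disjoint, simp, simp, blast, intro arg_cong2[of _ _ _ _ "(+)"] sum.cong)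
      (simp_all add: w1 w2)
  finally show ?thesis
    unfolding even_part_def odd_part_def by (simp add: sum_distrib_left algebra_simps)
qed

lemma square_disc_iff:
  assumes lw: "littlewood (2 * m) f" and m: "m > 0"
    and e: "e = 1 \<or> e = -1"
    and sym: "\<And>j. j \<le> m \<Longrightarrow> coeff f (m - j) = e ^ j * coeff f (m + j)"
  shows "square_disc f \<longleftrightarrow> (\<exists>k. (even_part e m f)\<^sup>2 - e * (odd_part e m f)\<^sup>2 = k\<^sup>2)"
proof -
  have deg: "degree f = 2 * m" and lc: "lead_coeff f = 1"
    using lw by (auto simp: littlewood_def)
  define w :: complex where "w = csqrt (of_int e)"
  have w: "w ^ 2 = of_int e" "w \<noteq> 0" "(- w) ^ 2 = of_int e" "- w \<noteq> 0"
    using e by (auto simp: w_def)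
  define k where "k = resultant (half_poly e m f) (pderiv (half_poly e m f))"
  define D where "D = (even_part e m f)\<^sup>2 - e * (odd_part e m f)\<^sup>2"
  define a c :: complex where "a = of_int (even_part e m f)" and "c = of_int (odd_part e m f)"
  have "(a + w * c) * (a + (- w) * c) = a\<^sup>2 - w\<^sup>2 * c\<^sup>2"
    by (simp add: algebra_simps power2_eq_square)
  then have "(a + w * c) * (a + (- w) * c) = of_int D"
    unfolding w(1) D_def a_def c_def by simp
  moreover have "of_int ((-1) ^ m * resultant f (pderiv f))
      = (a + w * c) * (a + (- w) * c) * (of_int k)\<^sup>2"
    using resultant_pderiv_half_poly[OF deg lc m e sym w(1)]
      half_poly_eval_double_sqrt[OF w(1,2), of m f] half_poly_eval_double_sqrt[OF w(3,4), of m f]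
    unfolding k_def a_def c_def by (simp only: mult_minus_right)
  ultimately have "of_int ((-1) ^ m * resultant f (pderiv f)) = (of_int (D * k\<^sup>2) :: complex)"
    by simp
  then have res: "(-1) ^ m * resultant f (pderiv f) = D * k\<^sup>2"
    by (simp only: of_int_eq_iff)
  have "2 * m * (2 * m - 1) div 2 = m * (2 * m - 1)"
    by simp
  moreover have "(-1 :: int) ^ (m * (2 * m - 1)) = (-1) ^ m"
    using m by (auto simp: minus_one_power_iff)
  ultimately have disc: "discriminant f = D * k\<^sup>2"
    unfolding discriminant_def Let_def lc using res by (simp add: deg)
  have k0: "k \<noteq> 0"
    using resultant_pderiv_nonzero[OF lw] res by auto
  show ?thesis
    unfolding square_disc_def disc D_def[symmetric]
  proof safe
    fix l assume l: "D * k\<^sup>2 = l\<^sup>2"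
    then have "k\<^sup>2 dvd l\<^sup>2" by (metis dvd_triv_right)
    then obtain q where "l = k * q" by (auto elim!: dvdE)
    then show "\<exists>l. D = l\<^sup>2"
      using l k0 by (auto simp: power_mult_distrib)
  next
    fix l assume "D = l\<^sup>2"
    then show "\<exists>j. l\<^sup>2 * k\<^sup>2 = j\<^sup>2"
      by (metis power_mult_distrib)
  qed
qed

subsection \<open>Pythagorean triples\<close>

definition triples :: "(nat \<times> nat \<times> nat) set" where
  "triples = {(d, u, v). odd d \<and> 0 < v \<and> v < u \<and> coprime u v \<and> odd (u + v)}"

text \<open>Euclid's argument: after division by the gcd, the halves of c' - a' and c' + a' are
  coprime with product (b'/2)^2, hence both are squares. The cofactor \<open>d\<close> is odd
  because it divides the odd number \<open>a\<close>.\<close>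

lemma pythagorean_parametrization:
  fixes a b c :: nat
  assumes eq: "a\<^sup>2 + b\<^sup>2 = c\<^sup>2" and "odd a" "even b" "b > 0"
  obtains d u v where "(d, u, v) \<in> triples"
    "a = d * (u\<^sup>2 - v\<^sup>2)" "b = 2 * d * u * v" "c = d * (u\<^sup>2 + v\<^sup>2)"
proof -
  define d where "d = gcd a b"
  have d0: "d > 0" using \<open>b > 0\<close> by (simp add: d_def)
  obtain a' b' where ab: "a = d * a'" "b = d * b'" "coprime a' b'"
    using gcd_coprime_exists[of a b] d0 unfolding d_def by (metis mult.commute not_gr0)
  have "d\<^sup>2 dvd c\<^sup>2"
    unfolding eq[symmetric] ab power_mult_distrib by auto
  then have "d dvd c" by simp
  then obtain c' where c: "c = d * c'" by (elim dvdE)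
  have eq': "a'\<^sup>2 + b'\<^sup>2 = c'\<^sup>2"
    using eq d0 unfolding ab c power_mult_distrib by (simp flip: distrib_left)
  have par: "odd d" "odd a'" "even b'" "b' > 0"
    using assms ab by auto
  have "odd c'"
    using arg_cong[OF eq', of even] par by auto
  have "a' < c'"
    using eq' par by (metis less_add_same_cancel1 power2_less_imp_less zero_le zero_less_power)
  define p q where "p = (c' - a') div 2" and "q = (c' + a') div 2"
  have pq: "c' = p + q" "q = p + a'"
    using \<open>odd c'\<close> \<open>odd a'\<close> \<open>a' < c'\<close> unfolding p_def q_def by presburger+
  obtain h where h: "b' = 2 * h" using par by (elim evenE)
  have pqh: "p * q = h\<^sup>2"
    using eq' unfolding h pq by (simp add: power2_eq_square algebra_simps)
  have "h > 0" using par h by simp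
  then have pos: "p > 0" "q > 0"
    using pqh by (auto intro!: Nat.gr0I)
  have cop: "coprime p q"
  proof (rule coprimeI)
    fix g assume g: "g dvd p" "g dvd q"
    then have "g dvd a'" "g dvd h"
      using pq pqh by (metis dvd_add_right_iff) (metis g dvd_mult_right mult_dvd_mono pow_divides_pow_iff pos2 power2_eq_square pqh)
    then have "g dvd a'" "g dvd b'"
      unfolding h by auto
    then show "is_unit g"
      using ab(3) by (meson coprime_common_divisor)
  qed
  have "is_nth_power 2 (p * q)"
    unfolding pqh by (auto simp: is_nth_power_def)
  then obtain u v where uv: "p = v\<^sup>2" "q = u\<^sup>2"
    using is_nth_power_mult_coprime_natD[of p q 2] cop pos that by (auto simp: is_nth_power_def)
  have "v\<^sup>2 < u\<^sup>2"
    using pq par uv by (metis less_add_same_cancel1 odd_pos)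
  then have "v < u"
    by (simp add: power2_less_imp_less)
  moreover have "odd (u + v)"
    using \<open>odd c'\<close> unfolding pq(1) uv by simp
  moreover have "coprime u v" "v > 0"
    using cop pos uv by (auto simp: coprime_commute)
  moreover have "h = u * v"
    using pqh unfolding uv by (metis mult.commute power_mult_distrib power2_eq_iff_nonneg zero_le)
  ultimately show ?thesis
    using that[of d u v] par pq uv ab c h by (simp add: triples_def add.commute)
qed

text \<open>The two products determine the ratio u/v, and coprimality makes it a reduced fraction.
  They arise as half sum and half difference of the hypotenuse and the odd leg, which gives the
  injectivity of the parametrization.\<close>

lemma triples_eqI:
  assumes "(d, u, v) \<in> triples" "(d', u', v') \<in> triples"
    and eq: "d * u\<^sup>2 = d' * u'\<^sup>2" "d * v\<^sup>2 = d' * v'\<^sup>2"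
  shows "(d, u, v) = (d', u', v')"
proof -
  have pos: "0 < d" "0 < d'" "0 < v" "0 < v'" "0 < u" "0 < u'" "coprime u v" "coprime u' v'"
    using assms by (auto simp: triples_def odd_pos)
  have "(d * d') * (u * v')\<^sup>2 = (d * u\<^sup>2) * (d' * v'\<^sup>2)"
    by (simp add: power_mult_distrib)
  also have "\<dots> = (d * d') * (u' * v)\<^sup>2"
    unfolding eq(1) eq(2)[symmetric] by (simp add: power_mult_distrib)
  finally have "u * v' = u' * v"
    using pos by (simp add: power2_eq_iff_nonneg)
  then have "u dvd u'" "u' dvd u"
    using pos by (metis coprime_dvd_mult_left_iff dvd_triv_left)+
  then have "u = u'" by (rule dvd_antisym)
  then show ?thesis
    using eq \<open>u * v' = u' * v\<close> pos by auto
qed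

lemma triples_square_identity:
  assumes "(d, u, v) \<in> triples"
  shows "(d * (u\<^sup>2 - v\<^sup>2))\<^sup>2 + (2 * d * u * v)\<^sup>2 = (d * (u\<^sup>2 + v\<^sup>2))\<^sup>2"
proof -
  obtain k where "u\<^sup>2 = v\<^sup>2 + k"
    using assms le_Suc_ex[of "v\<^sup>2" "u\<^sup>2"] by (auto simp: triples_def)
  then show ?thesis
    by (simp add: power_mult_distrib, simp add: power2_eq_square algebra_simps)
qed

text \<open>In a Pythagorean triple \<open>c\<close> is always the even leg; \<open>a\<close> is the
  odd leg in the skew case and the hypotenuse in the reciprocal case. One bijection with
  \<open>triples\<close> therefore serves both.\<close>

abbreviation skew_points :: "(nat \<times> nat) set" where
  "skew_points \<equiv> {(a, c). odd a \<and> even c \<and> c > 0 \<and> (\<exists>b. a\<^sup>2 + c\<^sup>2 = b\<^sup>2)}"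

abbreviation reciprocal_points :: "(nat \<times> nat) set" where
  "reciprocal_points \<equiv> {(a, c). odd a \<and> even c \<and> c > 0 \<and> (\<exists>b. a\<^sup>2 = b\<^sup>2 + c\<^sup>2)}"

lemma bij_betw_triples:
  "bij_betw (\<lambda>(d, u, v). (d * (u\<^sup>2 - v\<^sup>2), 2 * d * u * v, d * (u\<^sup>2 + v\<^sup>2))) triples
     {(a, c, b). odd a \<and> even c \<and> c > 0 \<and> a\<^sup>2 + c\<^sup>2 = b\<^sup>2}" (is "bij_betw ?f _ ?P")
proof (rule bij_betw_imageI)
  show "inj_on ?f triples"
  proof (rule inj_onI)
    fix x y assume xy: "x \<in> triples" "y \<in> triples" "?f x = ?f y"
    obtain d u v d' u' v' where [simp]: "x = (d, u, v)" "y = (d', u', v')"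
      using prod_cases3 by metis
    have t: "(d, u, v) \<in> triples" "(d', u', v') \<in> triples"
      and eq: "d * u\<^sup>2 - d * v\<^sup>2 = d' * u'\<^sup>2 - d' * v'\<^sup>2" "d * u\<^sup>2 + d * v\<^sup>2 = d' * u'\<^sup>2 + d' * v'\<^sup>2"
      using xy by (simp_all add: diff_mult_distrib2 distrib_left)
    moreover have "d * v\<^sup>2 \<le> d * u\<^sup>2" "d' * v'\<^sup>2 \<le> d' * u'\<^sup>2"
      using t by (auto simp: triples_def)
    ultimately have "d * u\<^sup>2 = d' * u'\<^sup>2" "d * v\<^sup>2 = d' * v'\<^sup>2"
      by linarith+
    then show "x = y"
      using triples_eqI[OF t] by simp
  qed
  show "?f ` triples = ?P"
  proof (intro equalityI subsetI)
    fix x assume "x \<in> ?f ` triples"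
    then obtain d u v where t: "(d, u, v) \<in> triples" "x = ?f (d, u, v)"
      by auto
    have "\<not> u\<^sup>2 < v\<^sup>2"
      using t by (auto simp: triples_def not_less)
    then have "odd d" "odd (u\<^sup>2 - v\<^sup>2)" "0 < d * u * v"
      using t by (auto simp: triples_def odd_pos)
    then show "x \<in> ?P"
      using triples_square_identity[OF t(1)] by (auto simp: t)
  next
    fix x assume "x \<in> ?P"
    then obtain a c b where x: "x = (a, c, b)" "odd a" "even c" "c > 0" "a\<^sup>2 + c\<^sup>2 = b\<^sup>2" by auto
    obtain d u v where "(d, u, v) \<in> triples"
      "a = d * (u\<^sup>2 - v\<^sup>2)" "c = 2 * d * u * v" "b = d * (u\<^sup>2 + v\<^sup>2)"
      by (rule pythagorean_parametrization[OF x(5,2,3,4)])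
    then have "(d, u, v) \<in> triples" "x = ?f (d, u, v)"
      using x(1) by simp_all
    then show "x \<in> ?f ` triples"
      by blast
  qed
qed

lemma bij_betw_triples_skew:
  "bij_betw (\<lambda>(d, u, v). (d * (u\<^sup>2 - v\<^sup>2), 2 * d * u * v)) triples
     skew_points"
proof -
  have "bij_betw (\<lambda>(a :: nat, c :: nat, b :: nat). (a, c)) {(a, c, b). odd a \<and> even c \<and> c > 0 \<and> a\<^sup>2 + c\<^sup>2 = b\<^sup>2}
      skew_points"
    by (rule bij_betw_imageI) (auto simp: inj_on_def image_iff power2_eq_iff_nonneg)
  from bij_betw_trans[OF bij_betw_triples this] show ?thesis
    by (simp add: comp_def case_prod_unfold)
qed

lemma bij_betw_triples_reciprocal:
  "bij_betw (\<lambda>(d, u, v). (d * (u\<^sup>2 + v\<^sup>2), 2 * d * u * v)) triples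
     reciprocal_points"
proof -
  have par: "odd a \<longleftrightarrow> odd b" if "a\<^sup>2 + c\<^sup>2 = b\<^sup>2" "even c" for a b c :: nat
    using that by (metis even_add even_power pos2)
  have "bij_betw (\<lambda>(a :: nat, c :: nat, b :: nat). (b, c)) {(a, c, b). odd a \<and> even c \<and> c > 0 \<and> a\<^sup>2 + c\<^sup>2 = b\<^sup>2}
      reciprocal_points"
  proof (rule bij_betw_imageI)
    show "inj_on (\<lambda>(a :: nat, c :: nat, b :: nat). (b, c)) {(a, c, b). odd a \<and> even c \<and> c > 0 \<and> a\<^sup>2 + c\<^sup>2 = b\<^sup>2}"
      by (auto simp: inj_on_def) (metis add_right_cancel power2_eq_iff_nonneg zero_le)
    show "(\<lambda>(a :: nat, c :: nat, b :: nat). (b, c)) ` {(a, c, b). odd a \<and> even c \<and> c > 0 \<and> a\<^sup>2 + c\<^sup>2 = b\<^sup>2}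
        = reciprocal_points"
    proof (intro equalityI subsetI)
      fix x :: "nat \<times> nat"
      assume "x \<in> reciprocal_points"
      then obtain a c b where x: "x = (a, c)" "odd a" "even c" "c > 0" "b\<^sup>2 + c\<^sup>2 = a\<^sup>2" by auto
      then have "odd b" using par[of b c a] by simp
      then show "x \<in> (\<lambda>(a :: nat, c :: nat, b :: nat). (b, c)) ` {(a, c, b). odd a \<and> even c \<and> c > 0 \<and> a\<^sup>2 + c\<^sup>2 = b\<^sup>2}"
        using x by (intro image_eqI[of _ _ "(b, c, a)"]) auto
    qed (use par in \<open>auto simp: eq_commute\<close>)
  qed
  from bij_betw_trans[OF bij_betw_triples this] show ?thesis
    by (simp add: comp_def case_prod_unfold)
qed

subsection \<open>Lattice sums over coprime pairs\<close>

lemma integral_antimono_bounds: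
  fixes f :: "real \<Rightarrow> real"
  assumes cont: "continuous_on {0..} f"
    and anti: "\<And>s t. 0 \<le> s \<Longrightarrow> s \<le> t \<Longrightarrow> f t \<le> f s"
    and "0 \<le> s" "s \<le> t"
  shows "f t * (t - s) \<le> integral {0..t} f - integral {0..s} f"
    and "integral {0..t} f - integral {0..s} f \<le> f s * (t - s)"
proof -
  have int: "f integrable_on {a..b}" if "0 \<le> a" for a b
    using that by (intro integrable_continuous_real continuous_on_subset[OF cont]) auto
  have eq: "integral {0..t} f - integral {0..s} f = integral {s..t} f"
    using Henstock_Kurzweil_Integration.integral_combine[of 0 s t f] int assms by simp
  have "integral {s..t} (\<lambda>_. f t) \<le> integral {s..t} f"
    using assms by (intro integral_le int anti integrable_const_ivl) auto
  moreover have "integral {s..t} f \<le> integral {s..t} (\<lambda>_. f s)"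
    using assms by (intro integral_le int anti integrable_const_ivl) auto
  ultimately show "f t * (t - s) \<le> integral {0..t} f - integral {0..s} f"
    "integral {0..t} f - integral {0..s} f \<le> f s * (t - s)"
    unfolding eq using assms by (simp_all add: mult.commute)
qed

text \<open>Comparison term by term with the integral. Monotonicity limits the loss to the single
  end term \<open>h * f p\<close>, whatever the number of terms, so sums of varying length are
  controlled uniformly.\<close>

lemma riemann_sum_antimono:
  fixes f :: "real \<Rightarrow> real"
  assumes cont: "continuous_on {0..} f"
    and anti: "\<And>s t. 0 \<le> s \<Longrightarrow> s \<le> t \<Longrightarrow> f t \<le> f s"
    and nonneg: "\<And>t. f t \<ge> 0" and p: "0 \<le> p" and h: "0 < h"
  defines "F \<equiv> \<lambda>t. integral {0..t} f"
  shows "F (p + h * real K) - F p \<le> h * (\<Sum>j<K. f (p + h * real j))"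
    and "h * (\<Sum>j<K. f (p + h * real j)) \<le> h * f p + F (p + h * real K) - F p"
proof -
  note b = integral_antimono_bounds[OF cont anti]
  show "F (p + h * real K) - F p \<le> h * (\<Sum>j<K. f (p + h * real j))"
  proof (induction K)
    case (Suc K)
    have "F (p + h * real (Suc K)) - F (p + h * real K) \<le> f (p + h * real K) * h"
      using b(2)[of "p + h * real K" "p + h * real (Suc K)"] p h unfolding F_def by (simp add: algebra_simps)
    then show ?case
      using Suc by (simp add: algebra_simps)
  qed simp
  \<comment> \<open>The induction needs the sharper error \<open>f p - f (p + h * K)\<close>, which
    telescopes; nonnegativity of \<open>f\<close> is applied only afterwards.\<close>
  have *: "h * (\<Sum>j<K. f (p + h * real j)) \<le> h * (f p - f (p + h * real K)) + F (p + h * real K) - F p"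
  proof (induction K)
    case (Suc K)
    have "f (p + h * real (Suc K)) * h \<le> F (p + h * real (Suc K)) - F (p + h * real K)"
      using b(1)[of "p + h * real K" "p + h * real (Suc K)"] p h unfolding F_def by (simp add: algebra_simps)
    then show ?case
      using Suc by (simp add: algebra_simps)
  qed simp
  have "0 \<le> h * f (p + h * real K)"
    using h nonneg by simp
  then show "h * (\<Sum>j<K. f (p + h * real j)) \<le> h * f p + F (p + h * real K) - F p"
    using * by (simp add: algebra_simps)
qed

section \<open>The truncated Gaussian integral and Gaussian sums over odd numbers\<close>

definition gauss_int :: "real \<Rightarrow> real" where
  "gauss_int y = integral {0..y} (\<lambda>t. exp (- t\<^sup>2))"

lemma gauss_int_tendsto: "(gauss_int \<longlongrightarrow> sqrt pi / 2) at_top"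
proof -
  let ?f = "\<lambda>x::real. indicator {0..} x *\<^sub>R exp (- x\<^sup>2)"
  have int: "integrable lborel ?f" and val: "integral\<^sup>L lborel ?f = sqrt pi / 2"
    using gaussian_moment_0 by (auto simp: has_bochner_integral_iff)
  have "((\<lambda>y. \<integral>x. indicator {..y} x *\<^sub>R ?f x \<partial>lborel) \<longlongrightarrow> integral\<^sup>L lborel ?f) at_top"
    using int by (intro tendsto_integral_at_top) auto
  moreover have "(\<integral>x. indicator {..y} x *\<^sub>R ?f x \<partial>lborel) = gauss_int y" for y
  proof -
    have "(\<integral>x. indicator {..y} x *\<^sub>R ?f x \<partial>lborel) = (LINT x:{0..y}|lborel. exp (- x\<^sup>2))"
      unfolding set_lebesgue_integral_def
      by (intro Bochner_Integration.integral_cong) (auto split: split_indicator)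
    also have "\<dots> = gauss_int y"
      unfolding gauss_int_def
      by (intro set_borel_integral_eq_integral(2) borel_integrable_atLeastAtMost') (auto intro!: continuous_intros)
    finally show ?thesis .
  qed
  ultimately show ?thesis
    unfolding val by (simp add: fun_eq_iff)
qed

lemma gauss_antimono: "0 \<le> s \<Longrightarrow> s \<le> t \<Longrightarrow> exp (- t\<^sup>2) \<le> exp (- s\<^sup>2 :: real)"
  by (simp add: power_mono)

lemma gauss_int_bounds:
  assumes "0 \<le> s" "s \<le> t"
  shows "gauss_int s \<le> gauss_int t" "gauss_int t - gauss_int s \<le> t - s"
proof -
  have c: "continuous_on {0..} (\<lambda>t::real. exp (- t\<^sup>2))"
    by (intro continuous_intros)
  note b = integral_antimono_bounds[of "\<lambda>t. exp (- t\<^sup>2)" s t, OF c gauss_antimono assms, folded gauss_int_def]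
  have "0 \<le> exp (- t\<^sup>2) * (t - s)" "exp (- s\<^sup>2) * (t - s) \<le> 1 * (t - s)"
    using assms mult_right_mono[of "exp (- s\<^sup>2)" 1 "t - s"] by simp_all
  then show "gauss_int s \<le> gauss_int t" "gauss_int t - gauss_int s \<le> t - s"
    using b by simp_all
qed

lemma gauss_int_0 [simp]: "gauss_int 0 = 0"
  by (simp add: gauss_int_def)

lemma gauss_int_le: "0 \<le> y \<Longrightarrow> gauss_int y \<le> sqrt pi / 2"
  by (rule tendsto_lowerbound[OF gauss_int_tendsto])
    (use gauss_int_bounds(1) in \<open>auto intro: eventually_at_top_linorderI[of y]\<close>)

text \<open>Odd multiples of \<open>r\<close> are sampled with step \<open>2 * r\<close>, so the sum
  is close to (sqrt pi / 2) / (2r). From below, the samples cover the interval from r to r (2K + 1);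
  the missing piece from 0 to r has mass at most \<open>r\<close>, which costs 1/2.\<close>

lemma odd_gauss_sum_bounds:
  fixes r :: real
  assumes r: "r > 0"
  shows "(\<Sum>j<K. exp (- (r * real (2 * j + 1))\<^sup>2)) \<le> 1 + sqrt pi / (4 * r)"
    and "0 \<le> Y \<Longrightarrow> Y \<le> r * real (2 * K + 1) \<Longrightarrow>
      gauss_int Y / (2 * r) - 1 / 2 \<le> (\<Sum>j<K. exp (- (r * real (2 * j + 1))\<^sup>2))"
proof -
  have c: "continuous_on {0..} (\<lambda>t::real. exp (- t\<^sup>2))"
    by (intro continuous_intros)
  define S where "S = (\<Sum>j<K. exp (- (r * real (2 * j + 1))\<^sup>2))"
  have S: "(\<Sum>j<K. exp (- (r + 2 * r * real j)\<^sup>2)) = S"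
    unfolding S_def by (simp add: algebra_simps)
  have b: "gauss_int (r + 2 * r * real K) - gauss_int r \<le> 2 * r * S"
    "2 * r * S \<le> 2 * r * exp (- r\<^sup>2) + gauss_int (r + 2 * r * real K) - gauss_int r"
    using riemann_sum_antimono[of "\<lambda>t. exp (- t\<^sup>2)" r "2 * r" K] c gauss_antimono r
    unfolding S gauss_int_def by (auto simp del: exp_le_cancel_iff)
  have G: "0 \<le> gauss_int r" "gauss_int r \<le> r" "gauss_int (r + 2 * r * real K) \<le> sqrt pi / 2"
    using gauss_int_bounds[of 0 r] gauss_int_le[of "r + 2 * r * real K"] r by simp_all
  have "2 * r * S \<le> 2 * r * exp (- r\<^sup>2) + gauss_int (r + 2 * r * real K) - gauss_int r"
    using b(2) r by simp
  also have "\<dots> \<le> 2 * r * 1 + sqrt pi / 2"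
  proof -
    have "2 * r * exp (- r\<^sup>2) \<le> 2 * r * 1"
      using r by (intro mult_left_mono) auto
    then show ?thesis using G by linarith
  qed
  finally show "S \<le> 1 + sqrt pi / (4 * r)"
    using r by (simp add: field_simps)
  assume Y: "0 \<le> Y" "Y \<le> r * real (2 * K + 1)"
  have "gauss_int Y \<le> gauss_int (r + 2 * r * real K)"
    using Y by (intro gauss_int_bounds(1)) (auto simp: algebra_simps)
  also have "\<dots> \<le> 2 * r * S + r"
    using b(1) G r by simp
  finally show "gauss_int Y / (2 * r) - 1 / 2 \<le> S"
    using r by (simp add: field_simps)
qed

text \<open>For odd \<open>d\<close>, the set \<open>cop u\<close> contains exactly the
  \<open>v\<close> with \<open>(d, u, v)\<close> in \<open>triples\<close>. Without coprimality,
  \<open>opp u\<close> is an arithmetic progression of step 2, whose sums are Riemann sums.\<close>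

definition opp :: "nat \<Rightarrow> nat set" where
  "opp u = {v \<in> {0<..<u}. odd (u + v)}"

definition cop :: "nat \<Rightarrow> nat set" where
  "cop u = {v \<in> opp u. coprime u v}"

lemma finite_opp [simp]: "finite (opp u)" and finite_cop [simp]: "finite (cop u)"
  by (auto simp: opp_def cop_def)

lemma card_cop: "card (cop u) \<le> u"
proof -
  have "card (cop u) \<le> card {0<..<u}"
    by (intro card_mono) (auto simp: opp_def cop_def)
  then show ?thesis
    by simp
qed

section \<open>Inverse squares and harmonic numbers\<close>

lemma inverse_squares_le: "(\<Sum>k=1..n. 1 / real k ^ 2) \<le> 2 - 1 / real n"
proof (induction n)
  case (Suc n)
  have "1 / real (Suc n) ^ 2 \<le> 1 / real n - 1 / real (Suc n)" if "n > 0"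
  proof -
    have "1 / real (Suc n) ^ 2 \<le> 1 / (real n * real (Suc n))"
      unfolding power2_eq_square by (intro frac_le mult_right_mono) (use that in auto)
    also have "\<dots> = 1 / real n - 1 / real (Suc n)"
      using that by (simp add: field_simps)
    finally show ?thesis .
  qed
  then show ?case
    using Suc by (cases "n = 0") auto
qed simp

text \<open>The even terms make up a quarter of the series for zeta(2) = pi^2/6.\<close>

lemma odd_inverse_squares_tendsto:
  "(\<lambda>n. \<Sum>k\<in>{k\<in>{1..n}. odd k}. 1 / real k ^ 2) \<longlonglongrightarrow> pi\<^sup>2 / 8"
proof -
  define Z where "Z n = (\<Sum>k=1..n. 1 / real k ^ 2)" for n
  have "(\<lambda>n. \<Sum>k<n. 1 / real (k + 1) ^ 2) \<longlonglongrightarrow> pi\<^sup>2 / 6"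
    using inverse_squares_sums by (simp add: sums_def add.commute)
  moreover have "(\<Sum>k<n. 1 / real (k + 1) ^ 2) = Z n" for n
    unfolding Z_def by (rule sum.reindex_bij_witness[of _ "\<lambda>k. k - 1" "\<lambda>k. k + 1"]) auto
  ultimately have Z: "Z \<longlonglongrightarrow> pi\<^sup>2 / 6"
    by simp
  have "(\<Sum>k\<in>{k\<in>{1..n}. odd k}. 1 / real k ^ 2) = Z n - Z (n div 2) / 4" for n
  proof -
    have "Z n = (\<Sum>k\<in>{k\<in>{1..n}. odd k} \<union> {k\<in>{1..n}. even k}. 1 / real k ^ 2)"
      unfolding Z_def by (rule sum.cong) auto
    also have "\<dots> = (\<Sum>k\<in>{k\<in>{1..n}. odd k}. 1 / real k ^ 2) + (\<Sum>k\<in>{k\<in>{1..n}. even k}. 1 / real k ^ 2)"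
      by (subst sum.union_disjoint) auto
    also have "(\<Sum>k\<in>{k\<in>{1..n}. even k}. 1 / real k ^ 2) = (\<Sum>k=1..n div 2. 1 / (4 * real k ^ 2))"
      by (rule sum.reindex_bij_witness[of _ "\<lambda>k. 2 * k" "\<lambda>k. k div 2"])
        (auto simp: power_mult_distrib elim!: evenE)
    also have "\<dots> = Z (n div 2) / 4"
      unfolding Z_def sum_divide_distrib by (simp add: mult.commute)
    finally show ?thesis by simp
  qed
  moreover have "(\<lambda>n. Z n - Z (n div 2) / 4) \<longlonglongrightarrow> pi\<^sup>2 / 6 - pi\<^sup>2 / 6 / 4"
    by (intro tendsto_intros Z filterlim_compose[OF Z]) (real_asymp, simp)
  ultimately show ?thesis
    by simp
qed

lemma harm_bounds:
  assumes "n > 0"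
  shows "ln (real n) \<le> harm n" "harm n \<le> ln (real n) + 1"
proof -
  have "ln (real n) \<le> ln (real n + 1)"
    using assms by simp
  then show "ln (real n) \<le> harm n"
    using ln_le_harm[of n] by linarith
  show "harm n \<le> ln (real n) + 1"
    using decseqD[OF decseq_harm_diff_ln, of 0 "n - 1"] assms by (simp add: harm_expand)
qed

text \<open>The two halves of the theorem differ only in \<open>H\<close>, which is 1/(1 + t^2) for
  skew-reciprocal and 1/sqrt(1 + 6t^2 + t^4) for reciprocal polynomials. Continuity and monotonicity
  reach beyond 1 because the Riemann sum of a row ends at 1 + 1/u.\<close>

locale angular_weight =
  fixes H :: "real \<Rightarrow> real"
  assumes cont: "continuous_on {0..} H"
    and anti: "\<And>s t. 0 \<le> s \<Longrightarrow> s \<le> t \<Longrightarrow> H t \<le> H s"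
    and pos: "\<And>t. H t > 0"
    and le1: "\<And>t. H t \<le> 1"
begin

abbreviation Hq :: "nat \<Rightarrow> nat \<Rightarrow> real" where
  "Hq u v \<equiv> H (real v / real u)"

definition I :: real where "I = integral {0..1} H"

definition all_sum :: "nat \<Rightarrow> real" where
  "all_sum n = (\<Sum>u=1..n. \<Sum>v\<in>opp u. Hq u v / real u ^ 2)"

definition prim_sum :: "nat \<Rightarrow> real" where
  "prim_sum n = (\<Sum>u=1..n. \<Sum>v\<in>cop u. Hq u v / real u ^ 2)"

text \<open>Half of the \<open>v < u\<close> have the right parity, so the row is a Riemann sum of
  \<open>H\<close> over the unit interval with step 2/u. The error is bounded independently of
  \<open>u\<close>; divided by u^2 it is summable over all rows.\<close>

lemma row_sum:
  assumes u: "u > 0"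
  shows "\<bar>(\<Sum>v\<in>opp u. Hq u v) - real u / 2 * I\<bar> \<le> 2"
proof -
  \<comment> \<open>\<open>p\<close> is the least \<open>v\<close> of parity opposite to
    \<open>u\<close>, and the greatest is u - 1; so the sampling interval starts at p/u and ends at
    (p + 2K)/u = 1 + 1/u.\<close>
  define p where "p = (if even u then 1 else 2 :: nat)"
  define K where "K = (u + 1 - p) div 2"
  have pK: "p + 2 * K = u + 1"
    using u by (auto simp: p_def K_def)
  have bij: "(\<Sum>v\<in>opp u. Hq u v) = (\<Sum>j<K. H (real p / real u + 2 / real u * real j))"
  proof (rule sum.reindex_bij_witness[of _ "\<lambda>j. p + 2 * j" "\<lambda>v. (v - p) div 2"])
    fix v assume v: "v \<in> opp u"
    then have "p \<le> v" "even (v - p)"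
      by (auto simp: opp_def p_def)
    then show *: "p + 2 * ((v - p) div 2) = v"
      by simp
    show "(v - p) div 2 \<in> {..<K}"
      using v pK * by (auto simp: opp_def)
    have "real v = real p + 2 * real ((v - p) div 2)"
      by (subst *[symmetric]) simp
    then show "H (real p / real u + 2 / real u * real ((v - p) div 2)) = Hq u v"
      by (simp add: add_divide_distrib)
  next
    fix j assume "j \<in> {..<K}"
    then show "p + 2 * j \<in> opp u"
      using pK by (auto simp: opp_def p_def)
  qed simp
  define F where "F t = integral {0..t} H" for t
  define V where "V = (\<Sum>v\<in>opp u. Hq u v)"
  have b: "F t - F s \<ge> 0 \<and> F t - F s \<le> t - s" if "0 \<le> s" "s \<le> t" for s t
  proof -
    have "0 \<le> H t * (t - s)" "H s * (t - s) \<le> 1 * (t - s)"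
      using that pos[of t] le1[of s] mult_right_mono[of "H s" 1 "t - s"] by simp_all
    moreover have "H t * (t - s) \<le> F t - F s" "F t - F s \<le> H s * (t - s)"
      unfolding F_def by (rule integral_antimono_bounds[OF cont anti]; use that in simp)+
    ultimately show ?thesis
      by (metis mult_1 order_trans)
  qed
  have [simp]: "F 0 = 0" "F 1 = I" by (simp_all add: F_def I_def)
  have end_eq: "real p / real u + 2 / real u * real K = 1 + 1 / real u"
    using arg_cong[OF pK, of real] u by (simp add: field_simps)
  have r: "F (1 + 1 / real u) - F (real p / real u) \<le> 2 / real u * V"
    "2 / real u * V \<le> 2 / real u * H (real p / real u) + F (1 + 1 / real u) - F (real p / real u)"
    using riemann_sum_antimono[of H "real p / real u" "2 / real u" K] cont anti pos u
    unfolding bij[symmetric] V_def end_eq F_def by (auto simp: less_imp_le)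
  have p2: "real p / real u \<le> 2 / real u"
    using u by (auto simp: p_def divide_right_mono)
  have "I - 2 / real u \<le> 2 / real u * V"
    using r(1) b[of 1 "1 + 1 / real u"] b[of 0 "real p / real u"] p2 by simp
  then have "real u / 2 * (I - 2 / real u) \<le> real u / 2 * (2 / real u * V)"
    by (rule mult_left_mono) simp
  then have 1: "real u / 2 * I - 1 \<le> V"
    using u by (simp add: right_diff_distrib)
  have "2 / real u * H (real p / real u) \<le> 2 / real u * 1"
    using le1 by (intro mult_left_mono) auto
  then have "2 / real u * V \<le> 2 / real u + (I + 1 / real u)"
    using r(2) b[of 1 "1 + 1 / real u"] b[of 0 "real p / real u"] by simp
  then have "real u / 2 * (2 / real u * V) \<le> real u / 2 * (2 / real u + (I + 1 / real u))"
    by (rule mult_left_mono) simp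
  then have 2: "V \<le> real u / 2 * I + 3 / 2"
    using u by (simp add: distrib_left)
  show ?thesis
    using 1 2 unfolding V_def by linarith
qed

lemma I_bounds: "0 < I" "I \<le> 1"
proof -
  have "H 1 * (1 - 0) \<le> integral {0..1} H - integral {0..0} H"
    "integral {0..1} H - integral {0..0} H \<le> H 0 * (1 - 0)"
    by (rule integral_antimono_bounds[OF cont anti]; simp)+
  then show "0 < I" "I \<le> 1"
    using pos[of 1] le1[of 0] by (auto simp: I_def)
qed

text \<open>Replacing each row by \<open>real u / 2 * I\<close> leaves a harmonic sum. The row
  errors 2/u^2 add up to at most 4, and passing from the harmonic number to the logarithm costs at
  most I/2.\<close>

lemma all_sum_bounds:
  assumes "n > 0"
  shows "\<bar>all_sum n - I / 2 * ln (real n)\<bar> \<le> 5"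
proof -
  have "\<bar>all_sum n - I / 2 * harm n\<bar>
      = \<bar>\<Sum>u=1..n. ((\<Sum>v\<in>opp u. Hq u v) - real u / 2 * I) / real u ^ 2\<bar>"
  proof -
    have "real u / 2 * I / real u ^ 2 = I / 2 * inverse (real u)" for u
      by (cases "u = 0") (simp_all add: power2_eq_square field_simps)
    then have "(\<Sum>v\<in>opp u. Hq u v / real u ^ 2) - I / 2 * inverse (real u)
        = ((\<Sum>v\<in>opp u. Hq u v) - real u / 2 * I) / real u ^ 2" for u
      by (simp only: diff_divide_distrib sum_divide_distrib)
    then show ?thesis
      unfolding all_sum_def harm_def sum_distrib_left sum_subtractf[symmetric] by simp
  qed
  also have "\<dots> \<le> (\<Sum>u=1..n. \<bar>((\<Sum>v\<in>opp u. Hq u v) - real u / 2 * I) / real u ^ 2\<bar>)"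
    by (rule sum_abs)
  also have "\<dots> \<le> (\<Sum>u=1..n. 2 * (1 / real u ^ 2))"
  proof (rule sum_mono)
    fix u assume "u \<in> {1..n}"
    then show "\<bar>((\<Sum>v\<in>opp u. Hq u v) - real u / 2 * I) / real u ^ 2\<bar> \<le> 2 * (1 / real u ^ 2)"
      using row_sum[of u] by (simp add: abs_divide divide_right_mono)
  qed
  also have "\<dots> \<le> 2 * 2"
    unfolding sum_distrib_left[symmetric]
    by (intro mult_left_mono order.trans[OF inverse_squares_le]) auto
  finally have "\<bar>all_sum n - I / 2 * harm n\<bar> \<le> 4"
    by simp
  moreover have "I / 2 * ln (real n) \<le> I / 2 * harm n" "I / 2 * harm n \<le> I / 2 * (ln (real n) + 1)"
    using harm_bounds[OF assms] I_bounds by (intro mult_left_mono; simp)+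
  moreover have "I / 2 * (ln (real n) + 1) = I / 2 * ln (real n) + I / 2"
    by (simp add: algebra_simps)
  ultimately show ?thesis
    using I_bounds unfolding abs_le_iff by linarith
qed

end

context angular_weight
begin

lemma prim_sum_le_all_sum_diff:
  assumes "m \<le> n"
  shows "prim_sum n - prim_sum m \<le> all_sum n - all_sum m" "prim_sum m \<le> prim_sum n"
proof -
  have split: "{1..n} = {1..m} \<union> {m + 1..n}"
    using assms by auto
  have d1: "prim_sum n - prim_sum m = (\<Sum>u=m + 1..n. \<Sum>v\<in>cop u. Hq u v / real u ^ 2)"
    unfolding prim_sum_def split by (subst sum.union_disjoint) auto
  have d2: "all_sum n - all_sum m = (\<Sum>u=m + 1..n. \<Sum>v\<in>opp u. Hq u v / real u ^ 2)"
    unfolding all_sum_def split by (subst sum.union_disjoint) auto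
  show "prim_sum n - prim_sum m \<le> all_sum n - all_sum m"
    unfolding d1 d2 by (intro sum_mono sum_mono2) (auto simp: cop_def pos less_imp_le)
  have "0 \<le> prim_sum n - prim_sum m"
    unfolding d1 by (intro sum_nonneg) (auto simp: pos less_imp_le)
  then show "prim_sum m \<le> prim_sum n"
    by simp
qed

text \<open>The pairs are sorted by their gcd \<open>k\<close>, which is odd because u + v is odd.
  The weight depends on v/u only, so the factor 1/u^2 contributes 1/k^2.\<close>

lemma all_sum_eq_prim_sums:
  "all_sum n = (\<Sum>k\<in>{k\<in>{1..n}. odd k}. prim_sum (n div k) / real k ^ 2)"
proof -
  define h where "h = (\<lambda>(u, v). Hq u v / real u ^ 2)"
  have "all_sum n = (\<Sum>x\<in>(SIGMA u:{1..n}. opp u). h x)"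
    unfolding all_sum_def h_def by (subst sum.Sigma) auto
  also have "\<dots> = (\<Sum>y\<in>(SIGMA k:{k\<in>{1..n}. odd k}. SIGMA u:{1..n div k}. cop u).
      (\<lambda>(k, u, v). h (u, v) / real k ^ 2) y)"
  proof (rule sum.reindex_bij_witness[of _ "\<lambda>(k, u, v). (k * u, k * v)"
        "\<lambda>(u, v). (gcd u v, u div gcd u v, v div gcd u v)"])
    fix x assume x: "x \<in> (SIGMA u:{1..n}. opp u)"
    obtain u v where uv: "x = (u, v)" by force
    define g where "g = gcd u v"
    have *: "1 \<le> u" "u \<le> n" "0 < v" "v < u" "odd (u + v)"
      using x unfolding uv by (auto simp: opp_def)
    then have "g > 0" by (simp add: g_def)
    obtain u' v' where u'v': "u = g * u'" "v = g * v'" "coprime u' v'"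
      using gcd_coprime_exists[of u v] \<open>g > 0\<close> unfolding g_def by (metis mult.commute not_gr0)
    have d: "u div g = u'" "v div g = v'"
      using u'v' \<open>g > 0\<close> by auto
    have "odd g" "odd (u' + v')" "0 < v'" "v' < u'" "0 < u'"
      using * unfolding u'v' by (auto simp flip: distrib_left)
    moreover have "u' \<le> n div g"
      using \<open>g > 0\<close> *(2) unfolding u'v' by (simp add: less_eq_div_iff_mult_less_eq mult.commute)
    moreover have "g \<le> n"
      using *(1,2) unfolding u'v' by (metis \<open>0 < u'\<close> le_trans mult.commute nat_mult_le_cancel_disj mult_le_mono1 mult_1 Suc_leI One_nat_def)
    ultimately show "(case x of (u, v) \<Rightarrow> (gcd u v, u div gcd u v, v div gcd u v))
        \<in> (SIGMA k:{k\<in>{1..n}. odd k}. SIGMA u:{1..n div k}. cop u)"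
      using u'v'(3) \<open>g > 0\<close> unfolding uv by (auto simp: g_def[symmetric] d cop_def opp_def)
    show "(case case x of (u, v) \<Rightarrow> (gcd u v, u div gcd u v, v div gcd u v) of (k, u, v) \<Rightarrow> (k * u, k * v)) = x"
      unfolding uv using u'v' by (simp add: g_def[symmetric] d)
    show "(case case x of (u, v) \<Rightarrow> (gcd u v, u div gcd u v, v div gcd u v) of
        (k, u, v) \<Rightarrow> h (u, v) / (real k)\<^sup>2) = h x"
      unfolding uv using \<open>g > 0\<close>
      by (simp add: g_def[symmetric] d h_def) (simp add: u'v' power_mult_distrib)
  next
    fix y assume y: "y \<in> (SIGMA k:{k\<in>{1..n}. odd k}. SIGMA u:{1..n div k}. cop u)"
    obtain k u v where kuv: "y = (k, u, v)" by (rule prod_cases3)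
    have *: "1 \<le> k" "k \<le> n" "odd k" "1 \<le> u" "u \<le> n div k" "0 < v" "v < u" "odd (u + v)" "coprime u v"
      using y unfolding kuv by (auto simp: opp_def cop_def)
    have "k * u \<le> n"
      using * by (simp add: less_eq_div_iff_mult_less_eq mult.commute)
    then show "(case y of (k, u, v) \<Rightarrow> (k * u, k * v)) \<in> (SIGMA u:{1..n}. opp u)"
      using * unfolding kuv by (auto simp: opp_def simp flip: distrib_left)
    have "gcd (k * u) (k * v) = k"
      using * by (simp add: gcd_mult_distrib_nat[symmetric])
    then show "(case case y of (k, u, v) \<Rightarrow> (k * u, k * v) of (u, v) \<Rightarrow> (gcd u v, u div gcd u v, v div gcd u v)) = y"
      using * unfolding kuv by simp
  qed
  also have "\<dots> = (\<Sum>k\<in>{k\<in>{1..n}. odd k}. prim_sum (n div k) / real k ^ 2)"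
    unfolding prim_sum_def sum_divide_distrib h_def by (simp add: sum.Sigma[symmetric])
  finally show ?thesis .
qed

text \<open>No Moebius inversion is needed: the increments of \<open>prim_sum\<close> are dominated by those of \<open>all_sum\<close>,
  so \<open>prim_sum (n div k)\<close> differs from \<open>prim_sum n\<close> only by \<open>O(log k)\<close>, and \<open>log k / k^2\<close> is summable.\<close>

lemma prim_sum_asymp: "(\<lambda>n. prim_sum n / ln (real n)) \<longlonglongrightarrow> 4 * I / pi\<^sup>2"
proof -
  define D where "D n = {k\<in>{1..n}. odd k}" for n :: nat
  define S where "S n = (\<Sum>k\<in>D n. 1 / real k ^ 2)" for n
  \<comment> \<open>A bound for \<open>prim_sum n - prim_sum (n div k)\<close>, divided by k^2: the
    logarithms differ by at most ln (2k), because n <= 2k (n div k), and 10 is twice the error 5 of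
    \<open>all_sum\<close>.\<close>
  define c where "c k = (I / 2 * ln (2 * real k) + 10) / real k ^ 2" for k :: nat
  have c0: "c k \<ge> 0" for k
    using I_bounds unfolding c_def by (cases "k = 0") (auto intro!: divide_nonneg_nonneg add_nonneg_nonneg mult_nonneg_nonneg)
  have "summable c"
  proof (rule summable_comparison_test_bigo)
    show "summable (\<lambda>k. norm (real k powr (- 3 / 2)))"
      by (simp add: summable_real_powr_iff)
    have "(\<lambda>k. (J / 2 * ln (2 * real k) + 10) / (real k)\<^sup>2) \<in> O(\<lambda>k. real k powr (- 3 / 2))"
      if "J > 0" for J :: real
      using that by real_asymp
    then show "c \<in> O(\<lambda>k. real k powr (- 3 / 2))"
      using I_bounds(1) unfolding c_def by blast
  qed
  define C where "C = suminf c"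
  have diff: "prim_sum n - prim_sum (n div k) \<le> I / 2 * ln (2 * real k) + 10" if "k \<in> D n" for n k
  proof -
    have k: "1 \<le> k" "k \<le> n" using that by (auto simp: D_def)
    have m: "n div k \<ge> 1"
      using k by (simp add: Suc_leI div_greater_zero_iff)
    have "n < k + k * (n div k)"
      using k by (intro dividend_less_times_div) simp
    moreover have "k * 1 \<le> k * (n div k)"
      using m by (rule mult_le_mono2)
    ultimately have "n \<le> 2 * k * (n div k)"
      by linarith
    then have "real n \<le> real (2 * k * (n div k))"
      by (simp only: of_nat_le_iff)
    then have "ln (real n) \<le> ln (2 * real k * real (n div k))"
      using k by (subst ln_le_cancel_iff) auto
    also have "\<dots> = ln (2 * real k) + ln (real (n div k))"
      using k m by (simp add: ln_mult)
    finally have "I / 2 * ln (real n) \<le> I / 2 * (ln (2 * real k) + ln (real (n div k)))"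
      using I_bounds by (intro mult_left_mono) auto
    also have "\<dots> = I / 2 * ln (2 * real k) + I / 2 * ln (real (n div k))"
      by (rule distrib_left)
    finally have "I / 2 * ln (real n) \<le> I / 2 * ln (2 * real k) + I / 2 * ln (real (n div k))" .
    then show ?thesis
      using prim_sum_le_all_sum_diff(1)[of "n div k" n] all_sum_bounds[of n] all_sum_bounds[of "n div k"] k m
      unfolding abs_le_iff by simp
  qed
  have up: "all_sum n \<le> prim_sum n * S n" for n
    unfolding all_sum_eq_prim_sums S_def sum_distrib_left D_def
    by (intro sum_mono) (auto intro!: divide_right_mono prim_sum_le_all_sum_diff(2))
  have low: "prim_sum n * S n \<le> all_sum n + C" for n
  proof -
    have "prim_sum n * S n - all_sum n = (\<Sum>k\<in>D n. (prim_sum n - prim_sum (n div k)) / real k ^ 2)"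
      unfolding all_sum_eq_prim_sums S_def sum_distrib_left D_def
      by (simp add: sum_subtractf diff_divide_distrib)
    also have "\<dots> \<le> (\<Sum>k\<in>D n. c k)"
      unfolding c_def by (intro sum_mono divide_right_mono diff) auto
    also have "\<dots> \<le> C"
      unfolding C_def by (intro sum_le_suminf \<open>summable c\<close>) (auto simp: c0 D_def)
    finally show ?thesis by simp
  qed
  have S: "S \<longlonglongrightarrow> pi\<^sup>2 / 8"
    using odd_inverse_squares_tendsto unfolding S_def D_def by simp
  have lim: "(\<lambda>n. (I / 2 * ln (real n) + B) / ln (real n)) \<longlonglongrightarrow> I / 2" for B
  proof -
    have "(\<lambda>n. I / 2 + B / ln (real n)) \<longlonglongrightarrow> I / 2 + 0"
      by (intro tendsto_intros) real_asymp
    then have "(\<lambda>n. I / 2 + B / ln (real n)) \<longlonglongrightarrow> I / 2"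
      by simp
    then show ?thesis
      by (rule Lim_transform_eventually)
        (auto intro!: eventually_mono[OF eventually_gt_at_top[of 1]] simp: field_simps)
  qed
  have "(\<lambda>n. prim_sum n * S n / ln (real n)) \<longlonglongrightarrow> I / 2"
  proof (rule tendsto_sandwich[OF _ _ lim[of "-5"] lim[of "C + 5"]])
    show "eventually (\<lambda>n. (I / 2 * ln (real n) + (- 5)) / ln (real n) \<le> prim_sum n * S n / ln (real n)) sequentially"
      using eventually_gt_at_top[of 1]
    proof eventually_elim
      case (elim n)
      then show ?case
        using up[of n] all_sum_bounds[of n] unfolding abs_le_iff by (intro divide_right_mono) auto
    qed
    show "eventually (\<lambda>n. prim_sum n * S n / ln (real n) \<le> (I / 2 * ln (real n) + (C + 5)) / ln (real n)) sequentially"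
      using eventually_gt_at_top[of 1]
    proof eventually_elim
      case (elim n)
      then show ?case
        using low[of n] all_sum_bounds[of n] unfolding abs_le_iff by (intro divide_right_mono) auto
    qed
  qed
  from tendsto_divide[OF this S] have "(\<lambda>n. prim_sum n * S n / ln (real n) / S n) \<longlonglongrightarrow> I / 2 / (pi\<^sup>2 / 8)"
    by simp
  moreover have "I / 2 / (pi\<^sup>2 / 8) = 4 * I / pi\<^sup>2"
    by simp
  ultimately have "(\<lambda>n. prim_sum n * S n / ln (real n) / S n) \<longlonglongrightarrow> 4 * I / pi\<^sup>2"
    by simp
  then show ?thesis
  proof (rule Lim_transform_eventually)
    have "eventually (\<lambda>n. S n > 0) sequentially"
      using S by (rule order_tendstoD) simp
    then show "eventually (\<lambda>n. prim_sum n * S n / ln (real n) / S n = prim_sum n / ln (real n)) sequentially"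
      by eventually_elim simp
  qed
qed

end

subsection \<open>Gaussian sums over Pythagorean triples\<close>

lemma inverse_squares_tail_le:
  assumes "n > 0" "n \<le> m"
  shows "(\<Sum>k=n + 1..m. 1 / real k ^ 2) \<le> 1 / real n - 1 / real m"
  using assms(2)
proof (induction m rule: dec_induct)
  case (step m)
  have "m > 0" using step assms by simp
  have "1 / real (Suc m) ^ 2 \<le> 1 / (real m * real (Suc m))"
    unfolding power2_eq_square by (intro frac_le mult_right_mono) (use \<open>m > 0\<close> in auto)
  also have "\<dots> = 1 / real m - 1 / real (Suc m)"
    using \<open>m > 0\<close> by (simp add: field_simps)
  finally show ?case
    using step by simp
qed simp

lemma odd_inverse_squares_le: "(\<Sum>j<K. 1 / real (2 * j + 1) ^ 2) \<le> 2"
proof -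
  have "(\<Sum>j<K. 1 / real (2 * j + 1) ^ 2) \<le> (\<Sum>j<K. 1 / real (j + 1) ^ 2)"
    by (intro sum_mono divide_left_mono power_mono) auto
  also have "\<dots> = (\<Sum>k=1..K. 1 / real k ^ 2)"
    by (rule sum.reindex_bij_witness[of _ "\<lambda>k. k - 1" "\<lambda>k. k + 1"]) auto
  also have "\<dots> \<le> 2"
    by (rule order.trans[OF inverse_squares_le]) simp
  finally show ?thesis .
qed

lemma exp_neg_le_inverse: "y > 0 \<Longrightarrow> exp (- y) \<le> 1 / (y :: real)"
proof -
  assume "y > 0"
  moreover have "y \<le> exp y"
    using exp_ge_add_one_self[of y] by linarith
  ultimately show ?thesis
    by (simp add: exp_minus field_simps)
qed

context angular_weight
begin

text \<open>In terms of the quartic form \<open>q = u^4 / H(v/u)^2\<close> this is \<open>exp (- d^2 q / x^2)\<close>.\<close>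

definition wt :: "real \<Rightarrow> nat \<times> nat \<times> nat \<Rightarrow> real" where
  "wt x = (\<lambda>(d, u, v). exp (- (real d * real u ^ 2 / (x * Hq u v))\<^sup>2))"

lemma wt_nonneg: "wt x t \<ge> 0"
  by (simp add: wt_def split: prod.splits)

abbreviation triple_box :: "nat set \<Rightarrow> (nat \<Rightarrow> nat) \<Rightarrow> (nat \<times> nat \<times> nat) set" where
  "triple_box A K \<equiv> (\<lambda>(u, v, j). (2 * j + 1, u, v)) ` (SIGMA u:A. SIGMA v:cop u. {..<K u})"

lemma sum_wt_box:
  "(\<Sum>t\<in>triple_box A K. wt x t)
    = (\<Sum>u\<in>A. \<Sum>v\<in>cop u. \<Sum>j<K u. exp (- (real u ^ 2 / (x * Hq u v) * real (2 * j + 1))\<^sup>2))"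
  if "finite A"
proof -
  have inj: "inj_on (\<lambda>(u, v, j). (2 * j + 1, u, v)) B" for B :: "(nat \<times> nat \<times> nat) set"
    by (auto simp: inj_on_def)
  have "wt x \<circ> (\<lambda>(u, v, j). (2 * j + 1, u, v))
    = (\<lambda>(u, v, j). exp (- (real u ^ 2 / (x * Hq u v) * real (2 * j + 1))\<^sup>2))"
    by (auto simp: fun_eq_iff wt_def mult.commute)
  then show ?thesis
    using that by (subst sum.reindex[OF inj]) (simp add: sum.Sigma del: of_nat_add of_nat_mult)
qed

text \<open>The cut at u = sqrt x balances the errors. Below it, the sum over \<open>d\<close> has
  the error 1 for each of at most n^2 <= x pairs. Above it, exp (-y) <= 1/y bounds the sum over
  \<open>d\<close> by 2x^2/u^4; a row has at most \<open>u\<close> entries, and the sum of 2x^2/u^3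
  over u > n is at most 4x. Together this is the 5x.\<close>

lemma triples_sum_upper:
  assumes x: "x \<ge> 1" and T: "finite T" "T \<subseteq> triples"
  defines "n \<equiv> nat \<lfloor>sqrt x\<rfloor>"
  shows "(\<Sum>t\<in>T. wt x t) \<le> sqrt pi / 4 * x * prim_sum n + 5 * x"
proof -
  \<comment> \<open>\<open>M\<close> bounds every \<open>d\<close> and \<open>u\<close> occurring in
    \<open>T\<close>, so that \<open>T\<close> lies in a finite box; the estimates below do not
    depend on \<open>M\<close>.\<close>
  define M where "M = n + (\<Sum>(d, u, v)\<in>T. d + u)"
  define e where "e u v j = exp (- (real u ^ 2 / (x * Hq u v) * real (2 * j + 1))\<^sup>2)" for u v j :: nat
  define g where "g u = (\<Sum>v\<in>cop u. \<Sum>j<M + 1. e u v j)" for u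
  have sx: "sqrt x \<ge> 1"
    using x by simp
  have n: "n \<ge> 1" "real n \<le> sqrt x" "sqrt x < real n + 1"
    unfolding n_def using sx by (auto simp: le_nat_iff le_floor_iff)
  have mem: "d \<le> M" "u \<le> M" if "(d, u, v) \<in> T" for d u v
  proof -
    have "d + u \<le> (\<Sum>(d, u, v)\<in>T. d + u)"
      using member_le_sum[of "(d, u, v)" T "\<lambda>(d, u, v). d + u"] that T by auto
    then show "d \<le> M" "u \<le> M" by (auto simp: M_def)
  qed
  have "T \<subseteq> triple_box {1..M} (\<lambda>_. M + 1)"
  proof
    fix t assume t: "t \<in> T"
    obtain d u v where duv: "t = (d, u, v)" by (rule prod_cases3)
    have "(d, u, v) \<in> triples" using t T duv by auto
    moreover from this have "d = 2 * (d div 2) + 1"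
      by (auto simp: triples_def)
    ultimately show "t \<in> triple_box {1..M} (\<lambda>_. M + 1)"
      using mem[of d u v] t unfolding duv
      by (intro image_eqI[of _ _ "(u, v, d div 2)"]) (auto simp: triples_def cop_def opp_def)
  qed
  then have "(\<Sum>t\<in>T. wt x t) \<le> (\<Sum>t\<in>triple_box {1..M} (\<lambda>_. M + 1). wt x t)"
    by (intro sum_mono2) (auto intro!: finite_imageI finite_SigmaI simp: wt_nonneg)
  also have "\<dots> = (\<Sum>u=1..M. g u)"
    unfolding g_def e_def by (rule sum_wt_box) simp
  also have "{1..M} = {1..n} \<union> {n + 1..M}"
    by (auto simp: M_def)
  also have "(\<Sum>u\<in>\<dots>. g u) = (\<Sum>u=1..n. g u) + (\<Sum>u=n + 1..M. g u)"
    by (rule sum.union_disjoint) auto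
  also have "(\<Sum>u=1..n. g u) \<le> (\<Sum>u=1..n. real n + sqrt pi / 4 * x * (\<Sum>v\<in>cop u. Hq u v / real u ^ 2))"
  proof (rule sum_mono)
    fix u assume u: "u \<in> {1..n}"
    have "g u \<le> (\<Sum>v\<in>cop u. 1 + sqrt pi / 4 * x * (Hq u v / real u ^ 2))"
      unfolding g_def
    proof (rule sum_mono)
      fix v
      have "0 < real u ^ 2 / (x * Hq u v)"
        using u x pos[of "real v / real u"] by auto
      from odd_gauss_sum_bounds(1)[OF this, of "M + 1"]
      show "(\<Sum>j<M + 1. e u v j) \<le> 1 + sqrt pi / 4 * x * (Hq u v / real u ^ 2)"
        unfolding e_def by simp
    qed
    also have "\<dots> = real (card (cop u)) + sqrt pi / 4 * x * (\<Sum>v\<in>cop u. Hq u v / real u ^ 2)"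
      by (simp add: sum.distrib sum_distrib_left)
    finally show "g u \<le> real n + sqrt pi / 4 * x * (\<Sum>v\<in>cop u. Hq u v / real u ^ 2)"
      using card_cop[of u] u by simp
  qed
  also have "\<dots> = real n * real n + sqrt pi / 4 * x * prim_sum n"
    unfolding prim_sum_def by (simp add: sum.distrib sum_distrib_left)
  also have "real n * real n \<le> x"
    using mult_mono[OF n(2,2)] x by simp
  also have "(\<Sum>u=n + 1..M. g u) \<le> (\<Sum>u=n + 1..M. 2 * x\<^sup>2 / sqrt x * (1 / real u ^ 2))"
  proof (rule sum_mono)
    fix u assume u: "u \<in> {n + 1..M}"
    then have u0: "real u > 0" "sqrt x \<le> real u"
      using n by auto
    have "g u \<le> (\<Sum>v\<in>cop u. 2 * x\<^sup>2 / real u ^ 4)"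
      unfolding g_def
    proof (rule sum_mono)
      fix v
      have "(\<Sum>j<M + 1. e u v j) \<le> (\<Sum>j<M + 1. x\<^sup>2 / real u ^ 4 * (1 / real (2 * j + 1) ^ 2))"
      proof (rule sum_mono)
        fix j
        define h where "h = Hq u v"
        have h: "0 < h" "h \<le> 1" using pos le1 by (auto simp: h_def)
        have "x * h \<le> x * 1" using x h by (intro mult_left_mono) auto
        then have "real u ^ 2 / x * real (2 * j + 1) \<le> real u ^ 2 / (x * h) * real (2 * j + 1)"
          using x h u0 by (intro mult_right_mono divide_left_mono) auto
        then have "(real u ^ 2 / x * real (2 * j + 1))\<^sup>2 \<le> (real u ^ 2 / (x * h) * real (2 * j + 1))\<^sup>2"
          using x by (intro power_mono) auto
        then have "e u v j \<le> exp (- (real u ^ 2 / x * real (2 * j + 1))\<^sup>2)"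
          unfolding e_def h_def by simp
        also have "\<dots> \<le> 1 / (real u ^ 2 / x * real (2 * j + 1))\<^sup>2"
          using x u0 by (intro exp_neg_le_inverse zero_less_power mult_pos_pos divide_pos_pos) auto
        also have "\<dots> = x\<^sup>2 / real u ^ 4 * (1 / real (2 * j + 1) ^ 2)"
          by (simp add: power_mult_distrib power_divide)
        finally show "e u v j \<le> \<dots>" .
      qed
      also have "\<dots> \<le> x\<^sup>2 / real u ^ 4 * 2"
        unfolding sum_distrib_left[symmetric] by (intro mult_left_mono odd_inverse_squares_le) auto
      finally show "(\<Sum>j<M + 1. e u v j) \<le> 2 * x\<^sup>2 / real u ^ 4"
        by (simp only: mult.commute times_divide_eq_right)
    qed
    also have "\<dots> = real (card (cop u)) * (2 * x\<^sup>2 / real u ^ 4)"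
      by simp
    also have "\<dots> \<le> real u * (2 * x\<^sup>2 / real u ^ 4)"
      using card_cop[of u] by (intro mult_right_mono) auto
    also have "\<dots> = 2 * x\<^sup>2 / real u * (1 / real u ^ 2)"
      using u0 by (simp add: power2_eq_square power4_eq_xxxx)
    also have "\<dots> \<le> 2 * x\<^sup>2 / sqrt x * (1 / real u ^ 2)"
      using u0(2) sx by (intro mult_right_mono frac_le) auto
    finally show "g u \<le> 2 * x\<^sup>2 / sqrt x * (1 / real u ^ 2)" .
  qed
  also have "\<dots> \<le> 2 * x\<^sup>2 / sqrt x * (2 / sqrt x)"
    unfolding sum_distrib_left[symmetric]
  proof (rule mult_left_mono)
    have "(\<Sum>u=n + 1..M. 1 / real u ^ 2) \<le> 1 / real n - 1 / real M"
      using n by (intro inverse_squares_tail_le) (auto simp: M_def)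
    also have "\<dots> \<le> 1 / real n" by simp
    also have "\<dots> \<le> 2 / sqrt x"
    proof -
      have "sqrt x \<le> 2 * real n"
        using n by linarith
      then have "2 / (2 * real n) \<le> 2 / sqrt x"
        using sx by (intro frac_le) auto
      then show ?thesis by simp
    qed
    finally show "(\<Sum>u=n + 1..M. 1 / real u ^ 2) \<le> 2 / sqrt x" .
  qed (use x in auto)
  also have "\<dots> = 4 * x"
    using x by (simp add: power2_eq_square)
  finally show ?thesis by simp
qed

text \<open>The truncation d u^2 <= Y x keeps the associated points at height O(x), where the
  Gaussian approximation is valid. It replaces sqrt pi / 2 by \<open>gauss_int Y\<close>, a loss
  that disappears as \<open>Y\<close> grows.\<close>

lemma triples_sum_lower:
  assumes x: "x \<ge> 1" and Y: "Y \<ge> 0"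
  defines "n \<equiv> nat \<lfloor>sqrt x\<rfloor>"
  defines "T \<equiv> {(d, u, v) \<in> triples. u \<le> n \<and> real d * real u ^ 2 \<le> Y * x}"
  shows "finite T" "gauss_int Y / 2 * x * prim_sum n - x / 2 \<le> (\<Sum>t\<in>T. wt x t)"
proof -
  have sx: "sqrt x \<ge> 1"
    using x by simp
  have n: "n \<ge> 1" "real n \<le> sqrt x"
    unfolding n_def using sx by (auto simp: le_nat_iff le_floor_iff)
  have "T \<subseteq> {..nat \<lfloor>Y * x\<rfloor>} \<times> {..n} \<times> {..n}"
  proof
    fix t assume "t \<in> T"
    moreover obtain d u v where duv: "t = (d, u, v)" by (rule prod_cases3)
    ultimately have t: "(d, u, v) \<in> triples" "u \<le> n" "real d * real u ^ 2 \<le> Y * x"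
      by (auto simp: T_def)
    then have "1 \<le> u" "v < u" by (auto simp: triples_def)
    then have "real d * 1 \<le> real d * real u ^ 2"
      by (intro mult_left_mono) (auto simp: one_le_power)
    then have "real d \<le> Y * x" using t by simp
    then show "t \<in> {..nat \<lfloor>Y * x\<rfloor>} \<times> {..n} \<times> {..n}"
      using t \<open>v < u\<close> by (simp add: duv le_nat_floor)
  qed
  then show fin: "finite T"
    by (rule finite_subset) auto
  \<comment> \<open>The number of odd \<open>d\<close> with d <= Y x / u^2.\<close>
  define K where "K u = nat \<lfloor>(Y * x / real u ^ 2 + 1) / 2\<rfloor>" for u :: nat
  have K: "real (K u) \<le> (Y * x / real u ^ 2 + 1) / 2" "(Y * x / real u ^ 2 + 1) / 2 < real (K u) + 1" for u
  proof -
    have "0 \<le> (Y * x / real u ^ 2 + 1) / 2"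
      using Y x by auto
    then show "real (K u) \<le> (Y * x / real u ^ 2 + 1) / 2" "(Y * x / real u ^ 2 + 1) / 2 < real (K u) + 1"
      unfolding K_def by linarith+
  qed
  have "n * n \<le> x"
    using mult_mono[OF n(2,2)] x by simp
  have "(\<Sum>u=1..n. \<Sum>v\<in>cop u. gauss_int Y / 2 * x * (Hq u v / real u ^ 2) - 1 / 2)
      \<le> (\<Sum>u=1..n. \<Sum>v\<in>cop u. \<Sum>j<K u. exp (- (real u ^ 2 / (x * Hq u v) * real (2 * j + 1))\<^sup>2))"
  proof (intro sum_mono)
    fix u v assume u: "u \<in> {1..n}"
    define h where "h = Hq u v"
    have h: "0 < h" "h \<le> 1" using pos le1 by (auto simp: h_def)
    have r: "0 < real u ^ 2 / (x * h)"
      using u x h by auto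
    have "x * h \<le> x * 1" using x h by (intro mult_left_mono) auto
    then have "real u ^ 2 / x \<le> real u ^ 2 / (x * h)"
      using x h by (intro divide_left_mono) auto
    moreover have "Y * x / real u ^ 2 \<le> real (2 * K u + 1)"
      using K(2)[of u] by simp
    ultimately have "real u ^ 2 / x * (Y * x / real u ^ 2) \<le> real u ^ 2 / (x * h) * real (2 * K u + 1)"
      using x Y r by (intro mult_mono) auto
    then have "Y \<le> real u ^ 2 / (x * h) * real (2 * K u + 1)"
      using x u by simp
    from odd_gauss_sum_bounds(2)[OF r Y this]
    show "gauss_int Y / 2 * x * (Hq u v / real u ^ 2) - 1 / 2
       \<le> (\<Sum>j<K u. exp (- (real u ^ 2 / (x * Hq u v) * real (2 * j + 1))\<^sup>2))"
      unfolding h_def by simp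
  qed
  also have "\<dots> = (\<Sum>t\<in>triple_box {1..n} K. wt x t)"
    by (rule sum_wt_box[symmetric]) simp
  also have "\<dots> \<le> (\<Sum>t\<in>T. wt x t)"
  proof (rule sum_mono2[OF fin])
    show "triple_box {1..n} K \<subseteq> T"
    proof
      fix t assume "t \<in> triple_box {1..n} K"
      then obtain u v j where t: "t = (2 * j + 1, u, v)"
        and u: "u \<in> {1..n}" and v: "v \<in> cop u" and j: "j \<in> {..<K u}"
        by auto
      have "real (2 * j + 1) \<le> 2 * real (K u) - 1"
        using j by auto
      also have "\<dots> \<le> Y * x / real u ^ 2"
        using K(1)[of u] by simp
      finally have "real (2 * j + 1) * real u ^ 2 \<le> Y * x"
        using u by (simp add: pos_le_divide_eq)
      then show "t \<in> T"
        using u v unfolding t by (auto simp: T_def triples_def cop_def opp_def)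
    qed
  qed (simp add: wt_nonneg)
  finally have main: "(\<Sum>u=1..n. \<Sum>v\<in>cop u. gauss_int Y / 2 * x * (Hq u v / real u ^ 2) - 1 / 2)
      \<le> (\<Sum>t\<in>T. wt x t)" .
  have "(\<Sum>u=1..n. \<Sum>v\<in>cop u. gauss_int Y / 2 * x * (Hq u v / real u ^ 2) - 1 / 2)
      = gauss_int Y / 2 * x * prim_sum n - (\<Sum>u=1..n. real (card (cop u)) / 2)"
    unfolding prim_sum_def sum_distrib_left sum_subtractf by simp
  moreover have "(\<Sum>u=1..n. real (card (cop u)) / 2) \<le> (\<Sum>u=1..n. real n / 2)"
  proof (rule sum_mono)
    fix u assume "u \<in> {1..n}"
    then show "real (card (cop u)) / 2 \<le> real n / 2"
      using card_cop[of u] by simp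
  qed
  ultimately show "gauss_int Y / 2 * x * prim_sum n - x / 2 \<le> (\<Sum>t\<in>T. wt x t)"
    using main \<open>n * n \<le> x\<close> by simp
qed

end

text \<open>\<open>norm_pr\<close> makes the Gaussian weight of a point depend on its parameters
  exactly as in \<open>wt\<close>. The crude \<open>pr_le\<close> serves to place the triples with d
  u^2 <= Y x inside the window.\<close>

locale pythagorean_weight = angular_weight +
  fixes pr :: "nat \<times> nat \<times> nat \<Rightarrow> nat \<times> nat" and P :: "(nat \<times> nat) set"
  assumes bij: "bij_betw pr triples P"
    and norm_pr: "(d, u, v) \<in> triples \<Longrightarrow> pr (d, u, v) = (a, c) \<Longrightarrow>
      real a ^ 2 + real c ^ 2 = (real d * real u ^ 2 / H (real v / real u)) ^ 2"
    and pr_le: "(d, u, v) \<in> triples \<Longrightarrow> pr (d, u, v) = (a, c) \<Longrightarrow> a \<le> 2 * d * u ^ 2 \<and> c \<le> 2 * d * u ^ 2"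
begin

text \<open>The denominator 16 N is twice the variance 8 N of either coordinate; by
  \<open>norm_pr\<close> the summand is \<open>wt\<close> at x = 4 sqrt N. Only the positive
  quadrant is summed; signs are restored later.\<close>

definition gauss_sum :: "nat \<Rightarrow> real" where
  "gauss_sum N = (\<Sum>(a, c)\<in>{(a, c) \<in> P. real a \<le> real N powr (3/5) \<and> real c \<le> real N powr (3/5)}.
     exp (- (real a ^ 2 + real c ^ 2) / (16 * real N)))"

lemma gauss_sum_eq:
  assumes N: "N > 0"
  defines "T \<equiv> {t \<in> triples. real (fst (pr t)) \<le> real N powr (3/5) \<and> real (snd (pr t)) \<le> real N powr (3/5)}"
  shows "finite T" "gauss_sum N = (\<Sum>t\<in>T. wt (4 * sqrt (real N)) t)"
proof -
  define Q where "Q = {(a, c) \<in> P. real a \<le> real N powr (3/5) \<and> real c \<le> real N powr (3/5)}"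
  have "Q \<subseteq> {..nat \<lfloor>real N powr (3/5)\<rfloor>} \<times> {..nat \<lfloor>real N powr (3/5)\<rfloor>}"
    by (auto simp: Q_def le_nat_floor)
  then have finQ: "finite Q"
    by (rule finite_subset) auto
  have img: "pr ` T = Q"
  proof (intro equalityI subsetI)
    fix q assume "q \<in> pr ` T"
    then obtain t where "t \<in> T" "q = pr t" by auto
    moreover from this have "pr t \<in> P"
      using bij by (auto simp: T_def bij_betw_def)
    ultimately show "q \<in> Q"
      by (cases q) (auto simp: Q_def T_def)
  next
    fix q assume "q \<in> Q"
    moreover from this have "q \<in> pr ` triples"
      using bij by (auto simp: Q_def bij_betw_def)
    then obtain t where "t \<in> triples" "q = pr t" by auto
    ultimately have "t \<in> T"
      by (auto simp: Q_def T_def split: prod.splits)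
    then show "q \<in> pr ` T"
      using \<open>q = pr t\<close> by blast
  qed
  have inj: "inj_on pr T"
    using bij unfolding bij_betw_def T_def by (auto intro: inj_on_subset)
  show "finite T"
    using finQ img inj by (metis finite_imageD)
  have "gauss_sum N = (\<Sum>t\<in>T. case pr t of (a, c) \<Rightarrow> exp (- (real a ^ 2 + real c ^ 2) / (16 * real N)))"
    unfolding gauss_sum_def Q_def[symmetric] img[symmetric] by (subst sum.reindex[OF inj]) (simp add: o_def)
  also have "\<dots> = (\<Sum>t\<in>T. wt (4 * sqrt (real N)) t)"
  proof (rule sum.cong)
    fix t assume "t \<in> T"
    moreover obtain d u v where duv: "t = (d, u, v)" by (rule prod_cases3)
    moreover obtain a c where ac: "pr t = (a, c)" by force
    ultimately have "real a ^ 2 + real c ^ 2 = (real d * real u ^ 2 / Hq u v) ^ 2"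
      using norm_pr by (auto simp: T_def)
    moreover have "(real d * real u ^ 2 / (4 * sqrt (real N) * Hq u v))\<^sup>2
        = (real d * real u ^ 2 / Hq u v) ^ 2 / (16 * real N)"
      by (simp add: power_divide power_mult_distrib)
    ultimately show "(case pr t of (a, c) \<Rightarrow> exp (- (real a ^ 2 + real c ^ 2) / (16 * real N))) = wt (4 * sqrt (real N)) t"
      by (simp only: ac[unfolded duv] wt_def duv prod.case minus_divide_left)
  qed simp
  finally show "gauss_sum N = (\<Sum>t\<in>T. wt (4 * sqrt (real N)) t)" .
qed

text \<open>For x = 4 sqrt N the cut lies at n ~ 2 N^(1/4), so ln n ~ (ln N)/4. The constant is the
  product of sqrt pi / 4 from the sum over \<open>d\<close>, 4 from \<open>x\<close>, 4 I / pi^2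
  from the coprime pairs and 1/4 from the logarithm.\<close>

lemma gauss_sum_asymp: "(\<lambda>N. gauss_sum N / (sqrt (real N) * ln (real N))) \<longlonglongrightarrow> I / pi powr (3/2)"
proof -
  define n where "n N = nat \<lfloor>sqrt (4 * sqrt (real N))\<rfloor>" for N :: nat
  have n_top: "filterlim n at_top sequentially"
    unfolding n_def by real_asymp
  have "(\<lambda>N. ln (real (n N)) / ln (real N)) \<longlonglongrightarrow> 1 / 4"
    unfolding n_def by real_asymp
  from tendsto_mult[OF filterlim_compose[OF prim_sum_asymp n_top] this]
  have "(\<lambda>N. prim_sum (n N) / ln (real (n N)) * (ln (real (n N)) / ln (real N))) \<longlonglongrightarrow> I / pi\<^sup>2"
    by simp
  moreover have "eventually (\<lambda>N. prim_sum (n N) / ln (real (n N)) * (ln (real (n N)) / ln (real N))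
      = prim_sum (n N) / ln (real N)) sequentially"
    using eventually_compose_filterlim[OF eventually_gt_at_top[of 1] n_top]
    by eventually_elim simp
  ultimately have prim: "(\<lambda>N. prim_sum (n N) / ln (real N)) \<longlonglongrightarrow> I / pi\<^sup>2"
    by (rule Lim_transform_eventually)
  have lim: "(\<lambda>N. (A * (4 * sqrt (real N)) * prim_sum (n N) + B * (4 * sqrt (real N))) / (sqrt (real N) * ln (real N)))
      \<longlonglongrightarrow> 4 * A * (I / pi\<^sup>2)" for A B :: real
  proof -
    have "(\<lambda>N. 4 * A * (prim_sum (n N) / ln (real N)) + 4 * B / ln (real N)) \<longlonglongrightarrow> 4 * A * (I / pi\<^sup>2) + 0"
      by (intro tendsto_add tendsto_mult tendsto_const prim) real_asymp
    then have "(\<lambda>N. 4 * A * (prim_sum (n N) / ln (real N)) + 4 * B / ln (real N)) \<longlonglongrightarrow> 4 * A * (I / pi\<^sup>2)"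
      by simp
    then show ?thesis
      by (rule Lim_transform_eventually)
        (auto intro!: eventually_mono[OF eventually_gt_at_top[of 1]] simp: field_simps)
  qed
  have pi32: "pi\<^sup>2 = sqrt pi * pi powr (3/2)"
    by (simp flip: powr_half_sqrt powr_add add: powr_numeral[symmetric] del: powr_numeral)
  show ?thesis
  proof (rule order_tendstoI)
    fix b assume b: "b < I / pi powr (3/2)"
    \<comment> \<open>\<open>Y\<close> is chosen after \<open>b\<close>: each fixed \<open>Y\<close>
      proves a lower bound whose constant tends to the desired one as \<open>Y\<close>
      grows.\<close>
    have "((\<lambda>Y. 4 * (gauss_int Y / 2) * (I / pi\<^sup>2)) \<longlongrightarrow> 4 * (sqrt pi / 2 / 2) * (I / pi\<^sup>2)) at_top"
      by (intro tendsto_intros gauss_int_tendsto) auto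
    moreover have "4 * (sqrt pi / 2 / 2) * (I / pi\<^sup>2) = I / pi powr (3/2)"
      unfolding pi32 by simp
    ultimately have "eventually (\<lambda>Y. b < 4 * (gauss_int Y / 2) * (I / pi\<^sup>2)) at_top"
      using b by (intro order_tendstoD) auto
    then obtain Y where Y: "Y \<ge> 0" "b < 4 * (gauss_int Y / 2) * (I / pi\<^sup>2)"
      using eventually_happens[OF eventually_conj[OF _ eventually_ge_at_top[of 0]]] by force
    have "eventually (\<lambda>N. b < (gauss_int Y / 2 * (4 * sqrt (real N)) * prim_sum (n N) + (- 1 / 2) * (4 * sqrt (real N))) / (sqrt (real N) * ln (real N))) sequentially"
      using Y by (intro order_tendstoD(1)[OF lim]) auto
    \<comment> \<open>By \<open>pr_le\<close> the truncated triples give coordinates of order sqrt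
      N, hence below N^(3/5) for large N.\<close>
    moreover have "eventually (\<lambda>N. 2 * (Y * (4 * sqrt (real N))) \<le> real N powr (3/5)) sequentially"
      using Y(1) by real_asymp
    ultimately show "eventually (\<lambda>N. b < gauss_sum N / (sqrt (real N) * ln (real N))) sequentially"
      using eventually_gt_at_top[of 1]
    proof eventually_elim
      case (elim N)
      define x where "x = 4 * sqrt (real N)"
      have "1 \<le> sqrt (real N)"
        by (rule real_sqrt_ge_one) (use elim in simp)
      then have x: "x \<ge> 1" unfolding x_def by linarith
      define T where "T = {t \<in> triples. real (fst (pr t)) \<le> real N powr (3/5) \<and> real (snd (pr t)) \<le> real N powr (3/5)}"
      have T: "finite T" "gauss_sum N = (\<Sum>t\<in>T. wt x t)"
        unfolding T_def x_def using gauss_sum_eq[of N] elim by auto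
      have "{(d, u, v) \<in> triples. u \<le> n N \<and> real d * real u ^ 2 \<le> Y * x} \<subseteq> T"
      proof
        fix t assume "t \<in> {(d, u, v) \<in> triples. u \<le> n N \<and> real d * real u ^ 2 \<le> Y * x}"
        then obtain d u v where t: "t = (d, u, v)" "(d, u, v) \<in> triples" "real d * real u ^ 2 \<le> Y * x"
          by auto
        obtain a c where ac: "pr (d, u, v) = (a, c)" by force
        have "real (2 * d * u ^ 2) \<le> real N powr (3/5)"
          using t(3) elim by (simp add: x_def)
        moreover have "real a \<le> real (2 * d * u ^ 2)" "real c \<le> real (2 * d * u ^ 2)"
          using pr_le[OF t(2) ac] by (simp_all only: of_nat_le_iff)
        ultimately show "t \<in> T"
          using t ac unfolding T_def by simp
      qed
      then have "(\<Sum>t\<in>{(d, u, v) \<in> triples. u \<le> n N \<and> real d * real u ^ 2 \<le> Y * x}. wt x t) \<le> gauss_sum N"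
        unfolding T(2) by (intro sum_mono2 T(1)) (auto simp: wt_nonneg)
      then have "gauss_int Y / 2 * x * prim_sum (n N) - x / 2 \<le> gauss_sum N"
        using triples_sum_lower(2)[OF x Y(1)] unfolding n_def x_def by simp
      then have "(gauss_int Y / 2 * x * prim_sum (n N) + (- 1 / 2) * x) / (sqrt (real N) * ln (real N))
          \<le> gauss_sum N / (sqrt (real N) * ln (real N))"
        using elim by (intro divide_right_mono) auto
      then show ?case
        using elim unfolding x_def by linarith
    qed
  next
    fix b assume b: "I / pi powr (3/2) < b"
    have "4 * (sqrt pi / 4) * (I / pi\<^sup>2) = I / pi powr (3/2)"
      unfolding pi32 by simp
    then have "eventually (\<lambda>N. (sqrt pi / 4 * (4 * sqrt (real N)) * prim_sum (n N) + 5 * (4 * sqrt (real N))) / (sqrt (real N) * ln (real N)) < b) sequentially"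
      using b by (intro order_tendstoD(2)[OF lim]) auto
    then show "eventually (\<lambda>N. gauss_sum N / (sqrt (real N) * ln (real N)) < b) sequentially"
      using eventually_gt_at_top[of 1]
    proof eventually_elim
      case (elim N)
      define x where "x = 4 * sqrt (real N)"
      have "1 \<le> sqrt (real N)"
        by (rule real_sqrt_ge_one) (use elim in simp)
      then have x: "x \<ge> 1" unfolding x_def by linarith
      have "gauss_sum N \<le> sqrt pi / 4 * x * prim_sum (n N) + 5 * x"
        using triples_sum_upper[OF x gauss_sum_eq(1), of N] gauss_sum_eq(2)[of N] elim
        unfolding x_def n_def by auto
      then have "gauss_sum N / (sqrt (real N) * ln (real N))
        \<le> (sqrt pi / 4 * x * prim_sum (n N) + 5 * x) / (sqrt (real N) * ln (real N))"
        using elim by (intro divide_right_mono) auto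
      then show ?case
        using elim unfolding x_def by linarith
    qed
  qed
qed

end

subsection \<open>Binomial coefficients as Gaussian weights\<close>

abbreviation cbin :: "nat \<Rightarrow> real" where
  "cbin N \<equiv> real (2 * N choose N)"

lemma binomial_step: "real ((2 * N) choose (N + Suc k)) * real (N + k + 1) = real ((2 * N) choose (N + k)) * (real N - real k)"
proof (cases "k \<le> N")
  case True
  have "(2 * N choose Suc (N + k)) * Suc (N + k) = (2 * N choose (N + k)) * (2 * N - (N + k))"
    using binomial_absorb_comp[of "2 * N" "N + k"] binomial_absorption[of "N + k" "2 * N"]
    by (metis mult.commute)
  then have "real (2 * N choose Suc (N + k)) * real (Suc (N + k)) = real (2 * N choose (N + k)) * real (2 * N - (N + k))"
    by (metis of_nat_mult)
  then show ?thesis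
    using True by (simp add: of_nat_diff add_ac)
next
  case False
  then have "2 * N < N + k" by simp
  then show ?thesis by (simp add: binomial_eq_0)
qed

text \<open>Neighbouring coefficients have the ratio (N + k + 1)/(N - k) = 1 + (2k + 1)/(N - k).
  Estimating it by 1 + y <= exp y with the common denominator N - K, the odd numerators add up to
  k^2. The upper bound uses the inverse ratio in the same way.\<close>

lemma central_ratio_bounds:
  assumes "k \<le> K" "K < N"
  shows "cbin N * exp (- (real k ^ 2) / (real N - real K)) \<le> real (2 * N choose (N + k))"
  using assms(1)
proof (induction k)
  case (Suc k)
  have d: "real N - real K > 0" "real N - real k \<ge> real N - real K" "real N - real k > 0"
    using assms Suc.prems by auto
  have "real (N + k + 1) / (real N - real k) = 1 + (2 * real k + 1) / (real N - real k)"
    using d by (simp add: field_simps)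
  also have "\<dots> \<le> exp ((2 * real k + 1) / (real N - real k))"
    using exp_ge_add_one_self by (simp add: add.commute)
  also have "\<dots> \<le> exp ((2 * real k + 1) / (real N - real K))"
    using d by (simp add: divide_left_mono)
  finally have *: "real (N + k + 1) \<le> exp ((2 * real k + 1) / (real N - real K)) * (real N - real k)"
    using d by (simp add: pos_divide_le_eq)
  have ex: "exp (- (real (Suc k) ^ 2) / (real N - real K)) * exp ((2 * real k + 1) / (real N - real K))
      = exp (- (real k ^ 2) / (real N - real K))"
    by (simp add: exp_add[symmetric] add_divide_distrib[symmetric] power2_eq_square algebra_simps)
  have "cbin N * exp (- (real (Suc k) ^ 2) / (real N - real K)) * real (N + k + 1)
      \<le> cbin N * exp (- (real (Suc k) ^ 2) / (real N - real K))
         * (exp ((2 * real k + 1) / (real N - real K)) * (real N - real k))"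
    using * by (intro mult_left_mono) auto
  also have "\<dots> = cbin N * exp (- (real k ^ 2) / (real N - real K)) * (real N - real k)"
    unfolding ex[symmetric] by simp
  also have "\<dots> \<le> real (2 * N choose (N + k)) * (real N - real k)"
    using Suc d by (intro mult_right_mono) auto
  also have "\<dots> = real (2 * N choose (N + Suc k)) * real (N + k + 1)"
    by (rule binomial_step[symmetric])
  finally show ?case
    by (simp add: mult_le_cancel_right)
qed simp

lemma central_ratio_upper:
  assumes "k \<le> K" "K \<le> N"
  shows "real (2 * N choose (N + k)) \<le> cbin N * exp (- (real k ^ 2) / (real N + real K))"
  using assms(1)
proof (induction k)
  case (Suc k)
  have d: "real N + real K \<ge> real (N + k + 1)" "real (N + k + 1) > 0" "real N - real k \<ge> 0"
    using assms Suc.prems by auto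
  have "(real N - real k) / real (N + k + 1) = 1 + - ((2 * real k + 1) / real (N + k + 1))"
    using d by (simp add: field_simps)
  also have "\<dots> \<le> exp (- ((2 * real k + 1) / real (N + k + 1)))"
    by (rule exp_ge_add_one_self)
  also have "\<dots> \<le> exp (- ((2 * real k + 1) / (real N + real K)))"
    using d by (simp add: divide_left_mono)
  finally have *: "real N - real k \<le> exp (- ((2 * real k + 1) / (real N + real K))) * real (N + k + 1)"
    using d by (simp add: pos_divide_le_eq)
  have ex: "exp (- (real k ^ 2) / (real N + real K)) * exp (- ((2 * real k + 1) / (real N + real K)))
      = exp (- (real (Suc k) ^ 2) / (real N + real K))"
    by (simp add: exp_add[symmetric] add_divide_distrib[symmetric] diff_divide_distrib[symmetric] power2_eq_square algebra_simps)
  have "real (2 * N choose (N + Suc k)) * real (N + k + 1) = real (2 * N choose (N + k)) * (real N - real k)"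
    by (rule binomial_step)
  also have "\<dots> \<le> cbin N * exp (- (real k ^ 2) / (real N + real K)) * (real N - real k)"
    using Suc d by (intro mult_right_mono) auto
  also have "\<dots> \<le> cbin N * exp (- (real k ^ 2) / (real N + real K))
      * (exp (- ((2 * real k + 1) / (real N + real K))) * real (N + k + 1))"
    using * by (intro mult_left_mono) auto
  also have "\<dots> = cbin N * exp (- (real (Suc k) ^ 2) / (real N + real K)) * real (N + k + 1)"
    unfolding ex[symmetric] by simp
  finally show ?case
    by (simp add: mult_le_cancel_right)
qed simp

text \<open>Extension by zero to negative lower index, so that sums over a box of integers need no
  range conditions.\<close>

definition ibinom :: "nat \<Rightarrow> int \<Rightarrow> real" where
  "ibinom n k = (if k < 0 then 0 else real (n choose nat k))"

lemma ibinom_nonneg [simp]: "ibinom n k \<ge> 0"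
  by (simp add: ibinom_def)

lemma ibinom_central_cases:
  obtains "\<bar>e\<bar> \<le> int N" "ibinom (2 * N) (int N + e) = real (2 * N choose (N + nat \<bar>e\<bar>))"
  | "\<bar>e\<bar> > int N" "ibinom (2 * N) (int N + e) = 0"
proof (cases "\<bar>e\<bar> \<le> int N")
  case True
  show ?thesis
  proof (rule that(1)[OF True], cases "e \<ge> 0")
    case True
    then show "ibinom (2 * N) (int N + e) = real (2 * N choose (N + nat \<bar>e\<bar>))"
      by (simp add: ibinom_def nat_add_distrib)
  next
    case False
    then have "nat (int N + e) = 2 * N - (N + nat \<bar>e\<bar>)"
      using True by linarith
    then show "ibinom (2 * N) (int N + e) = real (2 * N choose (N + nat \<bar>e\<bar>))"
      using binomial_symmetric[of "N + nat \<bar>e\<bar>" "2 * N"] \<open>\<bar>e\<bar> \<le> int N\<close>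
      unfolding ibinom_def by simp
  qed
next
  case False
  then have "ibinom (2 * N) (int N + e) = 0"
    by (auto simp: ibinom_def intro!: binomial_eq_0)
  then show ?thesis using that(2) False by simp
qed

text \<open>Three choices of the denominator: K = N gives a bound valid for every \<open>e\<close>,
  used in the tails, and K = |e| gives the sharp pair used in the window.\<close>

lemma ibinom_central_upper:
  "ibinom (2 * N) (int N + e) \<le> cbin N * exp (- (real_of_int e ^ 2) / (2 * real N))"
  "\<bar>e\<bar> \<le> int N \<Longrightarrow> ibinom (2 * N) (int N + e)
    \<le> cbin N * exp (- (real_of_int e ^ 2) / (real N + \<bar>real_of_int e\<bar>))"
  "\<bar>e\<bar> < int N \<Longrightarrow> cbin N * exp (- (real_of_int e ^ 2) / (real N - \<bar>real_of_int e\<bar>))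
    \<le> ibinom (2 * N) (int N + e)"
proof -
  have sq: "real (nat \<bar>e\<bar>) ^ 2 = real_of_int e ^ 2" "real (nat \<bar>e\<bar>) = \<bar>real_of_int e\<bar>"
    by simp_all
  show "ibinom (2 * N) (int N + e) \<le> cbin N * exp (- (real_of_int e ^ 2) / (2 * real N))"
  proof (cases rule: ibinom_central_cases[of e N])
    case 1
    then show ?thesis
      using central_ratio_upper[of "nat \<bar>e\<bar>" N N] unfolding sq(1) mult_2[of "real N"] by simp
  qed simp
  show "ibinom (2 * N) (int N + e) \<le> cbin N * exp (- (real_of_int e ^ 2) / (real N + \<bar>real_of_int e\<bar>))"
    if "\<bar>e\<bar> \<le> int N"
  proof (cases rule: ibinom_central_cases[of e N])
    case 1
    then show ?thesis
      using central_ratio_upper[of "nat \<bar>e\<bar>" "nat \<bar>e\<bar>" N] unfolding sq by simp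
  qed simp
  show "cbin N * exp (- (real_of_int e ^ 2) / (real N - \<bar>real_of_int e\<bar>)) \<le> ibinom (2 * N) (int N + e)"
    if "\<bar>e\<bar> < int N"
  proof (cases rule: ibinom_central_cases[of e N])
    case 1
    then show ?thesis
      using central_ratio_bounds[of "nat \<bar>e\<bar>" "nat \<bar>e\<bar>" N] that unfolding sq by simp
  qed (use that in auto)
qed

text \<open>Removing one sign halves a coefficient near the centre, up to the factor 1 - e/N, which
  tends to 1 uniformly in the window. This is the source of the factors 1/2 attached to sums of 2N -
  1 signs.\<close>

lemma ibinom_pred:
  assumes "N > 0" "\<bar>e\<bar> \<le> int N"
  shows "ibinom (2 * N - 1) (int N + e) = ibinom (2 * N) (int N + e) * (1 / 2) * (1 - real_of_int e / real N)"
proof -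
  define k where "k = nat (int N + e)"
  have k: "int k = int N + e" "k \<le> 2 * N"
    using assms by (auto simp: k_def)
  have "(2 * N - k) * (2 * N choose k) = 2 * N * ((2 * N - 1) choose k)"
    by (rule binomial_absorb_comp)
  then have "real (2 * N - k) * real (2 * N choose k) = 2 * real N * real ((2 * N - 1) choose k)"
    by (metis of_nat_mult of_nat_numeral)
  moreover have "real (2 * N - k) = real N - real_of_int e"
    using k assms by (simp add: of_nat_diff)
  ultimately have "(real N - real_of_int e) * real (2 * N choose k) = 2 * real N * real ((2 * N - 1) choose k)"
    by (simp only:)
  then have "real ((2 * N - 1) choose k) = (real N - real_of_int e) * real (2 * N choose k) / (2 * real N)"
    using assms by simp
  also have "\<dots> = real (2 * N choose k) * (1 / 2) * (1 - real_of_int e / real N)"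
    using assms by (simp add: field_simps)
  finally show ?thesis
    using k unfolding ibinom_def by (simp flip: k_def)
qed

text \<open>The partial Wallis product \<open>W n\<close> equals 16^n divided by (2n + 1) times the
  squared central binomial coefficient, so the limit is Wallis's formula. The square suffices, since
  two local limits are always multiplied.\<close>

lemma central_binomial_asymp:
  "(\<lambda>N. cbin N ^ 2 * pi * real N / 16 ^ N) \<longlonglongrightarrow> 1"
proof -
  define W where "W n = (\<Prod>k=1..n. (4 * real k ^ 2) / (4 * real k ^ 2 - 1))" for n
  have eq: "W n * (real (2 * n choose n) ^ 2 * (2 * real n + 1)) = 16 ^ n" for n
  proof (induction n)
    case (Suc n)
    have b: "real (2 * Suc n choose Suc n) * (real n + 1) = real (2 * n choose n) * (2 * (2 * real n + 1))"
    proof -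
      have "Suc n * (2 * Suc n choose Suc n) = 2 * Suc n * ((2 * n + 1) choose n)"
        using binomial_absorption[of n "2 * Suc n"] by simp
      then have 1: "(2 * Suc n choose Suc n) = 2 * ((2 * n + 1) choose n)"
        by (metis (no_types) mult.assoc mult.commute nat_mult_eq_cancel1 zero_less_Suc)
      have "(2 * n + 1 - n) * ((2 * n + 1) choose n) = (2 * n + 1) * (2 * n choose n)"
        using binomial_absorb_comp[of "2 * n + 1" n] by simp
      then have "(n + 1) * ((2 * n + 1) choose n) = (2 * n + 1) * (2 * n choose n)"
        by simp
      then have "real (n + 1) * real ((2 * n + 1) choose n) = real (2 * n + 1) * real (2 * n choose n)"
        by (metis of_nat_mult)
      then show ?thesis
        unfolding 1 by (simp add: algebra_simps)
    qed
    have WS: "W (Suc n) = W n * (4 * (real n + 1) ^ 2 / ((2 * real n + 1) * (2 * real n + 3)))"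
      unfolding W_def by (simp add: power2_eq_square algebra_simps)
    define B p q s where "B = real (2 * Suc n choose Suc n)" and "p = 2 * real n + 1"
      and "q = 2 * real n + 3" and "s = real n + 1"
    have "q \<noteq> 0" by (simp add: q_def)
    have "W (Suc n) * (B ^ 2 * (2 * real (Suc n) + 1)) = W n * (4 * s ^ 2 / (p * q)) * (B ^ 2 * q)"
      unfolding WS by (simp add: p_def q_def s_def algebra_simps)
    also have "\<dots> = W n * 4 * (B * s) ^ 2 / p"
      using \<open>q \<noteq> 0\<close> by (simp add: power_mult_distrib)
    finally have "W (Suc n) * (B ^ 2 * (2 * real (Suc n) + 1)) = W n * 4 * (B * (real n + 1)) ^ 2 / (2 * real n + 1)"
      unfolding p_def s_def .
    also have "\<dots> = W n * 4 * (real (2 * n choose n) * (2 * (2 * real n + 1))) ^ 2 / (2 * real n + 1)"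
      unfolding B_def b ..
    also have "\<dots> = 16 * (W n * (real (2 * n choose n) ^ 2 * (2 * real n + 1)))"
      by (simp add: power2_eq_square divide_simps) (simp add: algebra_simps)
    finally show ?case
      using Suc by (simp add: B_def)
  qed (simp add: W_def)
  have W: "W \<longlonglongrightarrow> pi / 2"
    unfolding W_def by (rule wallis)
  have "(\<lambda>N. pi * real N / (2 * real N + 1)) \<longlonglongrightarrow> pi / 2"
    by real_asymp
  from tendsto_divide[OF this W] have "(\<lambda>N. (pi * real N / (2 * real N + 1)) / W N) \<longlonglongrightarrow> 1"
    by simp
  then show ?thesis
  proof (rule Lim_transform_eventually)
    have "(pi * real N / (2 * real N + 1)) / W N = cbin N ^ 2 * pi * real N / 16 ^ N" for N
    proof -
      have "W N \<noteq> 0" "cbin N ^ 2 * (2 * real N + 1) \<noteq> 0"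
        using eq[of N] by auto
      then show ?thesis
        unfolding eq[of N, symmetric] by (simp add: divide_simps)
    qed
    then show "eventually (\<lambda>N. (pi * real N / (2 * real N + 1)) / W N = cbin N ^ 2 * pi * real N / 16 ^ N) sequentially"
      by simp
  qed
qed

section \<open>Uniform Gaussian local limits\<close>

abbreviation gauss :: "nat \<Rightarrow> int \<Rightarrow> real" where
  "gauss N a \<equiv> exp (- (real_of_int a ^ 2) / (16 * real N))"

text \<open>The error is relative and the same for all \<open>a\<close> in the window, so it can be
  pulled out of sums over sparse sets such as the Pythagorean points.\<close>

abbreviation gauss_core :: "real \<Rightarrow> (nat \<Rightarrow> int \<Rightarrow> real) \<Rightarrow> (nat \<Rightarrow> real) \<Rightarrow> (nat \<Rightarrow> real) \<Rightarrow> bool" where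
  "gauss_core l f lo hi \<equiv> \<forall>\<^sub>F N in sequentially. \<forall>a. \<bar>real_of_int a\<bar> \<le> real N powr (3/5) \<longrightarrow>
    lo N * (l * cbin N * gauss N a) \<le> f N a \<and> f N a \<le> hi N * (l * cbin N * gauss N a)"

abbreviation gauss_tail :: "(nat \<Rightarrow> int \<Rightarrow> real) \<Rightarrow> (nat \<Rightarrow> real) \<Rightarrow> bool" where
  "gauss_tail f t \<equiv> \<forall>\<^sub>F N in sequentially. \<forall>a. \<bar>real_of_int a\<bar> > real N powr (3/5) \<longrightarrow> f N a \<le> cbin N * t N"

text \<open>The exponent 3/5 only has to lie strictly between 1/2 and 2/3.\<close>

definition gauss_family :: "real \<Rightarrow> (nat \<Rightarrow> int \<Rightarrow> real) \<Rightarrow> bool" where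
  "gauss_family l f \<longleftrightarrow> l > 0 \<and> (\<forall>N a. 0 \<le> f N a) \<and>
    (\<exists>lo hi. lo \<longlonglongrightarrow> 1 \<and> hi \<longlonglongrightarrow> 1 \<and> gauss_core l f lo hi) \<and>
    (\<exists>t. (\<lambda>N. t N * real N ^ 3) \<longlonglongrightarrow> 0 \<and> gauss_tail f t)"

text \<open>Two errors separate the binomial exponent from the Gaussian one. Replacing n - |E| or n
  + |E| by n costs a cubic term of order M^3/n^2, and replacing E by a/4 costs a linear one of order
  M/n. The first tends to 0 for windows below n^(2/3), which is the upper limit on the exponent 3/5;
  the lower limit 1/2 makes the tail negligible.\<close>

lemma exp_perturb:
  fixes E a M n q :: real
  assumes E: "\<bar>4 * E - a\<bar> \<le> 5" and a: "\<bar>a\<bar> \<le> M" and q: "q = (M + 5) / 4" "q < n"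
  defines "\<epsilon> \<equiv> q ^ 3 / (n * (n - q)) + 5 * (2 * M + 5) / (16 * n)"
  shows "exp (- \<epsilon>) * exp (- (a ^ 2) / (16 * n)) \<le> exp (- (E ^ 2) / (n - \<bar>E\<bar>))"
    and "exp (- (E ^ 2) / (n + \<bar>E\<bar>)) \<le> exp \<epsilon> * exp (- (a ^ 2) / (16 * n))"
    and "\<bar>E\<bar> \<le> q"
proof -
  show Eq: "\<bar>E\<bar> \<le> q"
    using E a q by (auto simp: abs_le_iff)
  have n: "n > 0" "n - q > 0" "n - \<bar>E\<bar> \<ge> n - q" "n + \<bar>E\<bar> \<ge> n - q"
    using q Eq by auto
  have q0: "0 \<le> q"
    using Eq by linarith
  have cube: "E ^ 2 * \<bar>E\<bar> \<le> q ^ 3"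
    using power_mono[OF Eq, of 3] by (simp add: power3_eq_cube power2_eq_square abs_mult)
  have "E ^ 2 - a ^ 2 / 16 = (4 * E - a) * (4 * E + a) / 16"
    by (simp add: power2_eq_square algebra_simps)
  then have "\<bar>E ^ 2 - a ^ 2 / 16\<bar> = \<bar>4 * E - a\<bar> * \<bar>4 * E + a\<bar> / 16"
    by (simp only: abs_mult abs_divide abs_numeral)
  also have "\<dots> \<le> 5 * (2 * M + 5) / 16"
  proof -
    have "\<bar>4 * E + a\<bar> \<le> 2 * M + 5"
      using E a by (auto simp: abs_le_iff)
    then show ?thesis
      using E by (intro divide_right_mono mult_mono) auto
  qed
  finally have sq: "\<bar>E ^ 2 - a ^ 2 / 16\<bar> \<le> 5 * (2 * M + 5) / 16" .
  then have sq': "\<bar>E ^ 2 / n - a ^ 2 / (16 * n)\<bar> \<le> 5 * (2 * M + 5) / (16 * n)"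
  proof -
    have "E ^ 2 / n - a ^ 2 / (16 * n) = (E ^ 2 - a ^ 2 / 16) / n"
      by (simp add: diff_divide_distrib)
    then have "\<bar>E ^ 2 / n - a ^ 2 / (16 * n)\<bar> = \<bar>E ^ 2 - a ^ 2 / 16\<bar> / n"
      using n(1) by (simp add: abs_divide)
    also have "\<dots> \<le> 5 * (2 * M + 5) / 16 / n"
      using sq n by (intro divide_right_mono) auto
    finally show ?thesis by simp
  qed
  have "E ^ 2 / (n - \<bar>E\<bar>) - E ^ 2 / n = E ^ 2 * \<bar>E\<bar> / (n * (n - \<bar>E\<bar>))"
    using n by (simp add: field_simps)
  also have "\<dots> \<le> q ^ 3 / (n * (n - q))"
    using n cube q0 by (intro frac_le mult_left_mono mult_pos_pos) auto
  finally have 1: "E ^ 2 / (n - \<bar>E\<bar>) \<le> E ^ 2 / n + q ^ 3 / (n * (n - q))"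
    by simp
  have "E ^ 2 / n - E ^ 2 / (n + \<bar>E\<bar>) = E ^ 2 * \<bar>E\<bar> / (n * (n + \<bar>E\<bar>))"
    using n by (simp add: field_simps)
  also have "\<dots> \<le> q ^ 3 / (n * (n - q))"
    using n cube q0 by (intro frac_le mult_left_mono mult_pos_pos) auto
  finally have 2: "E ^ 2 / n \<le> E ^ 2 / (n + \<bar>E\<bar>) + q ^ 3 / (n * (n - q))"
    by simp
  show "exp (- \<epsilon>) * exp (- (a ^ 2) / (16 * n)) \<le> exp (- (E ^ 2) / (n - \<bar>E\<bar>))"
    using 1 sq' unfolding \<epsilon>_def exp_add[symmetric] exp_le_cancel_iff abs_le_iff by simp
  show "exp (- (E ^ 2) / (n + \<bar>E\<bar>)) \<le> exp \<epsilon> * exp (- (a ^ 2) / (16 * n))"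
    using 2 sq' unfolding \<epsilon>_def exp_add[symmetric] exp_le_cancel_iff abs_le_iff by simp
qed

text \<open>The bound 5 allows for rounding down in a division by 4, at most 3, and for a shift of
  the numerator by 2; it covers the index maps of both degrees. The second family acquires
  \<open>1 / 2\<close> by deletion of one sign.\<close>

lemma gauss_family_ibinom:
  assumes e: "\<And>a. \<bar>4 * e a - a\<bar> \<le> 5"
  shows "gauss_family 1 (\<lambda>N a. ibinom (2 * N) (int N + e a))"
    and "gauss_family (1 / 2) (\<lambda>N a. ibinom (2 * N - 1) (int N + e a))"
proof -
  define M where "M N = real N powr (3/5)" for N :: nat
  define q where "q N = (M N + 5) / 4" for N
  define \<epsilon> where "\<epsilon> N = q N ^ 3 / (real N * (real N - q N)) + 5 * (2 * M N + 5) / (16 * real N)" for N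
  define t where "t N = exp (- (((M N - 5) / 4) ^ 2) / (2 * real N))" for N
  have eps: "\<epsilon> \<longlonglongrightarrow> 0"
    unfolding \<epsilon>_def q_def M_def by real_asymp
  have qN: "(\<lambda>N. q N / real N) \<longlonglongrightarrow> 0"
    unfolding q_def M_def by real_asymp
  have t: "(\<lambda>N. t N * real N ^ 3) \<longlonglongrightarrow> 0"
    unfolding t_def M_def by real_asymp
  have M5: "eventually (\<lambda>N. M N \<ge> 5) sequentially"
    unfolding M_def by real_asymp
  have qlt: "eventually (\<lambda>N. q N < real N) sequentially"
    unfolding q_def M_def by real_asymp
  have e': "\<bar>4 * real_of_int (e a) - real_of_int a\<bar> \<le> 5" for a
    using e[of a] by linarith
  have bounds: "exp (- \<epsilon> N) * (cbin N * gauss N a) \<le> ibinom (2 * N) (int N + e a)"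
    "ibinom (2 * N) (int N + e a) \<le> exp (\<epsilon> N) * (cbin N * gauss N a)"
    "\<bar>real_of_int (e a)\<bar> \<le> q N"
    if N: "q N < real N" and a: "\<bar>real_of_int a\<bar> \<le> M N" for N a
  proof -
    note p = exp_perturb[OF e'[of a] a q_def N, folded \<epsilon>_def]
    show "\<bar>real_of_int (e a)\<bar> \<le> q N" by (rule p(3))
    then have eN: "\<bar>e a\<bar> < int N"
      using N by linarith
    have "cbin N * (exp (- \<epsilon> N) * gauss N a)
        \<le> cbin N * exp (- (real_of_int (e a) ^ 2) / (real N - \<bar>real_of_int (e a)\<bar>))"
      by (intro mult_left_mono p(1)) auto
    also have "\<dots> \<le> ibinom (2 * N) (int N + e a)"
      by (rule ibinom_central_upper(3)[OF eN])
    finally show "exp (- \<epsilon> N) * (cbin N * gauss N a) \<le> ibinom (2 * N) (int N + e a)"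
      by (simp only: mult.left_commute)
    have "ibinom (2 * N) (int N + e a)
        \<le> cbin N * exp (- (real_of_int (e a) ^ 2) / (real N + \<bar>real_of_int (e a)\<bar>))"
      using eN by (intro ibinom_central_upper(2)) simp
    also have "\<dots> \<le> cbin N * (exp (\<epsilon> N) * gauss N a)"
      by (intro mult_left_mono p(2)) auto
    finally show "ibinom (2 * N) (int N + e a) \<le> exp (\<epsilon> N) * (cbin N * gauss N a)"
      by (simp only: mult.left_commute)
  qed
  have tail: "ibinom (2 * N) (int N + e a) \<le> cbin N * t N"
    if N: "M N \<ge> 5" and a: "\<bar>real_of_int a\<bar> > M N" for N a
  proof -
    have "(M N - 5) / 4 \<le> \<bar>real_of_int (e a)\<bar>"
      using e'[of a] a by (auto simp: abs_if split: if_splits)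
    then have "((M N - 5) / 4) ^ 2 \<le> real_of_int (e a) ^ 2"
      using N power_mono[of "(M N - 5) / 4" "\<bar>real_of_int (e a)\<bar>" 2] by simp
    then have "exp (- (real_of_int (e a) ^ 2) / (2 * real N)) \<le> t N"
      unfolding t_def by (simp add: divide_right_mono)
    then have "cbin N * exp (- (real_of_int (e a) ^ 2) / (2 * real N)) \<le> cbin N * t N"
      by (intro mult_left_mono) auto
    then show ?thesis
      using ibinom_central_upper(1)[of N "e a"] by linarith
  qed
  show "gauss_family 1 (\<lambda>N a. ibinom (2 * N) (int N + e a))"
    unfolding gauss_family_def
  proof (intro conjI exI)
    show "(\<lambda>N. exp (- \<epsilon> N)) \<longlonglongrightarrow> 1" "(\<lambda>N. exp (\<epsilon> N)) \<longlonglongrightarrow> 1"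
      using tendsto_exp[OF tendsto_minus[OF eps]] tendsto_exp[OF eps] by simp_all
    show "\<forall>\<^sub>F N in sequentially. \<forall>a. \<bar>real_of_int a\<bar> \<le> real N powr (3/5) \<longrightarrow>
        exp (- \<epsilon> N) * (1 * cbin N * gauss N a) \<le> ibinom (2 * N) (int N + e a) \<and>
        ibinom (2 * N) (int N + e a) \<le> exp (\<epsilon> N) * (1 * cbin N * gauss N a)"
      using qlt by eventually_elim (use bounds in \<open>simp add: M_def\<close>)
    show "(\<lambda>N. t N * real N ^ 3) \<longlonglongrightarrow> 0" by (rule t)
    show "\<forall>\<^sub>F N in sequentially. \<forall>a. \<bar>real_of_int a\<bar> > real N powr (3/5) \<longrightarrow>
        ibinom (2 * N) (int N + e a) \<le> cbin N * t N"
      using M5 by eventually_elim (use tail in \<open>simp add: M_def\<close>)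
  qed auto
  show "gauss_family (1 / 2) (\<lambda>N a. ibinom (2 * N - 1) (int N + e a))"
    unfolding gauss_family_def
  proof (intro conjI exI)
    show "(\<lambda>N. exp (- \<epsilon> N) * (1 - q N / real N)) \<longlonglongrightarrow> 1" "(\<lambda>N. exp (\<epsilon> N) * (1 + q N / real N)) \<longlonglongrightarrow> 1"
      using tendsto_mult[OF tendsto_exp[OF tendsto_minus[OF eps]] tendsto_diff[OF tendsto_const qN]]
        tendsto_mult[OF tendsto_exp[OF eps] tendsto_add[OF tendsto_const qN]] by simp_all
    show "\<forall>\<^sub>F N in sequentially. \<forall>a. \<bar>real_of_int a\<bar> \<le> real N powr (3/5) \<longrightarrow>
        (exp (- \<epsilon> N) * (1 - q N / real N)) * (1 / 2 * cbin N * gauss N a) \<le> ibinom (2 * N - 1) (int N + e a) \<and>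
        ibinom (2 * N - 1) (int N + e a) \<le> (exp (\<epsilon> N) * (1 + q N / real N)) * (1 / 2 * cbin N * gauss N a)"
      using qlt eventually_gt_at_top[of 0]
    proof (eventually_elim, intro allI impI)
      fix N a assume N: "q N < real N" "0 < N" and a: "\<bar>real_of_int a\<bar> \<le> real N powr (3/5)"
      define X where "X = cbin N * gauss N a"
      define b where "b = ibinom (2 * N) (int N + e a)"
      define r where "r = real_of_int (e a) / real N"
      note bd = bounds[OF N(1), of a, folded X_def b_def]
      have a': "\<bar>real_of_int a\<bar> \<le> M N" using a by (simp add: M_def)
      have "\<bar>e a\<bar> \<le> int N"
        using bd(3)[OF a'] N by linarith
      then have ib: "ibinom (2 * N - 1) (int N + e a) = b * (1 / 2) * (1 - r)"
        unfolding b_def r_def by (rule ibinom_pred[OF N(2)])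
      have "\<bar>r\<bar> \<le> q N / real N"
        unfolding r_def using bd(3)[OF a'] by (simp add: abs_divide divide_right_mono)
      then have r: "1 - q N / real N \<le> 1 - r" "1 - r \<le> 1 + q N / real N" by linarith+
      have q1: "0 \<le> 1 - q N / real N" using N by simp
      have X0: "0 \<le> X" by (simp add: X_def)
      have "(exp (- \<epsilon> N) * X) * (1 - q N / real N) \<le> b * (1 - r)"
        using bd(1)[OF a'] r q1 X0 by (intro mult_mono) (auto simp: b_def)
      moreover have "b * (1 - r) \<le> (exp (\<epsilon> N) * X) * (1 + q N / real N)"
        using bd(2)[OF a'] r q1 X0 by (intro mult_mono) auto
      ultimately have "1 / 2 * ((exp (- \<epsilon> N) * X) * (1 - q N / real N)) \<le> 1 / 2 * (b * (1 - r))"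
        "1 / 2 * (b * (1 - r)) \<le> 1 / 2 * ((exp (\<epsilon> N) * X) * (1 + q N / real N))"
        by simp_all
      then show "(exp (- \<epsilon> N) * (1 - q N / real N)) * (1 / 2 * cbin N * gauss N a) \<le> ibinom (2 * N - 1) (int N + e a) \<and>
        ibinom (2 * N - 1) (int N + e a) \<le> (exp (\<epsilon> N) * (1 + q N / real N)) * (1 / 2 * cbin N * gauss N a)"
        unfolding ib mult.assoc[of "1/2"] X_def[symmetric] by (simp only: mult_ac)
    qed
    show "(\<lambda>N. t N * real N ^ 3) \<longlonglongrightarrow> 0" by (rule t)
    show "\<forall>\<^sub>F N in sequentially. \<forall>a. \<bar>real_of_int a\<bar> > real N powr (3/5) \<longrightarrow>
        ibinom (2 * N - 1) (int N + e a) \<le> cbin N * t N"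
      using M5 eventually_gt_at_top[of 0]
    proof (eventually_elim, intro allI impI)
      fix N a assume N: "M N \<ge> 5" "0 < N" and a: "\<bar>real_of_int a\<bar> > real N powr (3/5)"
      have "ibinom (2 * N - 1) (int N + e a) \<le> ibinom (2 * N) (int N + e a)"
      proof (cases "\<bar>e a\<bar> \<le> int N")
        case True
        then have "\<bar>real_of_int (e a) / real N\<bar> \<le> 1"
          using N by (simp add: abs_divide)
        then have "1 / 2 * (1 - real_of_int (e a) / real N) \<le> 1"
          unfolding abs_le_iff by simp
        then have "ibinom (2 * N) (int N + e a) * (1 / 2 * (1 - real_of_int (e a) / real N)) \<le> ibinom (2 * N) (int N + e a) * 1"
          by (intro mult_left_mono) auto
        then show ?thesis
          unfolding ibinom_pred[OF N(2) True] by (simp only: mult.assoc mult_1_right)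
      next
        case False
        then have "ibinom (2 * N - 1) (int N + e a) = 0"
          by (auto simp: ibinom_def intro!: binomial_eq_0)
        then show ?thesis by simp
      qed
      then show "ibinom (2 * N - 1) (int N + e a) \<le> cbin N * t N"
        using tail[of N a] N a by (simp add: M_def)
    qed
  qed auto
qed

subsection \<open>The lemniscate integral\<close>

lemma Gamma_quarter_reflection: "Gamma (1/4) * Gamma (3/4) = pi * sqrt (2 :: real)"
proof -
  have "Gamma (complex_of_real (1/4)) * Gamma (complex_of_real (3/4)) = of_real pi / sin (of_real (pi / 4))"
    using Gamma_reflection_complex[of "1/4"] by simp
  then have "complex_of_real (Gamma (1/4) * Gamma (3/4)) = complex_of_real (pi / sin (pi / 4))"
    unfolding Gamma_complex_of_real by (simp flip: sin_of_real)
  then have "Gamma (1/4) * Gamma (3/4) = pi / sin (pi / 4)"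
    by (simp only: of_real_eq_iff)
  also have "\<dots> = pi * sqrt 2"
    by (simp add: sin_45 real_div_sqrt field_simps)
  finally show ?thesis .
qed

text \<open>The substitution \<open>y = (2t / (1 + t^2))^4\<close> turns \<open>8 / sqrt (1 + 6t^2 + t^4)\<close> into the Beta integrand
  for the parameters \<open>1/4\<close> and \<open>1/2\<close>.\<close>

lemma lemniscate_integral:
  "integral {0..1} (\<lambda>t. 1 / sqrt (1 + 6 * t\<^sup>2 + t ^ 4)) = Gamma (1/4) ^ 2 / (8 * sqrt 2 * sqrt pi)"
proof -
  define s :: "real \<Rightarrow> real" where "s t = 2 * t / (1 + t\<^sup>2)" for t
  define g where "g t = s t ^ 4" for t
  define g' where "g' t = 4 * s t ^ 3 * (2 * (1 - t\<^sup>2) / (1 + t\<^sup>2)\<^sup>2)" for t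
  have nz: "1 + t\<^sup>2 \<noteq> 0" for t :: real
    using add_pos_nonneg[of 1 "t\<^sup>2"] by simp
  have "((\<lambda>t. t powr (1/4 - 1) * (1 - t) powr (1/2 - 1)) has_integral Beta (1/4) (1/2)) {0..1 :: real}"
    by (rule has_integral_Beta_real) auto
  from nn_integral_has_integral_lebesgue[OF _ this]
  have "ennreal (Beta (1/4) (1/2)) = (\<integral>\<^sup>+ t. ennreal (t powr (- 3/4) * (1 - t) powr (- 1/2) * indicator {g 0..g 1} t) \<partial>lborel)"
    by (simp add: mult_ac ennreal_mult' ennreal_indicator g_def s_def)
  also have "\<dots> = (\<integral>\<^sup>+ t. ennreal (g t powr (- 3/4) * (1 - g t) powr (- 1/2) * g' t * indicator {0..1} t) \<partial>lborel)"
  proof (subst nn_integral_substitution[where g = g and g' = g' and a = 0 and b = 1])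
    fix t :: real assume t: "t \<in> {0..1}"
    have "(s has_real_derivative 2 * (1 - t\<^sup>2) / (1 + t\<^sup>2)\<^sup>2) (at t)"
      unfolding s_def using nz[of t]
      by (auto intro!: derivative_eq_intros simp: power2_eq_square field_simps)
    then show "(g has_real_derivative g' t) (at t)"
      unfolding g_def g'_def by (auto intro!: derivative_eq_intros)
    show "0 \<le> g' t"
      using t unfolding g'_def s_def by (intro mult_nonneg_nonneg divide_nonneg_nonneg zero_le_power) (auto simp: power_le_one)
  next
    show "continuous_on {0..1} g'"
      unfolding g'_def s_def using nz by (auto intro!: continuous_intros)
  qed (auto simp: set_borel_measurable_def)
  also have "\<dots> = (\<integral>\<^sup>+ t. ennreal (indicator {0..1} t * (8 * (1 / sqrt (1 + 6 * t\<^sup>2 + t ^ 4)))) \<partial>lborel)"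
  \<comment> \<open>At the end points the Beta integrand has the default value 0 of
    \<open>powr\<close> at base 0, so the integrands agree only off these two points.\<close>
  proof (intro nn_integral_cong_AE AE_I[of _ _ "{0, 1}"])
    show "{t \<in> space lborel. \<not> ennreal (g t powr (- 3/4) * (1 - g t) powr (- 1/2) * g' t * indicator {0..1} t) =
        ennreal (indicator {0..1} t * (8 * (1 / sqrt (1 + 6 * t\<^sup>2 + t ^ 4))))} \<subseteq> {0, 1}"
    proof (rule subsetI, rule ccontr)
      fix t assume t: "t \<in> {t \<in> space lborel. \<not> ennreal (g t powr (- 3/4) * (1 - g t) powr (- 1/2) * g' t * indicator {0..1} t) =
        ennreal (indicator {0..1} t * (8 * (1 / sqrt (1 + 6 * t\<^sup>2 + t ^ 4))))}" "t \<notin> {0, 1}"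
      have "t \<in> {0..1}"
      proof (rule ccontr)
        assume "t \<notin> {0..1}"
        then have "indicator {0..1} t = (0 :: real)" by simp
        then show False using t(1) by simp
      qed
      then have t01: "0 < t" "t < 1"
        using t(2) by auto
      have s0: "s t > 0"
        using t01 by (auto simp: s_def intro!: divide_pos_pos add_pos_nonneg)
      have t2: "t\<^sup>2 < 1" using t01 by (simp add: power_less_one_iff)
      have p1: "g t powr (- 3/4) = 1 / s t ^ 3"
      proof -
        have "s t powr 4 = g t"
          using s0 powr_realpow[of "s t" 4] by (simp add: g_def)
        moreover have "(s t powr 4) powr (- 3/4) = s t powr (4 * (- 3/4))"
          by (rule powr_powr)
        moreover have "s t powr (4 * (- 3/4)) = 1 / s t ^ 3"
          using s0 powr_realpow[of "s t" 3] by (simp add: powr_minus_divide)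
        ultimately show ?thesis by simp
      qed
      define p where "p = 1 + t\<^sup>2"
      have p0: "p > 0" unfolding p_def by (simp add: add_pos_nonneg)
      have "1 - g t = (p ^ 4 - (2 * t) ^ 4) / p ^ 4"
        unfolding g_def s_def p_def[symmetric] using p0 by (simp add: power_divide diff_divide_distrib)
      \<comment> \<open>Here p^4 - (2t)^4 = (p^2 - 4t^2)(p^2 + 4t^2), and p^2 - 4t^2 is the square
        of 1 - t^2, which cancels the zero of g' at t = 1.\<close>
      also have "p ^ 4 - (2 * t) ^ 4 = (1 - t\<^sup>2)\<^sup>2 * (1 + 6 * t\<^sup>2 + t ^ 4)"
        unfolding p_def by (simp add: power2_eq_square power4_eq_xxxx algebra_simps)
      finally have g1: "1 - g t = (1 - t\<^sup>2)\<^sup>2 * (1 + 6 * t\<^sup>2 + t ^ 4) / p ^ 4" .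
      have "sqrt ((p\<^sup>2)\<^sup>2) = \<bar>p\<^sup>2\<bar>"
        by (rule real_sqrt_abs)
      then have "sqrt (p ^ 4) = p\<^sup>2"
        by simp
      then have "sqrt (1 - g t) = (1 - t\<^sup>2) * sqrt (1 + 6 * t\<^sup>2 + t ^ 4) / p\<^sup>2"
        unfolding g1 using t2 by (simp add: real_sqrt_mult real_sqrt_divide)
      moreover have pos: "1 + 6 * t\<^sup>2 + t ^ 4 > 0"
        by (simp add: add_pos_nonneg)
      moreover have "0 < 1 - g t"
        unfolding g1
        using p0 t2 pos by (intro divide_pos_pos mult_pos_pos) auto
      ultimately have p2: "(1 - g t) powr (- 1/2) = p\<^sup>2 / ((1 - t\<^sup>2) * sqrt (1 + 6 * t\<^sup>2 + t ^ 4))"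
        by (simp add: powr_minus_divide powr_half_sqrt)
      have "g t powr (- 3/4) * (1 - g t) powr (- 1/2) * g' t = 8 * (1 / sqrt (1 + 6 * t\<^sup>2 + t ^ 4))"
        unfolding p1 p2 g'_def p_def[symmetric] using s0 p0 t2 pos by (simp add: field_simps)
      then show False
        using t by (simp add: mult.commute)
    qed
  qed (auto simp: emeasure_lborel_countable)
  also have "\<dots> = ennreal (integral {0..1} (\<lambda>t. 8 * (1 / sqrt (1 + 6 * t\<^sup>2 + t ^ 4))))"
  proof (rule nn_integral_has_integral_lebesgue)
    show "((\<lambda>t. 8 * (1 / sqrt (1 + 6 * t\<^sup>2 + t ^ 4))) has_integral integral {0..1} (\<lambda>t. 8 * (1 / sqrt (1 + 6 * t\<^sup>2 + t ^ 4)))) {0..1}"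
    proof (intro integrable_integral integrable_continuous_real continuous_intros ballI)
      fix t :: real
      have "1 + 6 * t\<^sup>2 + t ^ 4 > 0" by (simp add: add_pos_nonneg)
      then show "sqrt (1 + 6 * t\<^sup>2 + t ^ 4) \<noteq> 0" by simp
    qed
  qed auto
  finally have eq: "ennreal (Beta (1/4) (1/2)) = ennreal (integral {0..1} (\<lambda>t. 8 * (1 / sqrt (1 + 6 * t\<^sup>2 + t ^ 4))))" .
  have cancel: "y \<noteq> 0 \<Longrightarrow> x * y / (y * y * z) = x / (z * y)" for x y z :: real
    by simp
  have B: "Beta (1/4) (1/2) = Gamma (1/4) ^ 2 / (sqrt 2 * sqrt pi)"
  proof -
    have G0: "Gamma (1/4 :: real) \<noteq> 0"
      using Gamma_real_pos[of "1/4"] by linarith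
    have "Beta (1/4) (1/2) = Gamma (1/4) * sqrt pi / Gamma (3/4 :: real)"
      by (simp add: Beta_def Gamma_one_half_real)
    also have "Gamma (3/4 :: real) = pi * sqrt 2 / Gamma (1/4)"
      using Gamma_quarter_reflection by (simp add: nonzero_eq_divide_eq[OF G0] mult.commute)
    also have "Gamma (1/4) * sqrt pi / (pi * sqrt 2 / Gamma (1/4)) = Gamma (1/4) ^ 2 * sqrt pi / (sqrt pi * sqrt pi * sqrt 2)"
      by (simp add: power2_eq_square)
    also have "\<dots> = Gamma (1/4) ^ 2 / (sqrt 2 * sqrt pi)"
      by (rule cancel) simp
    finally show ?thesis .
  qed
  have "0 \<le> integral {0..1} (\<lambda>t. 8 * (1 / sqrt (1 + 6 * t\<^sup>2 + t ^ 4)))"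
  proof (rule Henstock_Kurzweil_Integration.integral_nonneg)
    show "(\<lambda>t. 8 * (1 / sqrt (1 + 6 * t\<^sup>2 + t ^ 4))) integrable_on {0..1 :: real}"
    proof (intro integrable_continuous_real continuous_intros ballI)
      fix t :: real
      have "1 + 6 * t\<^sup>2 + t ^ 4 > 0" by (simp add: add_pos_nonneg)
      then show "sqrt (1 + 6 * t\<^sup>2 + t ^ 4) \<noteq> 0" by simp
    qed
  qed auto
  moreover have "0 \<le> Beta (1/4) (1/2 :: real)"
    unfolding B by simp
  ultimately have "Beta (1/4) (1/2) = integral {0..1} (\<lambda>t. 8 * (1 / sqrt (1 + 6 * t\<^sup>2 + t ^ 4)))"
    using eq by simp
  then show ?thesis
    unfolding B Henstock_Kurzweil_Integration.integral_mult_right by (simp add: field_simps)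
qed

lemma arctan_integral: "integral {0..1} (\<lambda>t. 1 / (1 + t\<^sup>2)) = pi / 4"
proof (rule integral_unique)
  have "((\<lambda>t. 1 / (1 + t\<^sup>2)) has_integral arctan 1 - arctan 0) {0..1 :: real}"
  proof (rule fundamental_theorem_of_calculus)
    fix t :: real
    show "(arctan has_vector_derivative 1 / (1 + t\<^sup>2)) (at t within {0..1})"
      unfolding has_real_derivative_iff_has_vector_derivative[symmetric]
      using has_field_derivative_at_within[OF DERIV_arctan[of t]] by (simp add: divide_inverse)
  qed simp
  then show "((\<lambda>t. 1 / (1 + t\<^sup>2)) has_integral pi / 4) {0..1 :: real}"
    by (simp add: arctan_one)
qed

subsection \<open>Weighted count of Pythagorean points\<close>

text \<open>This controls the line C = 0, on which every odd \<open>A\<close> gives a square: its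
  total weight has order sqrt N, one logarithm below the main term.\<close>

lemma odd_gauss_sum_int:
  assumes "N > 0"
  shows "(\<Sum>a\<in>{a. odd a \<and> \<bar>a\<bar> \<le> 10 * int N}. gauss N a) \<le> 4 * (1 + sqrt (real N))"
proof -
  define r where "r = 1 / (4 * sqrt (real N))"
  have r: "r > 0" using assms by (simp add: r_def)
  define h where "h a = gauss N a" for a
  have h: "h (int (2 * j + 1)) = exp (- (r * real (2 * j + 1))\<^sup>2)" "h (- int (2 * j + 1)) = exp (- (r * real (2 * j + 1))\<^sup>2)" for j
  proof -
    have "(r * x)\<^sup>2 = x\<^sup>2 / (16 * real N)" for x
      by (simp add: r_def power_divide)
    then show "h (int (2 * j + 1)) = exp (- (r * real (2 * j + 1))\<^sup>2)" "h (- int (2 * j + 1)) = exp (- (r * real (2 * j + 1))\<^sup>2)"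
      unfolding h_def of_int_minus power2_minus of_int_of_nat_eq by (simp_all only: minus_divide_left)
  qed
  have "{a. odd a \<and> \<bar>a\<bar> \<le> 10 * int N} = (\<lambda>j. int (2 * j + 1)) ` {..<5 * N} \<union> (\<lambda>j. - int (2 * j + 1)) ` {..<5 * N}"
  proof (intro equalityI subsetI)
    fix a :: int assume a: "a \<in> {a. odd a \<and> \<bar>a\<bar> \<le> 10 * int N}"
    from a have "odd \<bar>a\<bar>" by simp
    then obtain b where b: "\<bar>a\<bar> = 2 * b + 1" by (elim oddE)
    define j where "j = nat b"
    have j: "\<bar>a\<bar> = int (2 * j + 1)"
      using b by (simp add: j_def)
    then have "j \<in> {..<5 * N}" using a by auto
    moreover have "a = int (2 * j + 1) \<or> a = - int (2 * j + 1)"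
      using j by linarith
    ultimately show "a \<in> (\<lambda>j. int (2 * j + 1)) ` {..<5 * N} \<union> (\<lambda>j. - int (2 * j + 1)) ` {..<5 * N}"
      by blast
  qed auto
  then have "(\<Sum>a\<in>{a. odd a \<and> \<bar>a\<bar> \<le> 10 * int N}. h a)
      \<le> (\<Sum>a\<in>(\<lambda>j. int (2 * j + 1)) ` {..<5 * N}. h a) + (\<Sum>a\<in>(\<lambda>j. - int (2 * j + 1)) ` {..<5 * N}. h a)"
    using sum.union_inter[of "(\<lambda>j. int (2 * j + 1)) ` {..<5 * N}" "(\<lambda>j. - int (2 * j + 1)) ` {..<5 * N}" h]
      sum_nonneg[of "(\<lambda>j. int (2 * j + 1)) ` {..<5 * N} \<inter> (\<lambda>j. - int (2 * j + 1)) ` {..<5 * N}" h]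
    by (simp add: h_def)
  also have "\<dots> = (\<Sum>j<5 * N. h (int (2 * j + 1))) + (\<Sum>j<5 * N. h (- int (2 * j + 1)))"
    by (subst (1 2) sum.reindex) (auto simp: inj_on_def)
  also have "\<dots> = 2 * (\<Sum>j<5 * N. exp (- (r * real (2 * j + 1))\<^sup>2))"
    unfolding h by simp
  also have "\<dots> \<le> 2 * (1 + sqrt pi / (4 * r))"
    by (intro mult_left_mono odd_gauss_sum_bounds(1) r) simp
  also have "sqrt pi / (4 * r) = sqrt pi * sqrt (real N)"
    using assms by (simp add: r_def)
  also have "2 * (1 + sqrt pi * sqrt (real N)) \<le> 4 * (1 + sqrt (real N))"
  proof -
    have "sqrt pi \<le> 2"
      using pi_less_4 by (intro real_le_lsqrt) auto
    then have "sqrt pi * sqrt (real N) \<le> 2 * sqrt (real N)"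
      by (intro mult_right_mono) auto
    then show ?thesis by simp
  qed
  finally show ?thesis
    unfolding h_def .
qed

abbreviation gauss_upper :: "real \<Rightarrow> (nat \<Rightarrow> int \<Rightarrow> real) \<Rightarrow> (nat \<Rightarrow> real) \<Rightarrow> bool" where
  "gauss_upper l f t \<equiv> \<forall>\<^sub>F N in sequentially. \<forall>a. f N a \<le> cbin N * (2 * l * gauss N a + t N)"

abbreviation gauss_bounded :: "real \<Rightarrow> (nat \<Rightarrow> int \<Rightarrow> real) \<Rightarrow> bool" where
  "gauss_bounded l f \<equiv> \<forall>\<^sub>F N in sequentially. \<forall>a. f N a \<le> cbin N * (2 * l + 1)"

text \<open>As soon as \<open>hi\<close> is below 2, core and tail merge into estimates for every
  \<open>a\<close>. Passing to the absolute value of \<open>t\<close> makes the tail error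
  nonnegative.\<close>

lemma gauss_familyE:
  assumes "gauss_family l f"
  obtains lo hi t where "l > 0" "\<And>N a. 0 \<le> f N a" "lo \<longlonglongrightarrow> 1" "hi \<longlonglongrightarrow> 1"
    "(\<lambda>N. t N * real N ^ 3) \<longlonglongrightarrow> 0" "\<And>N. t N \<ge> 0"
    "gauss_core l f lo hi"
    "gauss_tail f t"
    "gauss_upper l f t"
    "gauss_bounded l f"
proof -
  from assms obtain lo hi t where l: "l > 0" and f0: "\<And>N a. 0 \<le> f N a" and lim: "lo \<longlonglongrightarrow> 1" "hi \<longlonglongrightarrow> 1"
    and main: "gauss_core l f lo hi"
    and t: "(\<lambda>N. t N * real N ^ 3) \<longlonglongrightarrow> 0"
    and tail: "gauss_tail f t"
    unfolding gauss_family_def by blast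
  have tail': "gauss_tail f (\<lambda>N. \<bar>t N\<bar>)"
    using tail by eventually_elim (meson abs_ge_self mult_left_mono of_nat_0_le_iff order_trans)
  have hi2: "\<forall>\<^sub>F N in sequentially. hi N < 2"
    using lim(2) by (rule order_tendstoD) simp
  have all: "gauss_upper l f (\<lambda>N. \<bar>t N\<bar>)"
    using main tail' hi2
  proof eventually_elim
    case (elim N)
    note 1 = elim(1) and 2 = elim(2) and 3 = elim(3)
    show ?case
    proof
      fix a
      define B G where "B = cbin N" and "G = gauss N a"
      have BG: "B \<ge> 0" "G \<ge> 0" by (auto simp: B_def G_def)
      have "f N a \<le> B * (2 * l * G + \<bar>t N\<bar>)"
      proof (cases "\<bar>real_of_int a\<bar> \<le> real N powr (3/5)")
        case True
        then have "f N a \<le> hi N * (l * B * G)"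
          using 1 by (simp add: B_def G_def)
        also have "\<dots> \<le> 2 * (l * B * G)"
          using 3 l BG by (intro mult_right_mono) auto
        also have "\<dots> \<le> B * (2 * l * G + \<bar>t N\<bar>)"
          using BG by (simp add: algebra_simps)
        finally show ?thesis .
      next
        case False
        then have "f N a \<le> B * \<bar>t N\<bar>"
          using 2 by (simp add: B_def)
        also have "\<dots> \<le> B * (2 * l * G + \<bar>t N\<bar>)"
          using BG l by (intro mult_left_mono) auto
        finally show ?thesis .
      qed
      then show "f N a \<le> cbin N * (2 * l * gauss N a + \<bar>t N\<bar>)"
        by (simp add: B_def G_def)
    qed
  qed
  have t': "(\<lambda>N. \<bar>t N\<bar> * real N ^ 3) \<longlonglongrightarrow> 0"
    using tendsto_rabs[OF t] by (simp add: abs_mult)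
  have t1: "\<forall>\<^sub>F N in sequentially. \<bar>t N\<bar> \<le> 1"
    using order_tendstoD(2)[OF t', of 1, simplified] eventually_gt_at_top[of 0]
  proof eventually_elim
    case (elim N)
    have "\<bar>t N\<bar> * 1 \<le> \<bar>t N\<bar> * real N ^ 3"
      using elim by (intro mult_left_mono one_le_power) auto
    then show ?case using elim by simp
  qed
  have "gauss_bounded l f"
    using all t1
  proof eventually_elim
    case (elim N)
    show ?case
    proof
      fix a
      have "2 * l * gauss N a \<le> 2 * l * 1"
        using l by (intro mult_left_mono) auto
      then have "cbin N * (2 * l * gauss N a + \<bar>t N\<bar>) \<le> cbin N * (2 * l + 1)"
        using elim(2) by (intro mult_left_mono) auto
      then show "f N a \<le> cbin N * (2 * l + 1)"
        using elim(1) by (meson order_trans)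
    qed
  qed
  then show ?thesis
    by (intro that[of lo hi "\<lambda>N. \<bar>t N\<bar>"] l f0 lim main t' tail' all) auto
qed

context pythagorean_weight
begin

text \<open>Points of \<open>P\<close> have nonzero coordinates, so each has exactly four sign
  variants, all of the same weight.\<close>

lemma gauss_sum_int:
  assumes Q: "\<And>a c. (a, c) \<in> Q \<longleftrightarrow> (nat \<bar>a\<bar>, nat \<bar>c\<bar>) \<in> P \<and> \<bar>real_of_int a\<bar> \<le> real N powr (3/5) \<and> \<bar>real_of_int c\<bar> \<le> real N powr (3/5)"
    and P: "\<And>a c. (a, c) \<in> P \<Longrightarrow> a > 0 \<and> c > 0"
  shows "finite Q" "(\<Sum>(a, c)\<in>Q. gauss N a * gauss N c)
    = 4 * gauss_sum N"
proof -
  define Q' where "Q' = {(a, c) \<in> P. real a \<le> real N powr (3/5) \<and> real c \<le> real N powr (3/5)}"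
  have "Q' \<subseteq> {..nat \<lfloor>real N powr (3/5)\<rfloor>} \<times> {..nat \<lfloor>real N powr (3/5)\<rfloor>}"
    by (auto simp: Q'_def le_nat_floor)
  then have fin: "finite Q'"
    by (rule finite_subset) auto
  define S :: "int set" where "S = {1, -1}"
  define m where "m = (\<lambda>(s, s', a, c). (s * int a, s' * int c))"
  have img: "m ` (S \<times> S \<times> Q') = Q"
  proof (intro equalityI subsetI)
    fix x assume "x \<in> m ` (S \<times> S \<times> Q')"
    then show "x \<in> Q"
      by (auto simp: m_def S_def Q'_def Q)
  next
    fix x assume x: "x \<in> Q"
    obtain a c where ac: "x = (a, c)" by force
    have "(nat \<bar>a\<bar>, nat \<bar>c\<bar>) \<in> Q'"
      using x unfolding ac Q Q'_def by simp
    moreover from this have "sgn a \<in> S" "sgn c \<in> S"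
      using P[of "nat \<bar>a\<bar>" "nat \<bar>c\<bar>"] by (auto simp: S_def Q'_def sgn_if)
    moreover have "x = m (sgn a, sgn c, nat \<bar>a\<bar>, nat \<bar>c\<bar>)"
      by (simp add: m_def ac sgn_mult_abs)
    ultimately show "x \<in> m ` (S \<times> S \<times> Q')"
      by blast
  qed
  have inj: "inj_on m (S \<times> S \<times> Q')"
  proof (rule inj_onI)
    fix x y assume xy: "x \<in> S \<times> S \<times> Q'" "y \<in> S \<times> S \<times> Q'" "m x = m y"
    obtain s1 s2 a c s1' s2' a' c' where [simp]: "x = (s1, s2, a, c)" "y = (s1', s2', a', c')"
      by (metis prod.exhaust)
    have "a > 0" "c > 0" "a' > 0" "c' > 0"
      using xy P by (auto simp: Q'_def)
    then show "x = y"
      using xy by (auto simp: m_def S_def)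
  qed
  show "finite Q"
    unfolding img[symmetric] by (intro finite_imageI) (auto simp: S_def fin)
  define F where "F = (\<lambda>(a::nat, c::nat). exp (- (real a ^ 2 + real c ^ 2) / (16 * real N)))"
  have "(\<Sum>(a, c)\<in>Q. gauss N a * gauss N c)
      = (\<Sum>(s, s', x)\<in>S \<times> S \<times> Q'. F x)"
    unfolding img[symmetric]
  proof (subst sum.reindex[OF inj], rule sum.cong)
    fix y assume y: "y \<in> S \<times> S \<times> Q'"
    obtain s s' a c where [simp]: "y = (s, s', a, c)"
      by (metis prod.exhaust)
    show "((\<lambda>(a, c). gauss N a * gauss N c) \<circ> m) y
        = (case y of (s, s', x) \<Rightarrow> F x)"
      using y by (auto simp: m_def S_def F_def exp_add[symmetric] add_divide_distrib diff_divide_distrib)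
  qed simp
  also have "\<dots> = (\<Sum>s\<in>S. \<Sum>s'\<in>S. \<Sum>x\<in>Q'. F x)"
    by (simp only: sum.cartesian_product)
  also have "\<dots> = 4 * (\<Sum>x\<in>Q'. F x)"
    by (simp add: S_def)
  also have "(\<Sum>x\<in>Q'. F x) = gauss_sum N"
    unfolding gauss_sum_def Q'_def F_def by (simp add: case_prod_unfold)
  finally show "(\<Sum>(a, c)\<in>Q. gauss N a * gauss N c)
    = 4 * gauss_sum N" .
qed

end

text \<open>Attainable values are at most 4N + 5 in size, so the box with side bound 10 N contains
  all of them and merely keeps the sums finite.\<close>

abbreviation square_points :: "nat \<Rightarrow> (int \<Rightarrow> int \<Rightarrow> bool) \<Rightarrow> (int \<times> int) set" where
  "square_points N Sq \<equiv> {(a, c). odd a \<and> \<bar>a\<bar> \<le> 10 * int N \<and> 4 dvd c \<and> \<bar>c\<bar> \<le> 10 * int N \<and> Sq a c}"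

context pythagorean_weight
begin

text \<open>The points are split into those in the window, which carry the Gaussian main term with
  relative error tending to 0, those with c = 0, whose weight lacks the factor log N, and those
  outside the window. The last number O(N^2), and one of their two factors is below
  \<open>cbin N * t N\<close> or its analogue for \<open>g\<close>, smaller than any term that
  matters.\<close>

lemma weighted_count_asymp:
  fixes Sq :: "int \<Rightarrow> int \<Rightarrow> bool"
  assumes f: "gauss_family l f" and g: "gauss_family l' g"
    and P: "\<And>a c. (nat \<bar>a\<bar>, nat \<bar>c\<bar>) \<in> P \<longleftrightarrow> odd a \<and> 4 dvd c \<and> c \<noteq> 0 \<and> Sq a c"
  defines "S \<equiv> \<lambda>N. \<Sum>(a, c)\<in>square_points N Sq. f N a * g N c"
  shows "(\<lambda>N. S N / (l * l' * cbin N ^ 2 * (sqrt (real N) * ln (real N)))) \<longlonglongrightarrow> 4 * I / pi powr (3/2)"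
proof -
  obtain lo hi t where l: "l > 0" and f0: "\<And>N a. 0 \<le> f N a"
    and lim: "lo \<longlonglongrightarrow> 1" "hi \<longlonglongrightarrow> 1" and t: "(\<lambda>N. t N * real N ^ 3) \<longlonglongrightarrow> 0" "\<And>N. t N \<ge> 0"
    and f1: "gauss_core l f lo hi"
    and f2: "gauss_tail f t"
    and f3: "gauss_upper l f t"
    and f4: "gauss_bounded l f"
    by (rule gauss_familyE[OF f]) (rule that, assumption+)
  obtain lo' hi' t' where l': "l' > 0" and g0: "\<And>N a. 0 \<le> g N a"
    and lim': "lo' \<longlonglongrightarrow> 1" "hi' \<longlonglongrightarrow> 1" and t': "(\<lambda>N. t' N * real N ^ 3) \<longlonglongrightarrow> 0" "\<And>N. t' N \<ge> 0"
    and g1: "gauss_core l' g lo' hi'"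
    and g2: "gauss_tail g t'"
    and g3: "gauss_upper l' g t'"
    and g4: "gauss_bounded l' g"
    by (rule gauss_familyE[OF g]) (rule that, assumption+)
  define B where "B N = cbin N" for N :: nat
  define D where "D N = sqrt (real N) * ln (real N)" for N :: nat
  define G where "G N a = gauss N a" for N :: nat and a
  define u where "u N = t N + t' N" for N
  have u: "(\<lambda>N. u N * real N ^ 3) \<longlonglongrightarrow> 0"
    using tendsto_add[OF t(1) t'(1)] by (simp add: u_def distrib_right)
  have u0: "u N \<ge> 0" for N using t(2) t'(2) by (simp add: u_def)
  define k where "k = 2 * l + 2 * l' + 1"
  \<comment> \<open>The first two terms come from the line c = 0, the third from at most (21 N)^2
    points outside the window, 21 N being a bound for the number of integers up to 10 N in absolute
    value.\<close>
  define err where "err N = 8 * l * k * (1 + sqrt (real N)) + 21 * k * (real N * u N) + 441 * k * (real N ^ 2 * u N)" for N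
  have B0: "B N > 0" for N
    by (simp add: B_def)
  have main: "\<forall>\<^sub>F N in sequentially. lo N * lo' N * (l * l' * B N ^ 2) * (4 * gauss_sum N) \<le> S N \<and>
      S N \<le> hi N * hi' N * (l * l' * B N ^ 2) * (4 * gauss_sum N) + B N ^ 2 * err N"
  proof -
    have "\<forall>\<^sub>F N in sequentially. real N powr (3/5) \<le> 10 * real N" by real_asymp
    moreover have "\<forall>\<^sub>F N in sequentially. lo N > 0" "\<forall>\<^sub>F N in sequentially. lo' N > 0"
      using lim(1) lim'(1) by (auto intro: order_tendstoD)
    ultimately show ?thesis
      using f1 f2 f3 f4 g1 g2 g4 eventually_gt_at_top[of 0]
    proof eventually_elim
      case (elim N)
      note F1 = elim(4)[rule_format, folded B_def G_def] and F2 = elim(5)[rule_format, folded B_def]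
        and F3 = elim(6)[rule_format, folded B_def G_def] and F4 = elim(7)[rule_format, folded B_def]
        and G1 = elim(8)[rule_format, folded B_def G_def] and G2 = elim(9)[rule_format, folded B_def]
        and G4 = elim(10)[rule_format, folded B_def]
      define X where "X = {a. \<bar>a\<bar> \<le> 10 * int N}"
      define A where "A = {a. odd a \<and> \<bar>a\<bar> \<le> 10 * int N}"
      define Q where "Q = square_points N Sq"
      define small where "small a \<longleftrightarrow> \<bar>real_of_int a\<bar> \<le> real N powr (3/5)" for a
      define Q1 where "Q1 = {(a, c) \<in> Q. c \<noteq> 0 \<and> small a \<and> small c}"
      define Q2 where "Q2 = {(a, c) \<in> Q. c \<noteq> 0 \<and> \<not> (small a \<and> small c)}"
      define Q0 where "Q0 = {(a, c) \<in> Q. c = 0}"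
      have Xeq: "X = {- 10 * int N..10 * int N}" by (auto simp: X_def)
      have X: "finite X" "real (card X) \<le> 21 * real N"
        unfolding Xeq using elim by auto
      have A: "finite A" "real (card A) \<le> 21 * real N"
      proof -
        have "A \<subseteq> X" by (auto simp: A_def X_def)
        then show "finite A" using X(1) finite_subset by blast
        have "card A \<le> card X" using \<open>A \<subseteq> X\<close> X(1) by (rule card_mono[rotated])
        then show "real (card A) \<le> 21 * real N" using X(2) by linarith
      qed
      have QX: "Q \<subseteq> X \<times> X" by (auto simp: Q_def X_def)
      have finQ: "finite Q" using QX X(1) finite_subset by blast
      have fin: "finite Q0" "finite Q1" "finite Q2"
        using finQ by (auto simp: Q0_def Q1_def Q2_def intro: finite_subset)
      have Qsplit: "Q = Q1 \<union> (Q0 \<union> Q2)" "Q1 \<inter> (Q0 \<union> Q2) = {}" "Q0 \<inter> Q2 = {}"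
        by (auto simp: Q0_def Q1_def Q2_def)
      define h where "h = (\<lambda>(a, c). f N a * g N c)"
      have h0: "h x \<ge> 0" for x using f0 g0 by (auto simp: h_def split: prod.splits)
      have "S N = sum h Q" unfolding S_def Q_def h_def ..
      also have "\<dots> = sum h Q1 + (sum h Q0 + sum h Q2)"
        unfolding Qsplit(1) using fin Qsplit(2,3) by (simp add: sum.union_disjoint)
      finally have SN: "S N = sum h Q1 + (sum h Q0 + sum h Q2)" .
      have Q1: "(\<Sum>(a, c)\<in>Q1. G N a * G N c) = 4 * gauss_sum N"
        unfolding G_def
      proof (rule gauss_sum_int(2))
        fix a c
        have "small x \<Longrightarrow> \<bar>x\<bar> \<le> 10 * int N" for x
          using elim(1) unfolding small_def by linarith
        then show "(a, c) \<in> Q1 \<longleftrightarrow> (nat \<bar>a\<bar>, nat \<bar>c\<bar>) \<in> P \<and> \<bar>real_of_int a\<bar> \<le> real N powr (3/5) \<and> \<bar>real_of_int c\<bar> \<le> real N powr (3/5)"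
          unfolding P Q1_def Q_def small_def[symmetric] by auto
      next
        fix a c assume "(a, c) \<in> P"
        then have "odd (int a) \<and> 4 dvd int c \<and> int c \<noteq> 0"
          using P[of "int a" "int c"] by simp
        then show "a > 0 \<and> c > 0" by (auto intro!: Nat.gr0I)
      qed
      have GG: "G N a \<ge> 0" for a by (simp add: G_def)
      have low1: "lo N * lo' N * (l * l' * B N ^ 2) * (4 * gauss_sum N) \<le> sum h Q1"
        unfolding Q1[symmetric] sum_distrib_left
      proof (rule sum_mono)
        fix x assume "x \<in> Q1"
        then obtain a c where x: "x = (a, c)" and s: "small a" "small c" by (auto simp: Q1_def)
        have "(lo N * (l * B N * G N a)) * (lo' N * (l' * B N * G N c)) \<le> f N a * g N c"
          using F1[of a] G1[of c] s elim(2,3) l l' B0[of N] GG f0 unfolding small_def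
          by (intro mult_mono mult_nonneg_nonneg) auto
        then show "lo N * lo' N * (l * l' * (B N)\<^sup>2) * (case x of (a, c) \<Rightarrow> G N a * G N c) \<le> h x"
          by (simp add: x h_def power2_eq_square mult_ac)
      qed
      have up1: "sum h Q1 \<le> hi N * hi' N * (l * l' * B N ^ 2) * (4 * gauss_sum N)"
        unfolding Q1[symmetric] sum_distrib_left
      proof (rule sum_mono)
        fix x assume "x \<in> Q1"
        then obtain a c where x: "x = (a, c)" and s: "small a" "small c" by (auto simp: Q1_def)
        have "f N a * g N c \<le> (hi N * (l * B N * G N a)) * (hi' N * (l' * B N * G N c))"
          using F1[of a] G1[of c] s f0[of N a] g0[of N c] unfolding small_def
          by (intro mult_mono) (auto intro: order_trans)
        then show "h x \<le> hi N * hi' N * (l * l' * (B N)\<^sup>2) * (case x of (a, c) \<Rightarrow> G N a * G N c)"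
          by (simp add: x h_def power2_eq_square mult_ac)
      qed
      have sumf: "sum (f N) A \<le> B N * (8 * l * (1 + sqrt (real N)) + 21 * (real N * u N))"
      proof -
        have "sum (f N) A \<le> (\<Sum>a\<in>A. B N * (2 * l * G N a + t N))"
          by (intro sum_mono F3)
        also have "\<dots> = B N * (2 * l * sum (G N) A + real (card A) * t N)"
          by (simp add: sum_distrib_left[symmetric] sum.distrib)
        also have "\<dots> \<le> B N * (2 * l * (4 * (1 + sqrt (real N))) + 21 * real N * u N)"
        proof (intro mult_left_mono add_mono mult_mono)
          show "sum (G N) A \<le> 4 * (1 + sqrt (real N))"
            unfolding G_def A_def using elim by (intro odd_gauss_sum_int) auto
          show "t N \<le> u N" using t'(2) by (simp add: u_def)
        qed (use l t B0[of N] A in auto)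
        finally show ?thesis by (simp add: mult_ac)
      qed
      have k: "2 * l + 1 \<le> k" "2 * l' + 1 \<le> k" using l l' by (auto simp: k_def)
      have up0: "sum h Q0 \<le> B N ^ 2 * (8 * l * k * (1 + sqrt (real N)) + 21 * k * (real N * u N))"
      proof -
        have "Q0 \<subseteq> A \<times> {0}" by (auto simp: Q0_def Q_def A_def)
        then have "sum h Q0 \<le> sum h (A \<times> {0})"
          using A h0 by (intro sum_mono2) auto
        also have "\<dots> = (\<Sum>a\<in>A. \<Sum>c\<in>{0}. f N a * g N c)"
          unfolding h_def by (rule sum.cartesian_product[symmetric])
        also have "\<dots> = sum (f N) A * g N 0"
          by (simp add: sum_distrib_right)
        also have "\<dots> \<le> (B N * (8 * l * (1 + sqrt (real N)) + 21 * (real N * u N))) * (B N * k)"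
        proof (intro mult_mono sumf)
          show "g N 0 \<le> B N * k"
            using G4[of 0] mult_left_mono[OF k(2), of "B N"] B0[of N] by linarith
        qed (use B0[of N] l u0[of N] g0 in auto)
        also have "\<dots> = B N ^ 2 * (8 * l * k * (1 + sqrt (real N)) + 21 * k * (real N * u N))"
          by (simp add: power2_eq_square algebra_simps)
        finally show ?thesis .
      qed
      have up2: "sum h Q2 \<le> B N ^ 2 * (441 * k * (real N ^ 2 * u N))"
      proof -
        have "sum h Q2 \<le> (\<Sum>x\<in>Q2. B N ^ 2 * (k * u N))"
        proof (rule sum_mono)
          fix x assume "x \<in> Q2"
          then obtain a c where x: "x = (a, c)" and s: "\<not> small a \<or> \<not> small c" by (auto simp: Q2_def)
          have gk: "g N c \<le> B N * k"
            using G4[of c] mult_left_mono[OF k(2), of "B N"] B0[of N] by linarith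
          have fk: "f N a \<le> B N * k"
            using F4[of a] mult_left_mono[OF k(1), of "B N"] B0[of N] by linarith
          have tu: "B N * t N \<le> B N * u N" "B N * t' N \<le> B N * u N"
            using t(2) t'(2) B0[of N] by (auto intro!: mult_left_mono simp: u_def)
          from s have "f N a * g N c \<le> (B N * u N) * (B N * k)"
          proof
            assume "\<not> small a"
            then have "f N a \<le> B N * u N"
              using F2[of a] tu(1) unfolding small_def by linarith
            then show ?thesis
              using gk f0 g0 u0[of N] B0[of N] by (intro mult_mono) auto
          next
            assume "\<not> small c"
            then have "g N c \<le> B N * u N"
              using G2[of c] tu(2) unfolding small_def by linarith
            then have "f N a * g N c \<le> (B N * k) * (B N * u N)"
              using fk f0 g0 l l' B0[of N] by (intro mult_mono) (auto simp: k_def)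
            then show ?thesis by (simp add: mult_ac)
          qed
          then show "h x \<le> B N ^ 2 * (k * u N)"
            by (simp add: x h_def power2_eq_square mult_ac)
        qed
        also have "\<dots> = real (card Q2) * (B N ^ 2 * (k * u N))" by simp
        also have "\<dots> \<le> (441 * real N ^ 2) * (B N ^ 2 * (k * u N))"
        proof (rule mult_right_mono)
          have "Q2 \<subseteq> X \<times> X" using QX by (auto simp: Q2_def)
          then have "card Q2 \<le> card (X \<times> X)" using X(1) by (intro card_mono) auto
          then have "real (card Q2) \<le> real (card X) * real (card X)"
            by (simp add: card_cartesian_product flip: of_nat_mult)
          also have "\<dots> \<le> (21 * real N) * (21 * real N)"
            using X(2) by (intro mult_mono) auto
          finally show "real (card Q2) \<le> 441 * real N ^ 2"
            by (simp add: power2_eq_square)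
        qed (use l l' u0[of N] in \<open>auto simp: k_def\<close>)
        finally show ?thesis by (simp add: mult_ac)
      qed
      have "sum h Q0 \<ge> 0" "sum h Q2 \<ge> 0"
        using h0 by (auto intro: sum_nonneg)
      moreover have "B N ^ 2 * err N = B N ^ 2 * (8 * l * k * (1 + sqrt (real N)) + 21 * k * (real N * u N))
          + B N ^ 2 * (441 * k * (real N ^ 2 * u N))"
        by (simp add: err_def distrib_left)
      ultimately show ?case
        using low1 up1 up0 up2 unfolding SN by linarith
    qed
  qed
  have gs: "(\<lambda>N. gauss_sum N / D N) \<longlonglongrightarrow> I / pi powr (3/2)"
    using gauss_sum_asymp by (simp add: D_def)
  have err: "(\<lambda>N. err N / D N) \<longlonglongrightarrow> 0"
  proof -
    have "(\<lambda>N. 8 * l * k * ((1 + sqrt (real N)) / D N) + 21 * k * ((u N * real N ^ 3) * (1 / (real N ^ 2 * D N)))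
        + 441 * k * ((u N * real N ^ 3) * (1 / (real N * D N)))) \<longlonglongrightarrow> 8 * l * k * 0 + 21 * k * (0 * 0) + 441 * k * (0 * 0)"
      unfolding D_def by (intro tendsto_add tendsto_mult tendsto_const u) real_asymp+
    then have "(\<lambda>N. 8 * l * k * ((1 + sqrt (real N)) / D N) + 21 * k * ((u N * real N ^ 3) * (1 / (real N ^ 2 * D N)))
        + 441 * k * ((u N * real N ^ 3) * (1 / (real N * D N)))) \<longlonglongrightarrow> 0" by simp
    then show ?thesis
    proof (rule Lim_transform_eventually)
      show "\<forall>\<^sub>F N in sequentially. 8 * l * k * ((1 + sqrt (real N)) / D N) + 21 * k * ((u N * real N ^ 3) * (1 / (real N ^ 2 * D N)))
        + 441 * k * ((u N * real N ^ 3) * (1 / (real N * D N))) = err N / D N"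
        using eventually_gt_at_top[of 1]
      proof eventually_elim
        case (elim N)
        have eqs: "(u N * real N ^ 3) * (1 / (real N ^ 2 * D N)) = real N * u N / D N"
          "(u N * real N ^ 3) * (1 / (real N * D N)) = real N ^ 2 * u N / D N"
          using elim by (simp_all add: power2_eq_square power3_eq_cube)
        show ?case
          unfolding eqs by (simp add: err_def divide_inverse algebra_simps)
      qed
    qed
  qed
  define E where "E N = S N / (l * l' * B N ^ 2 * D N)" for N
  have lower: "(\<lambda>N. lo N * lo' N * (4 * (gauss_sum N / D N))) \<longlonglongrightarrow> 4 * I / pi powr (3/2)"
    using tendsto_mult[OF tendsto_mult[OF lim(1) lim'(1)] tendsto_mult[OF tendsto_const[of 4] gs]] by simp
  have upper: "(\<lambda>N. hi N * hi' N * (4 * (gauss_sum N / D N)) + (err N / D N) / (l * l')) \<longlonglongrightarrow> 4 * I / pi powr (3/2)"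
    using tendsto_add[OF tendsto_mult[OF tendsto_mult[OF lim(2) lim'(2)] tendsto_mult[OF tendsto_const[of 4] gs]]
        tendsto_divide[OF err tendsto_const[of "l * l'"]]] l l' by simp
  have bounds: "\<forall>\<^sub>F N in sequentially. lo N * lo' N * (4 * (gauss_sum N / D N)) \<le> E N \<and>
      E N \<le> hi N * hi' N * (4 * (gauss_sum N / D N)) + (err N / D N) / (l * l')"
    using main eventually_gt_at_top[of 1]
  proof eventually_elim
    case (elim N)
    have "sqrt (real N) > 0" "ln (real N) > 0" using elim(2) by auto
    then have D0: "D N > 0" unfolding D_def by (rule mult_pos_pos)
    define m where "m = l * l' * B N ^ 2 * D N"
    have m: "m > 0" unfolding m_def using l l' B0[of N] D0 by simp
    have "lo N * lo' N * (l * l' * B N ^ 2) * (4 * gauss_sum N) / m \<le> S N / m"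
      "S N / m \<le> (hi N * hi' N * (l * l' * B N ^ 2) * (4 * gauss_sum N) + B N ^ 2 * err N) / m"
      using elim(1) m by (auto intro!: divide_right_mono)
    moreover have "lo N * lo' N * (l * l' * B N ^ 2) * (4 * gauss_sum N) / m = lo N * lo' N * (4 * (gauss_sum N / D N))"
      unfolding m_def using l l' B0[of N] D0 by simp
    moreover have "(hi N * hi' N * (l * l' * B N ^ 2) * (4 * gauss_sum N) + B N ^ 2 * err N) / m
        = hi N * hi' N * (4 * (gauss_sum N / D N)) + (err N / D N) / (l * l')"
      unfolding m_def add_divide_distrib using l l' B0[of N] D0 by (simp add: field_simps)
    ultimately show ?case
      unfolding E_def m_def by simp
  qed
  have "E \<longlonglongrightarrow> 4 * I / pi powr (3/2)"
    by (rule tendsto_sandwich[OF _ _ lower upper]) (use bounds in \<open>auto elim: eventually_mono\<close>)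
  then show ?thesis
    unfolding E_def B_def D_def .
qed

end

subsection \<open>Counting sign patterns\<close>

definition palindromic :: "int \<Rightarrow> nat \<Rightarrow> int poly \<Rightarrow> bool" where
  "palindromic e m f \<longleftrightarrow> (\<forall>j\<le>m. coeff f (m - j) = e ^ j * coeff f (m + j))"

lemma reciprocal_iff:
  assumes "degree f = 2 * m"
  shows "reciprocal f \<longleftrightarrow> palindromic 1 m f"
  unfolding reciprocal_def palindromic_def assms
proof (intro iffI allI impI)
  fix j assume *: "\<forall>i\<le>2 * m. coeff f i = coeff f (2 * m - i)" "j \<le> m"
  then have "coeff f (m - j) = coeff f (2 * m - (m - j))"
    by (intro *(1)[rule_format]) simp
  also have "2 * m - (m - j) = m + j" using * by simp
  finally show "coeff f (m - j) = 1 ^ j * coeff f (m + j)" by simp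
next
  fix i assume *: "\<forall>j\<le>m. coeff f (m - j) = 1 ^ j * coeff f (m + j)" "i \<le> 2 * m"
  show "coeff f i = coeff f (2 * m - i)"
  proof (cases "i \<le> m")
    case True
    then show ?thesis using *(1)[rule_format, of "m - i"] by (simp add: mult_2)
  next
    case False
    then show ?thesis using *(1)[rule_format, of "i - m"] *(2) by (simp add: mult_2)
  qed
qed

lemma skew_reciprocal_iff:
  assumes "degree f = 2 * m"
  shows "skew_reciprocal f \<longleftrightarrow> palindromic (-1) m f"
proof -
  define s :: "nat \<Rightarrow> int" where "s i = (-1) ^ (2 * m * (2 * m - 1) div 2) * (-1) ^ (2 * m - i)" for i
  have "2 * m * (2 * m - 1) div 2 = m * (2 * m - 1)" by simp
  moreover have "even (m * (2 * m - 1)) \<longleftrightarrow> even m" by (cases m) auto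
  \<comment> \<open>m (2m - 1) has the parity of m and cancels the m in 2m - i = m + j or m - j;
    this turns the defining sign into (-1)^j.\<close>
  ultimately have s1: "s (m - j) = (-1) ^ j" "s (m + j) = (-1) ^ j" if "j \<le> m" for j
    using that unfolding s_def by (auto simp: minus_one_power_iff)
  show ?thesis
    unfolding skew_reciprocal_def palindromic_def Let_def assms s_def[symmetric]
  proof (intro iffI allI impI)
    fix j assume *: "\<forall>i\<le>2 * m. coeff f i = s i * coeff f (2 * m - i)" "j \<le> m"
    then have "coeff f (m - j) = s (m - j) * coeff f (2 * m - (m - j))"
      by (intro *(1)[rule_format]) simp
    also have "2 * m - (m - j) = m + j" using * by simp
    finally show "coeff f (m - j) = (-1) ^ j * coeff f (m + j)" using s1 *(2) by simp
  next
    fix i assume *: "\<forall>j\<le>m. coeff f (m - j) = (-1) ^ j * coeff f (m + j)" "i \<le> 2 * m"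
    show "coeff f i = s i * coeff f (2 * m - i)"
    proof (cases "i \<le> m")
      case True
      then show ?thesis using *(1)[rule_format, of "m - i"] s1(1)[of "m - i"] by (simp add: mult_2)
    next
      case False
      define j where "j = i - m"
      have j: "i = m + j" "2 * m - i = m - j" "j \<le> m"
        using False *(2) by (auto simp: j_def)
      have "s i * coeff f (2 * m - i) = (-1) ^ j * ((-1) ^ j * coeff f (m + j))"
        using *(1) s1(2) j by simp
      then show ?thesis
        by (simp add: j)
    qed
  qed
qed

section \<open>Sign patterns as subsets\<close>

definition chi :: "nat set \<Rightarrow> nat \<Rightarrow> int" where
  "chi X j = (if j \<in> X then 1 else -1)"

lemma sum_chi:
  assumes "finite E"
  shows "(\<Sum>j\<in>E. chi X j) = 2 * int (card (X \<inter> E)) - int (card E)"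
proof -
  have "(\<Sum>j\<in>E. chi X j) = (\<Sum>j\<in>E. 2 * (if j \<in> X then 1 else 0) - 1)"
    unfolding chi_def by (rule sum.cong) auto
  also have "\<dots> = 2 * (\<Sum>j\<in>E. if j \<in> X then 1 else 0) - int (card E)"
    by (simp add: sum_subtractf sum_distrib_left)
  also have "(\<Sum>j\<in>E. if j \<in> X then 1 else 0) = int (card (X \<inter> E))"
    using assms by (simp add: sum.inter_restrict[symmetric] Int_commute)
  finally show ?thesis .
qed

text \<open>A palindromic Littlewood polynomial is encoded by the set of indices \<open>j < m\<close> at which the
  signed middle coefficient \<open>e^(j div 2) a_(m+j)\<close> equals 1.\<close>

lemma card_palindromic_littlewood:
  assumes m: "m > 0" and e: "e = 1 \<or> e = -1"
  defines "ev \<equiv> \<lambda>X. chi X 0 + 2 * ((\<Sum>j\<in>{j\<in>{1..<m}. even j}. chi X j) + (if even m then e ^ (m div 2) else 0))"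
    and "od \<equiv> \<lambda>X. 2 * ((\<Sum>j\<in>{j\<in>{1..<m}. odd j}. chi X j) + (if odd m then e ^ (m div 2) else 0))"
  shows "card {f. littlewood (2 * m) f \<and> palindromic e m f \<and> R (even_part e m f) (odd_part e m f)}
    = card {X. X \<subseteq> {..<m} \<and> R (ev X) (od X)}"
proof (rule bij_betw_same_card[of "\<lambda>f. {j\<in>{..<m}. coeff f (m + j) = e ^ (j div 2)}"])
  let ?A = "{f. littlewood (2 * m) f \<and> palindromic e m f \<and> R (even_part e m f) (odd_part e m f)}"
  let ?B = "{X. X \<subseteq> {..<m} \<and> R (ev X) (od X)}"
  define sg where "sg j = e ^ (j div 2)" for j :: nat
  have pw: "e ^ j = 1 \<or> e ^ j = -1" for j
    using e by (cases "even j") auto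
  have sg: "sg j * sg j = 1" "sg j = 1 \<or> sg j = -1" for j
    using pw[of "j div 2"] unfolding sg_def by auto
  have sgn0: "sg j \<noteq> 0" for j
    using sg(2)[of j] by auto
  have sg0: "sg 0 = 1" by (simp add: sg_def)
  define T where "T f = {j\<in>{..<m}. coeff f (m + j) = sg j}" for f :: "int poly"
  have parts: "even_part e m f = ev (T f) \<and> odd_part e m f = od (T f)"
    if f: "littlewood (2 * m) f" for f
  proof -
    have c: "coeff f (m + j) * sg j = chi (T f) j" if "j < m" for j
    proof -
      have "coeff f (m + j) \<in> {1, -1}" using f that by (auto simp: littlewood_def)
      then show ?thesis using sg(2)[of j] that by (auto simp: chi_def T_def)
    qed
    have cm: "coeff f (m + m) = 1" using f by (auto simp: littlewood_def mult_2)
    have 1: "{j\<in>{1..m}. even j} = {j\<in>{1..<m}. even j} \<union> (if even m then {m} else {})"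
      "{j\<in>{1..m}. odd j} = {j\<in>{1..<m}. odd j} \<union> (if odd m then {m} else {})"
      using m by (auto simp: le_less)
    have "(\<Sum>j\<in>{j\<in>{1..m}. even j}. coeff f (m + j) * sg j)
        = (\<Sum>j\<in>{j\<in>{1..<m}. even j}. chi (T f) j) + (if even m then sg m else 0)"
      unfolding 1 by (subst sum.union_disjoint) (auto simp: cm c)
    moreover have "(\<Sum>j\<in>{j\<in>{1..m}. odd j}. coeff f (m + j) * sg j)
        = (\<Sum>j\<in>{j\<in>{1..<m}. odd j}. chi (T f) j) + (if odd m then sg m else 0)"
      unfolding 1 by (subst sum.union_disjoint) (auto simp: cm c)
    moreover have "coeff f m = chi (T f) 0"
      using c[of 0] m by (simp add: sg0)
    ultimately show ?thesis
      unfolding even_part_def odd_part_def ev_def od_def sg_def by simp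
  qed
  show "bij_betw (\<lambda>f. {j\<in>{..<m}. coeff f (m + j) = e ^ (j div 2)})
      ?A
      ?B"
    unfolding sg_def[symmetric] T_def[symmetric]
  proof (rule bij_betw_imageI)
    show "inj_on T ?A"
    proof (rule inj_onI)
      fix f g assume fg: "f \<in> ?A"
        "g \<in> ?A" "T f = T g"
      have up: "coeff f (m + j) = coeff g (m + j)" if "j \<le> m" for j
      proof (cases "j = m")
        case True
        then show ?thesis using fg by (auto simp: littlewood_def mult_2)
      next
        case False
        then have "coeff f (m + j) \<in> {1, -1}" "coeff g (m + j) \<in> {1, -1}" "j < m"
          using fg that by (auto simp: littlewood_def)
        moreover have "j \<in> T f \<longleftrightarrow> j \<in> T g" using fg(3) by simp
        ultimately show ?thesis using sg(2)[of j] by (auto simp: T_def)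
      qed
      have low: "coeff f (m - j) = coeff g (m - j)" if "j \<le> m" for j
        using fg up[OF that] that by (auto simp: palindromic_def)
      show "f = g"
      proof (rule poly_eqI)
        fix i
        consider "i \<le> m" | "m \<le> i" "i \<le> 2 * m" | "i > 2 * m" by linarith
        then show "coeff f i = coeff g i"
        proof cases
          case 1 then show ?thesis using low[of "m - i"] by simp
        next
          case 2 then show ?thesis using up[of "i - m"] by simp
        next
          case 3 then show ?thesis using fg by (auto simp: littlewood_def coeff_eq_0)
        qed
      qed
    qed
    show "T ` ?A
        = ?B"
    proof (intro equalityI subsetI)
      fix X assume "X \<in> T ` ?A"
      then obtain f where "X = T f" "littlewood (2 * m) f" "R (even_part e m f) (odd_part e m f)" by auto
      then show "X \<in> ?B"
        using parts[of f] by (auto simp: T_def)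
    next
      fix X assume X: "X \<in> ?B"
      \<comment> \<open>Decoding: \<open>c j\<close> is the coefficient at m + j, with leading
        coefficient 1, and \<open>k\<close> extends it to the lower half by the symmetry.\<close>
      define c where "c j = (if j = m then 1 else chi X j * sg j)" for j
      define k where "k i = (if i < m then e ^ (m - i) * c (m - i) else c (i - m))" for i
      define f where "f = (\<Sum>i\<le>2 * m. monom (k i) i)"
      have cf: "coeff f i = (if i \<le> 2 * m then k i else 0)" for i
        unfolding f_def by (simp add: coeff_sum)
      have c1: "c j \<in> {1, -1}" for j
        using sg(2)[of j] by (auto simp: c_def chi_def)
      have k1: "k i \<in> {1, -1}" for i
        using c1[of "m - i"] c1[of "i - m"] pw[of "m - i"] by (auto simp: k_def)
      have "coeff f (2 * m) = 1"
        using m by (simp add: cf k_def c_def)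
      moreover have "degree f = 2 * m"
        using calculation by (intro antisym degree_le le_degree) (auto simp: cf)
      ultimately have lw: "littlewood (2 * m) f"
        using k1 by (auto simp: littlewood_def cf)
      have pal: "palindromic e m f"
        unfolding palindromic_def
      proof (intro allI impI)
        fix j assume "j \<le> m"
        then show "coeff f (m - j) = e ^ j * coeff f (m + j)"
          by (cases "j = 0") (auto simp: cf k_def)
      qed
      have TX: "T f = X"
        using X by (auto simp: T_def cf k_def c_def chi_def subset_iff sgn0 split: if_splits)
      have "f \<in> ?A"
        using lw pal parts[OF lw] X by (simp add: TX)
      then show "X \<in> T ` ?A"
        using TX by blast
    qed
  qed
qed

lemma card_subsets_prod:
  assumes "U \<inter> V = {}" "finite U" "finite V"
  shows "card {X. X \<subseteq> U \<union> V \<and> p (X \<inter> U) \<and> q (X \<inter> V)} = card {Y. Y \<subseteq> U \<and> p Y} * card {W. W \<subseteq> V \<and> q W}"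
proof -
  have "card {X. X \<subseteq> U \<union> V \<and> p (X \<inter> U) \<and> q (X \<inter> V)} = card ({Y. Y \<subseteq> U \<and> p Y} \<times> {W. W \<subseteq> V \<and> q W})"
  proof (rule bij_betw_same_card[of "\<lambda>X. (X \<inter> U, X \<inter> V)"], rule bij_betw_byWitness[where f' = "\<lambda>(Y, W). Y \<union> W"])
    have "(Y \<union> W) \<inter> U = Y" "(Y \<union> W) \<inter> V = W" if "Y \<subseteq> U" "W \<subseteq> V" for Y W
      using that assms(1) by auto
    then show "\<forall>x\<in>{Y. Y \<subseteq> U \<and> p Y} \<times> {W. W \<subseteq> V \<and> q W}. (\<lambda>X. (X \<inter> U, X \<inter> V)) ((\<lambda>(Y, W). Y \<union> W) x) = x"
      "(\<lambda>(Y, W). Y \<union> W) ` ({Y. Y \<subseteq> U \<and> p Y} \<times> {W. W \<subseteq> V \<and> q W}) \<subseteq> {X. X \<subseteq> U \<union> V \<and> p (X \<inter> U) \<and> q (X \<inter> V)}"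
      by auto
  qed auto
  then show ?thesis
    by (simp add: card_cartesian_product)
qed

lemma card_subsets_int:
  assumes "finite V"
  shows "real (card {W. W \<subseteq> V \<and> int (card W) = k}) = ibinom (card V) k"
proof (cases "k < 0")
  case True
  then have "{W. W \<subseteq> V \<and> int (card W) = k} = {}" by auto
  then show ?thesis using True by (simp only: ibinom_def) simp
next
  case False
  then have "{W. W \<subseteq> V \<and> int (card W) = k} = {W. W \<subseteq> V \<and> card W = nat k}" by auto
  then show ?thesis using False n_subsets[OF assms, of "nat k"] by (simp add: ibinom_def)
qed

text \<open>\<open>\<alpha>\<close> and \<open>\<gamma>\<close> collect twice the fixed leading
  coefficient and twice the excess of 2N over the number of free signs. A pair (a, c) determines the
  sign at index 0 and the numbers of positive signs at even and at odd indices; these choices are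
  independent, so each fibre is counted by a product of two binomial coefficients.\<close>

lemma card_sign_patterns:
  assumes Ev: "finite Ev" "card Ev \<le> 2 * N" "0 \<notin> Ev" and Od: "finite Od" "card Od \<le> 2 * N" "0 \<notin> Od" "Ev \<inter> Od = {}"
    and N: "N > 0" and al: "even \<alpha>" "\<bar>\<alpha>\<bar> \<le> 4" and ga: "4 dvd \<gamma>" "\<bar>\<gamma>\<bar> \<le> 4"
    and ev: "\<And>X. ev X = chi X 0 + 4 * (int (card (X \<inter> Ev)) - int N) + \<alpha>"
    and od: "\<And>X. od X = 4 * (int (card (X \<inter> Od)) - int N) + \<gamma>"
  shows "real (card {X. X \<subseteq> insert 0 (Ev \<union> Od) \<and> Sq (ev X) (od X)})
    = (\<Sum>(a, c)\<in>square_points N Sq.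
        ibinom (card Ev) (int N + (a + 2 - \<alpha>) div 4) * ibinom (card Od) (int N + (c - \<gamma> + 3) div 4))"
proof -
  define T where "T = square_points N Sq"
  define U where "U = {X. X \<subseteq> insert 0 (Ev \<union> Od)}"
  have finU: "finite U" using Ev Od by (simp add: U_def)
  have "T \<subseteq> {- 10 * int N..10 * int N} \<times> {- 10 * int N..10 * int N}" by (auto simp: T_def)
  then have finT: "finite T" by (rule finite_subset) simp
  have inT: "(ev X, od X) \<in> T" if "Sq (ev X) (od X)" for X
  proof -
    have "card (X \<inter> Ev) \<le> card Ev" "card (X \<inter> Od) \<le> card Od"
      using Ev Od by (auto intro: card_mono)
    then have "card (X \<inter> Ev) \<le> 2 * N" "card (X \<inter> Od) \<le> 2 * N"
      using Ev Od by auto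
    moreover have "chi X 0 = 1 \<or> chi X 0 = -1" by (simp add: chi_def)
    ultimately have "\<bar>ev X\<bar> \<le> 10 * int N" "\<bar>od X\<bar> \<le> 10 * int N"
      unfolding ev od using N al ga by auto
    moreover have "odd (ev X)" unfolding ev using al by (auto simp: chi_def)
    moreover have "4 dvd od X" unfolding od using ga by simp
    ultimately show ?thesis using that by (simp add: T_def)
  qed
  have "card {X. X \<subseteq> insert 0 (Ev \<union> Od) \<and> Sq (ev X) (od X)}
      = card (\<Union>(a, c)\<in>T. {X\<in>U. ev X = a \<and> od X = c})"
    by (rule arg_cong[of _ _ card]) (use inT in \<open>force simp: U_def T_def\<close>)
  also have "\<dots> = (\<Sum>y\<in>T. card (case y of (a, c) \<Rightarrow> {X\<in>U. ev X = a \<and> od X = c}))"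
    using finT finU by (intro card_UN_disjoint) auto
  finally have "real (card {X. X \<subseteq> insert 0 (Ev \<union> Od) \<and> Sq (ev X) (od X)})
      = (\<Sum>(a, c)\<in>T. real (card {X\<in>U. ev X = a \<and> od X = c}))"
    by (simp add: case_prod_unfold)
  also have "\<dots> = (\<Sum>(a, c)\<in>T. ibinom (card Ev) (int N + (a + 2 - \<alpha>) div 4) * ibinom (card Od) (int N + (c - \<gamma> + 3) div 4))"
  proof (intro sum.cong refl, clarify)
    fix a c assume "(a, c) \<in> T"
    then have a: "odd a" and c: "4 dvd c" by (auto simp: T_def)
    \<comment> \<open>\<open>a - \<alpha>\<close> is odd, and adding 2 before the division rounds it
      to the nearest multiple of 4; the remainder \<open>z\<close> is then 1 or -1 and has to be the
      sign at index 0.\<close>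
    define p where "p = (a + 2 - \<alpha>) div 4"
    define z where "z = a - \<alpha> - 4 * p"
    have z: "z = 1 \<or> z = -1"
      using a al(1) unfolding z_def p_def by presburger
    have evp: "y + 4 * (k - int N) + \<alpha> = a \<longleftrightarrow> y = z \<and> k = int N + p" if "y = 1 \<or> y = -1" for y k
      using that z unfolding z_def by presburger
    \<comment> \<open>4 divides \<open>c - \<gamma>\<close>, so the quotient is exact. The added 3
      keeps four times the quotient within 5 of \<open>c\<close> for all other integers
      \<open>c\<close> as well, as the uniform local limit demands.\<close>
    have odp: "4 * (k - int N) + \<gamma> = c \<longleftrightarrow> k = int N + (c - \<gamma> + 3) div 4" for k
      using c ga(1) by presburger
    have s1: "{X\<in>U. ev X = a \<and> od X = c} = {X. X \<subseteq> ({0} \<union> Ev) \<union> Od \<and>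
        (chi (X \<inter> ({0} \<union> Ev)) 0 = z \<and> int (card (X \<inter> ({0} \<union> Ev) \<inter> Ev)) = int N + p) \<and>
        int (card (X \<inter> Od)) = int N + (c - \<gamma> + 3) div 4}"
    proof -
      have "chi (X \<inter> ({0} \<union> Ev)) 0 = chi X 0" "X \<inter> ({0} \<union> Ev) \<inter> Ev = X \<inter> Ev" for X
        by (auto simp: chi_def)
      moreover have "chi X 0 = 1 \<or> chi X 0 = -1" for X by (simp add: chi_def)
      ultimately show ?thesis
        unfolding U_def ev od odp using evp by auto
    qed
    have s2: "card {X. X \<subseteq> ({0} \<union> Ev) \<union> Od \<and>
        (chi (X \<inter> ({0} \<union> Ev)) 0 = z \<and> int (card (X \<inter> ({0} \<union> Ev) \<inter> Ev)) = int N + p) \<and>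
        int (card (X \<inter> Od)) = int N + (c - \<gamma> + 3) div 4} = card {Y. Y \<subseteq> {0} \<union> Ev \<and> chi Y 0 = z \<and> int (card (Y \<inter> Ev)) = int N + p} *
        card {W. W \<subseteq> Od \<and> int (card W) = int N + (c - \<gamma> + 3) div 4}"
      by (rule card_subsets_prod[where p = "\<lambda>Y. chi Y 0 = z \<and> int (card (Y \<inter> Ev)) = int N + p"
            and q = "\<lambda>W. int (card W) = int N + (c - \<gamma> + 3) div 4"]) (use Ev Od in auto)
    have s3: "{Y. Y \<subseteq> {0} \<union> Ev \<and> chi Y 0 = z \<and> int (card (Y \<inter> Ev)) = int N + p}
        = {Y. Y \<subseteq> {0} \<union> Ev \<and> chi (Y \<inter> {0}) 0 = z \<and> int (card (Y \<inter> Ev)) = int N + p}"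
      by (auto simp: chi_def)
    have s4: "card {Y. Y \<subseteq> {0} \<union> Ev \<and> chi (Y \<inter> {0}) 0 = z \<and> int (card (Y \<inter> Ev)) = int N + p}
       = card {Y. Y \<subseteq> {0} \<and> chi Y 0 = z} * card {W. W \<subseteq> Ev \<and> int (card W) = int N + p}"
      by (rule card_subsets_prod[where p = "\<lambda>Y. chi Y 0 = z" and q = "\<lambda>W. int (card W) = int N + p"]) (use Ev in auto)
    have s5: "{Y. Y \<subseteq> {0} \<and> chi Y 0 = z} = {if z = 1 then {0} else {}}"
      using z by (auto simp: chi_def subset_singleton_iff split: if_splits)
    show "real (card {X\<in>U. ev X = a \<and> od X = c})
        = ibinom (card Ev) (int N + (a + 2 - \<alpha>) div 4) * ibinom (card Od) (int N + (c - \<gamma> + 3) div 4)"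
      using card_subsets_int[OF Ev(1), of "int N + p"] card_subsets_int[OF Od(1), of "int N + (c - \<gamma> + 3) div 4"]
      unfolding s1 s2 s3 s4 s5 by (simp add: p_def)
  qed
  finally show ?thesis unfolding T_def .
qed

section \<open>The lemniscate weight and the arctangent weight\<close>

lemma angular_weight_inverse_sqrt:
  fixes q :: "real \<Rightarrow> real"
  assumes "continuous_on {0..} q" "\<And>s t. 0 \<le> s \<Longrightarrow> s \<le> t \<Longrightarrow> q s \<le> q t" "\<And>t. 1 \<le> q t"
  shows "angular_weight (\<lambda>t. 1 / q t)"
proof
  show "continuous_on {0..} (\<lambda>t. 1 / q t)"
  proof (intro continuous_on_divide continuous_on_const assms(1) ballI)
    show "q t \<noteq> 0" for t using assms(3)[of t] by linarith
  qed
  show "1 / q t \<le> 1 / q s" if "0 \<le> s" "s \<le> t" for s t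
    using assms(2)[OF that] assms(3)[of s] assms(3)[of t] by (intro divide_left_mono mult_pos_pos) auto
  show "1 / q t > 0" "1 / q t \<le> 1" for t
    using assms(3)[of t] by (simp_all add: divide_le_eq_1)
qed

lemma four_dvd_triples: "(d, u, v) \<in> triples \<Longrightarrow> 4 dvd 2 * d * u * v"
  by (auto simp: triples_def elim!: evenE)

text \<open>Here \<open>a\<close> is the hypotenuse, and (u^2 + v^2)^2 + (2uv)^2 = u^4 + 6 u^2 v^2 +
  v^4 is not a square as a form; its root produces the elliptic weight.\<close>

lemma pythagorean_weight_reciprocal:
  "pythagorean_weight (\<lambda>t. 1 / sqrt (1 + 6 * t\<^sup>2 + t ^ 4))
    (\<lambda>(d, u, v). (d * (u\<^sup>2 + v\<^sup>2), 2 * d * u * v))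
    reciprocal_points"
proof (intro pythagorean_weight.intro pythagorean_weight_axioms.intro)
  show "angular_weight (\<lambda>t. 1 / sqrt (1 + 6 * t\<^sup>2 + t ^ 4))"
    by (rule angular_weight_inverse_sqrt) (auto intro!: continuous_intros add_mono power_mono)
  show "bij_betw (\<lambda>(d, u, v). (d * (u\<^sup>2 + v\<^sup>2), 2 * d * u * v)) triples
      reciprocal_points"
    by (rule bij_betw_triples_reciprocal)
next
  fix d u v a c
  assume t: "(d, u, v) \<in> triples" and "(\<lambda>(d, u, v). (d * (u\<^sup>2 + v\<^sup>2), 2 * d * u * v)) (d, u, v) = (a, c)"
  then have ac: "a = d * (u\<^sup>2 + v\<^sup>2)" "c = 2 * d * u * v" by auto
  have u: "u > 0" "v < u" using t by (auto simp: triples_def)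
  have q: "1 + 6 * (real v / real u)\<^sup>2 + (real v / real u) ^ 4 \<ge> 0" by simp
  have "real u ^ 4 * (1 + 6 * (real v / real u)\<^sup>2 + (real v / real u) ^ 4) = real u ^ 4 + 6 * real u ^ 2 * real v ^ 2 + real v ^ 4"
    using u by (simp add: power_divide distrib_left) (simp add: power4_eq_xxxx power2_eq_square)
  then have "real d ^ 2 * (real u ^ 4 * (1 + 6 * (real v / real u)\<^sup>2 + (real v / real u) ^ 4)) = real a ^ 2 + real c ^ 2"
    by (simp add: ac power4_eq_xxxx power2_eq_square algebra_simps)
  moreover have "(real d * (real u)\<^sup>2 / (1 / sqrt (1 + 6 * (real v / real u)\<^sup>2 + (real v / real u) ^ 4)))\<^sup>2
      = real d ^ 2 * (real u ^ 4 * (1 + 6 * (real v / real u)\<^sup>2 + (real v / real u) ^ 4))"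
    using q by (simp add: power_mult_distrib)
  ultimately show "(real a)\<^sup>2 + (real c)\<^sup>2 = (real d * (real u)\<^sup>2 / (1 / sqrt (1 + 6 * (real v / real u)\<^sup>2 + (real v / real u) ^ 4)))\<^sup>2"
    by simp
  have "v\<^sup>2 \<le> u\<^sup>2" "u * v \<le> u * u" using u by (auto intro: power_mono)
  then show "a \<le> 2 * d * u\<^sup>2 \<and> c \<le> 2 * d * u\<^sup>2"
    unfolding ac by (simp add: power2_eq_square mult.assoc)
qed

text \<open>Here \<open>a\<close> and \<open>c\<close> are the two legs, so a^2 + c^2 is itself the
  square of d (u^2 + v^2) and the weight is rational.\<close>

lemma pythagorean_weight_skew:
  "pythagorean_weight (\<lambda>t. 1 / (1 + t\<^sup>2))
    (\<lambda>(d, u, v). (d * (u\<^sup>2 - v\<^sup>2), 2 * d * u * v))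
    skew_points"
proof (intro pythagorean_weight.intro pythagorean_weight_axioms.intro)
  show "angular_weight (\<lambda>t. 1 / (1 + t\<^sup>2))"
    by (rule angular_weight_inverse_sqrt) (auto intro!: continuous_intros power_mono)
  show "bij_betw (\<lambda>(d, u, v). (d * (u\<^sup>2 - v\<^sup>2), 2 * d * u * v)) triples
      skew_points"
    by (rule bij_betw_triples_skew)
next
  fix d u v a c
  assume t: "(d, u, v) \<in> triples" and "(\<lambda>(d, u, v). (d * (u\<^sup>2 - v\<^sup>2), 2 * d * u * v)) (d, u, v) = (a, c)"
  then have ac: "a = d * (u\<^sup>2 - v\<^sup>2)" "c = 2 * d * u * v" by auto
  have u: "u > 0" "v < u" using t by (auto simp: triples_def)
  have "a\<^sup>2 + c\<^sup>2 = (d * (u\<^sup>2 + v\<^sup>2))\<^sup>2"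
    unfolding ac by (rule triples_square_identity[OF t])
  then have "real (a\<^sup>2 + c\<^sup>2) = real ((d * (u\<^sup>2 + v\<^sup>2))\<^sup>2)"
    by (simp only:)
  moreover have "real d * (real u)\<^sup>2 / (1 / (1 + (real v / real u)\<^sup>2)) = real (d * (u\<^sup>2 + v\<^sup>2))"
  proof -
    have "(real u)\<^sup>2 * (1 + (real v / real u)\<^sup>2) = (real u)\<^sup>2 + (real v)\<^sup>2"
      using u by (simp add: power_divide distrib_left)
    then show ?thesis by simp
  qed
  ultimately show "(real a)\<^sup>2 + (real c)\<^sup>2 = (real d * (real u)\<^sup>2 / (1 / (1 + (real v / real u)\<^sup>2)))\<^sup>2"
    by (simp only: of_nat_add of_nat_power)
  have "u * v \<le> u * u" using u by auto
  moreover have "d * (u\<^sup>2 - v\<^sup>2) \<le> d * (2 * u\<^sup>2)" by (intro mult_left_mono) auto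
  ultimately show "a \<le> 2 * d * u\<^sup>2 \<and> c \<le> 2 * d * u\<^sup>2"
    unfolding ac by (simp add: power2_eq_square mult.assoc)
qed

text \<open>From evenness of \<open>c\<close> to divisibility by 4: the even leg is 2duv, and one of
  \<open>u\<close>, \<open>v\<close> is even because their sum is odd.\<close>

lemma reciprocal_points_iff:
  fixes a c :: int
  shows "(nat \<bar>a\<bar>, nat \<bar>c\<bar>) \<in> reciprocal_points
    \<longleftrightarrow> odd a \<and> 4 dvd c \<and> c \<noteq> 0 \<and> (\<exists>k. a\<^sup>2 - 1 * c\<^sup>2 = k\<^sup>2)" (is "?l \<longleftrightarrow> ?r")
proof
  assume ?r
  then obtain k where k: "odd a" "4 dvd c" "c \<noteq> 0" "a\<^sup>2 - 1 * c\<^sup>2 = k\<^sup>2" by blast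
  then have "int ((nat \<bar>a\<bar>)\<^sup>2) = int ((nat \<bar>k\<bar>)\<^sup>2 + (nat \<bar>c\<bar>)\<^sup>2)" by simp
  then have "(nat \<bar>a\<bar>)\<^sup>2 = (nat \<bar>k\<bar>)\<^sup>2 + (nat \<bar>c\<bar>)\<^sup>2" by (simp only: of_nat_eq_iff)
  moreover have "even c" using k(2) by auto
  ultimately show ?l using k by (auto simp: even_nat_iff)
next
  assume l: ?l
  then obtain b where b: "(nat \<bar>a\<bar>)\<^sup>2 = b\<^sup>2 + (nat \<bar>c\<bar>)\<^sup>2" by auto
  have "(nat \<bar>a\<bar>, nat \<bar>c\<bar>) \<in> (\<lambda>(d, u, v). (d * (u\<^sup>2 + v\<^sup>2), 2 * d * u * v)) ` triples"
    using l unfolding bij_betw_imp_surj_on[OF bij_betw_triples_reciprocal] .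
  then obtain t where t: "t \<in> triples" "(nat \<bar>a\<bar>, nat \<bar>c\<bar>) = (\<lambda>(d, u, v). (d * (u\<^sup>2 + v\<^sup>2), 2 * d * u * v)) t"
    by auto
  obtain d u v where "t = (d, u, v)" by (rule prod_cases3)
  then have "(d, u, v) \<in> triples" "nat \<bar>c\<bar> = 2 * d * u * v"
    using t by simp_all
  then have "4 dvd nat \<bar>c\<bar>" using four_dvd_triples by metis
  then have "int 4 dvd int (nat \<bar>c\<bar>)" by (simp only: of_nat_dvd_iff)
  then have "4 dvd c" by simp
  moreover have "int ((nat \<bar>a\<bar>)\<^sup>2) = int (b\<^sup>2 + (nat \<bar>c\<bar>)\<^sup>2)" using b by (simp only:)
  then have "a\<^sup>2 - 1 * c\<^sup>2 = (int b)\<^sup>2" by simp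
  ultimately show ?r using l by (auto simp: even_nat_iff)
qed

lemma skew_points_iff:
  fixes a c :: int
  shows "(nat \<bar>a\<bar>, nat \<bar>c\<bar>) \<in> skew_points
    \<longleftrightarrow> odd a \<and> 4 dvd c \<and> c \<noteq> 0 \<and> (\<exists>k. a\<^sup>2 - (- 1) * c\<^sup>2 = k\<^sup>2)" (is "?l \<longleftrightarrow> ?r")
proof
  assume ?r
  then obtain k where k: "odd a" "4 dvd c" "c \<noteq> 0" "a\<^sup>2 - (- 1) * c\<^sup>2 = k\<^sup>2" by blast
  then have "int ((nat \<bar>a\<bar>)\<^sup>2 + (nat \<bar>c\<bar>)\<^sup>2) = int ((nat \<bar>k\<bar>)\<^sup>2)" by simp
  then have "(nat \<bar>a\<bar>)\<^sup>2 + (nat \<bar>c\<bar>)\<^sup>2 = (nat \<bar>k\<bar>)\<^sup>2" by (simp only: of_nat_eq_iff)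
  moreover have "even c" using k(2) by auto
  ultimately show ?l using k by (auto simp: even_nat_iff)
next
  assume l: ?l
  then obtain b where b: "(nat \<bar>a\<bar>)\<^sup>2 + (nat \<bar>c\<bar>)\<^sup>2 = b\<^sup>2" by auto
  have "(nat \<bar>a\<bar>, nat \<bar>c\<bar>) \<in> (\<lambda>(d, u, v). (d * (u\<^sup>2 - v\<^sup>2), 2 * d * u * v)) ` triples"
    using l unfolding bij_betw_imp_surj_on[OF bij_betw_triples_skew] .
  then obtain t where t: "t \<in> triples" "(nat \<bar>a\<bar>, nat \<bar>c\<bar>) = (\<lambda>(d, u, v). (d * (u\<^sup>2 - v\<^sup>2), 2 * d * u * v)) t"
    by auto
  obtain d u v where "t = (d, u, v)" by (rule prod_cases3)
  then have "(d, u, v) \<in> triples" "nat \<bar>c\<bar> = 2 * d * u * v"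
    using t by simp_all
  then have "4 dvd nat \<bar>c\<bar>" using four_dvd_triples by metis
  then have "int 4 dvd int (nat \<bar>c\<bar>)" by (simp only: of_nat_dvd_iff)
  then have "4 dvd c" by simp
  moreover have "int ((nat \<bar>a\<bar>)\<^sup>2 + (nat \<bar>c\<bar>)\<^sup>2) = int (b\<^sup>2)" using b by (simp only:)
  then have "a\<^sup>2 - (- 1) * c\<^sup>2 = (int b)\<^sup>2" by simp
  ultimately show ?r using l by (auto simp: even_nat_iff)
qed

section \<open>From square discriminants to weighted Pythagorean sums\<close>

definition square_disc_count :: "int \<Rightarrow> nat \<Rightarrow> nat" where
  "square_disc_count e m = card {f. littlewood (2 * m) f \<and> palindromic e m f \<and>
     (\<exists>k. (even_part e m f)\<^sup>2 - e * (odd_part e m f)\<^sup>2 = k\<^sup>2)}"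

lemma card_R_set: "m > 0 \<Longrightarrow> card (R_set (2 * m)) = square_disc_count 1 m"
  and card_S_set: "m > 0 \<Longrightarrow> card (S_set (2 * m)) = square_disc_count (- 1) m"
proof -
  assume m: "m > 0"
  have sq: "square_disc f \<longleftrightarrow> (\<exists>k. (even_part e m f)\<^sup>2 - e * (odd_part e m f)\<^sup>2 = k\<^sup>2)"
    if "littlewood (2 * m) f" "palindromic e m f" "e = 1 \<or> e = -1" for e f
    by (rule square_disc_iff) (use that m in \<open>auto simp: palindromic_def\<close>)
  have deg: "degree f = 2 * m" if "littlewood (2 * m) f" for f
    using that by (simp add: littlewood_def)
  show "card (R_set (2 * m)) = square_disc_count 1 m" "card (S_set (2 * m)) = square_disc_count (- 1) m"
    unfolding R_set_def S_set_def square_disc_count_def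
    by (intro arg_cong[of _ _ card] Collect_cong;
      use sq[where e = 1] sq[where e = "-1"] reciprocal_iff[OF deg] skew_reciprocal_iff[OF deg] in blast)+
qed

text \<open>A sum of signs over \<open>nE\<close> indices is 2 card - nE, so twice it exceeds 4
  (card - N) by 4N - 2 nE. With the contribution of the fixed leading coefficient, which falls to
  the even or the odd part by the parity of \<open>m\<close>, this is the shift
  \<open>\<alpha>\<close>, and likewise \<open>\<gamma>\<close>.\<close>

lemma square_disc_count_sum:
  fixes e :: int
  assumes e: "e = 1 \<or> e = -1" and m: "m > 0" and N: "N > 0"
    and nE: "card {j\<in>{1..<m}. even j} = nE" "nE \<le> 2 * N" and nO: "card {j\<in>{1..<m}. odd j} = nO" "nO \<le> 2 * N"
    and \<alpha>: "4 * int N - 2 * int nE + 2 * (if even m then e ^ (m div 2) else 0) = \<alpha>" "even \<alpha>" "\<bar>\<alpha>\<bar> \<le> 4"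
    and \<gamma>: "4 * int N - 2 * int nO + 2 * (if odd m then e ^ (m div 2) else 0) = \<gamma>" "4 dvd \<gamma>" "\<bar>\<gamma>\<bar> \<le> 4"
  shows "real (square_disc_count e m) = (\<Sum>(a, c)\<in>square_points N (\<lambda>a c. \<exists>k. a\<^sup>2 - e * c\<^sup>2 = k\<^sup>2).
        ibinom nE (int N + (a + 2 - \<alpha>) div 4) * ibinom nO (int N + (c - \<gamma> + 3) div 4))"
proof -
  define Ev Od where "Ev = {j\<in>{1..<m}. even j}" and "Od = {j\<in>{1..<m}. odd j}"
  have fin: "finite Ev" "finite Od" "0 \<notin> Ev" "0 \<notin> Od" "Ev \<inter> Od = {}"
    by (auto simp: Ev_def Od_def)
  have un: "{..<m} = insert 0 (Ev \<union> Od)"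
    using m by (auto simp: Ev_def Od_def)
  define ke ko where "ke = (if even m then e ^ (m div 2) else 0)" and "ko = (if odd m then e ^ (m div 2) else 0)"
  have card: "card Ev = nE" "card Od = nO"
    using nE nO by (simp_all add: Ev_def Od_def)
  have "square_disc_count e m = card {X. X \<subseteq> insert 0 (Ev \<union> Od) \<and>
      (\<exists>k. (chi X 0 + 2 * ((\<Sum>j\<in>Ev. chi X j) + ke))\<^sup>2 - e * (2 * ((\<Sum>j\<in>Od. chi X j) + ko))\<^sup>2 = k\<^sup>2)}"
    unfolding square_disc_count_def un[symmetric] unfolding Ev_def Od_def ke_def ko_def
    by (rule card_palindromic_littlewood[OF m e])
  moreover have "real (card {X. X \<subseteq> insert 0 (Ev \<union> Od) \<and>
      (\<exists>k. (chi X 0 + 2 * ((\<Sum>j\<in>Ev. chi X j) + ke))\<^sup>2 - e * (2 * ((\<Sum>j\<in>Od. chi X j) + ko))\<^sup>2 = k\<^sup>2)})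
    = (\<Sum>(a, c)\<in>square_points N (\<lambda>a c. \<exists>k. a\<^sup>2 - e * c\<^sup>2 = k\<^sup>2).
        ibinom (card Ev) (int N + (a + 2 - \<alpha>) div 4) * ibinom (card Od) (int N + (c - \<gamma> + 3) div 4))"
  proof (rule card_sign_patterns)
    show "chi X 0 + 2 * ((\<Sum>j\<in>Ev. chi X j) + ke) = chi X 0 + 4 * (int (card (X \<inter> Ev)) - int N) + \<alpha>" for X
      using \<alpha>(1) unfolding sum_chi[OF fin(1)] card ke_def[symmetric] by simp
    show "2 * ((\<Sum>j\<in>Od. chi X j) + ko) = 4 * (int (card (X \<inter> Od)) - int N) + \<gamma>" for X
      using \<gamma>(1) unfolding sum_chi[OF fin(2)] card ko_def[symmetric] by simp
  qed (use fin card nE nO N \<alpha> \<gamma> in auto)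
  ultimately show ?thesis
    unfolding card by simp
qed

text \<open>For m = 4N the leading coefficient enters the even part, whose 2N - 1 other signs give
  the shift 2 + 2 = 4, while the 2N odd indices are all free. For m = 4N - 1 both parts have 2N - 1
  free signs, and the leading coefficient enters the odd part with the sign e^(2N-1) = e, whence 2 +
  2e.\<close>

lemma square_disc_count_eq:
  fixes e :: int
  assumes e: "e = 1 \<or> e = -1" and N: "N > 0"
  shows "real (square_disc_count e (4 * N)) = (\<Sum>(a, c)\<in>square_points N (\<lambda>a c. \<exists>k. a\<^sup>2 - e * c\<^sup>2 = k\<^sup>2).
        ibinom (2 * N - 1) (int N + (a + 2 - 4) div 4) * ibinom (2 * N) (int N + (c - 0 + 3) div 4))"
    and "real (square_disc_count e (4 * N - 1)) = (\<Sum>(a, c)\<in>square_points N (\<lambda>a c. \<exists>k. a\<^sup>2 - e * c\<^sup>2 = k\<^sup>2).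
        ibinom (2 * N - 1) (int N + (a + 2 - 2) div 4) * ibinom (2 * N - 1) (int N + (c - (2 + 2 * e) + 3) div 4))"
proof -
  have e1: "{j\<in>{1..<4 * N}. even j} = (\<lambda>j. 2 * j) ` {1..<2 * N}" "{j\<in>{1..<4 * N - 1}. even j} = (\<lambda>j. 2 * j) ` {1..<2 * N}"
    by (auto elim!: evenE)
  have o1: "{j\<in>{1..<4 * N}. odd j} = (\<lambda>j. 2 * j + 1) ` {..<2 * N}" "{j\<in>{1..<4 * N - 1}. odd j} = (\<lambda>j. 2 * j + 1) ` {..<2 * N - 1}"
    by (auto elim!: oddE)
  have c: "card {j\<in>{1..<4 * N}. even j} = 2 * N - 1" "card {j\<in>{1..<4 * N - 1}. even j} = 2 * N - 1"
    "card {j\<in>{1..<4 * N}. odd j} = 2 * N" "card {j\<in>{1..<4 * N - 1}. odd j} = 2 * N - 1"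
    unfolding e1 o1 by (subst card_image; auto simp: inj_on_def)+
  have d: "4 * N div 2 = 2 * N" "(4 * N - 1) div 2 = 2 * N - 1" "even (4 * N)" "odd (4 * N - 1)" "int (2 * N - 1) = 2 * int N - 1"
    using N by auto
  have pw: "e ^ (2 * N) = 1" "e ^ (2 * N - 1) = e"
    using e N by (auto simp: power_mult)
  show "real (square_disc_count e (4 * N)) = (\<Sum>(a, c)\<in>square_points N (\<lambda>a c. \<exists>k. a\<^sup>2 - e * c\<^sup>2 = k\<^sup>2).
        ibinom (2 * N - 1) (int N + (a + 2 - 4) div 4) * ibinom (2 * N) (int N + (c - 0 + 3) div 4))"
    by (rule square_disc_count_sum[OF e _ N c(1) _ c(3)]; (simp only: d pw)?; use N in simp)
  show "real (square_disc_count e (4 * N - 1)) = (\<Sum>(a, c)\<in>square_points N (\<lambda>a c. \<exists>k. a\<^sup>2 - e * c\<^sup>2 = k\<^sup>2).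
        ibinom (2 * N - 1) (int N + (a + 2 - 2) div 4) * ibinom (2 * N - 1) (int N + (c - (2 + 2 * e) + 3) div 4))"
    by (rule square_disc_count_sum[OF e _ N c(2) _ c(4)]; (simp only: d pw)?; use N e in auto)
qed

subsection \<open>The asymptotics\<close>

text \<open>The squared central coefficient is asymptotic to 16^N / (pi N), which turns 4 I /
  pi^(3/2) into 4 l l' I / pi^(5/2). The product l l' is 1/2 in degree 8N, with one shortened
  binomial coefficient, and 1/4 in degree 8N - 2, with two.\<close>

lemma square_disc_count_limits:
  assumes e: "e = 1 \<or> e = -1" and pw: "pythagorean_weight H pr P"
    and P: "\<And>a c. (nat \<bar>a\<bar>, nat \<bar>c\<bar>) \<in> P \<longleftrightarrow> odd a \<and> 4 dvd c \<and> c \<noteq> 0 \<and> (\<exists>k. a\<^sup>2 - e * c\<^sup>2 = k\<^sup>2)"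
  defines "I \<equiv> integral {0..1} H"
  shows "(\<lambda>N. real (square_disc_count e (4 * N)) / (16 ^ N * ln (real N) / sqrt (real N))) \<longlonglongrightarrow> 2 * I / pi powr (5/2)"
    and "(\<lambda>N. real (square_disc_count e (4 * N - 1)) / (16 ^ N * ln (real N) / sqrt (real N))) \<longlonglongrightarrow> I / pi powr (5/2)"
proof -
  have aw: "angular_weight H"
    using pw by (rule pythagorean_weight.axioms(1))
  note asymp = pythagorean_weight.weighted_count_asymp[OF pw _ _ P, unfolded angular_weight.I_def[OF aw], folded I_def]
  have pi52: "pi powr (5/2) = pi * pi powr (3/2)"
    using powr_add[of pi 1 "3/2"] by simp
  have lim: "(\<lambda>N. C N / (16 ^ N * ln (real N) / sqrt (real N))) \<longlonglongrightarrow> 4 * (l * l') * I / pi powr (5/2)"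
    if "l > 0" "l' > 0" "(\<lambda>N. S N / (l * l' * cbin N ^ 2 * (sqrt (real N) * ln (real N)))) \<longlonglongrightarrow> 4 * I / pi powr (3/2)"
      and eq: "\<And>N. N > 0 \<Longrightarrow> C N = S N" for C S l l'
  proof -
    have "(\<lambda>N. S N / (l * l' * cbin N ^ 2 * (sqrt (real N) * ln (real N)))
        * (l * l' * (cbin N ^ 2 * pi * real N / 16 ^ N) / pi)) \<longlonglongrightarrow> 4 * I / pi powr (3/2) * (l * l' * 1 / pi)"
      by (intro tendsto_mult that(3) tendsto_divide tendsto_const central_binomial_asymp) auto
    moreover have "4 * I / pi powr (3/2) * (l * l' * 1 / pi) = 4 * (l * l') * I / pi powr (5/2)"
      unfolding pi52 by (simp add: mult_ac)
    ultimately have "(\<lambda>N. S N / (l * l' * cbin N ^ 2 * (sqrt (real N) * ln (real N)))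
        * (l * l' * (cbin N ^ 2 * pi * real N / 16 ^ N) / pi)) \<longlonglongrightarrow> 4 * (l * l') * I / pi powr (5/2)"
      by simp
    then show ?thesis
    proof (rule Lim_transform_eventually)
      show "\<forall>\<^sub>F N in sequentially. S N / (l * l' * cbin N ^ 2 * (sqrt (real N) * ln (real N)))
        * (l * l' * (cbin N ^ 2 * pi * real N / 16 ^ N) / pi) = C N / (16 ^ N * ln (real N) / sqrt (real N))"
        using eventually_gt_at_top[of 1]
      proof eventually_elim
        case (elim N)
        define b s L where "b = cbin N" and "s = sqrt (real N)" and "L = ln (real N)"
        have nz: "b > 0" "s > 0" "L > 0" "real N = s * s"
          using elim by (auto simp: b_def s_def L_def)
        have "S N / (l * l' * b ^ 2 * (s * L)) * (l * l' * (b ^ 2 * pi * (s * s) / 16 ^ N) / pi) = S N / (16 ^ N * L / s)"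
          using nz that(1,2) by (simp add: field_simps)
        then show ?case
          using eq[of N] elim nz(4) unfolding b_def[symmetric] s_def[symmetric] L_def[symmetric] by simp
      qed
    qed
  qed
  have f8: "gauss_family (1 / 2) (\<lambda>N a. ibinom (2 * N - 1) (int N + (a + 2 - 4) div 4))"
    by (rule gauss_family_ibinom(2)) presburger
  have g8: "gauss_family 1 (\<lambda>N c. ibinom (2 * N) (int N + (c - 0 + 3) div 4))"
    by (rule gauss_family_ibinom(1)) presburger
  have f82: "gauss_family (1 / 2) (\<lambda>N a. ibinom (2 * N - 1) (int N + (a + 2 - 2) div 4))"
    by (rule gauss_family_ibinom(2)) presburger
  have g82: "gauss_family (1 / 2) (\<lambda>N c. ibinom (2 * N - 1) (int N + (c - (2 + 2 * e) + 3) div 4))"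
    by (rule gauss_family_ibinom(2)) (use e in presburger)
  show "(\<lambda>N. real (square_disc_count e (4 * N)) / (16 ^ N * ln (real N) / sqrt (real N))) \<longlonglongrightarrow> 2 * I / pi powr (5/2)"
    using lim[OF _ _ asymp[OF f8 g8], of "\<lambda>N. real (square_disc_count e (4 * N))"] square_disc_count_eq(1)[OF e] by simp
  show "(\<lambda>N. real (square_disc_count e (4 * N - 1)) / (16 ^ N * ln (real N) / sqrt (real N))) \<longlonglongrightarrow> I / pi powr (5/2)"
    using lim[OF _ _ asymp[OF f82 g82], of "\<lambda>N. real (square_disc_count e (4 * N - 1))"] square_disc_count_eq(2)[OF e] by simp
qed

lemma bigtheta_of_limit:
  fixes f g :: "nat \<Rightarrow> real"
  assumes "(\<lambda>n. f n / g n) \<longlonglongrightarrow> c" "c \<noteq> 0" "eventually (\<lambda>n. g n \<noteq> 0) sequentially"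
  shows "f \<in> \<Theta>(g)"
proof -
  have "f \<sim>[at_top] (\<lambda>n. c * g n)"
    using asymp_equivI'_const[OF assms(1,2)] .
  then have "f \<in> \<Theta>(\<lambda>n. c * g n)"
    by (rule asymp_equiv_imp_bigtheta)
  then show ?thesis using assms(2) by simp
qed

lemma asymp_equiv_half_of_limits:
  fixes f g h :: "nat \<Rightarrow> real"
  assumes "(\<lambda>n. f n / h n) \<longlonglongrightarrow> c" "(\<lambda>n. g n / h n) \<longlonglongrightarrow> c / 2" "c \<noteq> 0"
  shows "g \<sim>[at_top] (\<lambda>n. f n / 2)"
proof -
  have 1: "g \<sim>[at_top] (\<lambda>n. c / 2 * h n)"
    using assms(3) by (intro asymp_equivI'_const assms(2)) simp
  have "(\<lambda>n. (f n / 2) / h n) \<longlonglongrightarrow> c / 2"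
    using tendsto_divide[OF assms(1) tendsto_const[of 2]] by (simp add: mult.commute)
  then have "(\<lambda>n. f n / 2) \<sim>[at_top] (\<lambda>n. c / 2 * h n)"
    using assms(3) by (intro asymp_equivI'_const) auto
  with 1 show ?thesis
    by (meson asymp_equiv_sym asymp_equiv_trans)
qed

theorem theorem1p1:
  defines "g \<equiv> (\<lambda>n::nat. 16 ^ n * ln (real n) / sqrt (real n))"
  shows "(\<lambda>n. real (card (R_set (8 * n)))) \<in> \<Theta>(g) \<and>
         (\<lambda>n. real (card (S_set (8 * n)))) \<in> \<Theta>(g) \<and>
         (\<lambda>n. real (card (R_set (8 * n - 2)))) \<in> \<Theta>(g) \<and>
         (\<lambda>n. real (card (S_set (8 * n - 2)))) \<in> \<Theta>(g) \<and>
         (\<lambda>n. real (card (R_set (8 * n))) / g n)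
           \<longlonglongrightarrow> Gamma (1/4) ^ 2 / (4 * sqrt 2 * pi ^ 3) \<and>
         (\<lambda>n. real (card (S_set (8 * n))) / g n)
           \<longlonglongrightarrow> 1 / (2 * pi powr (3/2)) \<and>
         (\<lambda>n. real (card (R_set (8 * n - 2)))) \<sim>[at_top] (\<lambda>n. real (card (R_set (8 * n))) / 2) \<and>
         (\<lambda>n. real (card (S_set (8 * n - 2)))) \<sim>[at_top] (\<lambda>n. real (card (S_set (8 * n))) / 2)"
proof -
  define cR cS :: real where "cR = Gamma (1/4) ^ 2 / (4 * sqrt 2 * pi ^ 3)" and "cS = 1 / (2 * pi powr (3/2))"
  have g0: "eventually (\<lambda>n. g n \<noteq> 0) sequentially"
    unfolding g_def using eventually_gt_at_top[of 1] by eventually_elim auto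
  \<comment> \<open>At \<open>n = 0\<close> the degree \<open>8 * n - 2\<close> is truncated to 0,
    and the translation into counts requires \<open>m > 0\<close>; a limit ignores this one
    index.\<close>
  have transfer: "(\<lambda>n. real (F n) / g n) \<longlonglongrightarrow> c"
    if "(\<lambda>n. real (F' n) / g n) \<longlonglongrightarrow> c" "\<And>n. n > 0 \<Longrightarrow> F n = F' n" for F F' :: "nat \<Rightarrow> nat" and c
    using that(1) by (rule Lim_transform_eventually)
      (use that(2) in \<open>auto intro: eventually_mono[OF eventually_gt_at_top[of 0]]\<close>)
  have pi3: "pi ^ 3 = pi powr (5/2) * sqrt pi"
    using powr_add[of pi "5/2" "1/2"] by (simp add: powr_half_sqrt)
  have pi52: "pi powr (5/2) = pi * pi powr (3/2)"
    using powr_add[of pi 1 "3/2"] by simp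
  have cR: "2 * integral {0..1} (\<lambda>t. 1 / sqrt (1 + 6 * t\<^sup>2 + t ^ 4)) / pi powr (5/2) = cR"
    "integral {0..1} (\<lambda>t. 1 / sqrt (1 + 6 * t\<^sup>2 + t ^ 4)) / pi powr (5/2) = cR / 2"
    unfolding lemniscate_integral cR_def pi3 by simp_all
  have cS: "2 * integral {0..1} (\<lambda>t. 1 / (1 + t\<^sup>2)) / pi powr (5/2) = cS"
    "integral {0..1} (\<lambda>t. 1 / (1 + t\<^sup>2)) / pi powr (5/2) = cS / 2"
    unfolding arctan_integral cS_def pi52 by simp_all
  have "Gamma (1/4 :: real) \<noteq> 0"
    using Gamma_real_pos[of "1/4"] by linarith
  then have c0: "cR \<noteq> 0" "cS \<noteq> 0"
    by (simp_all add: cR_def cS_def)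
  have idx: "8 * n = 2 * (4 * n)" "8 * n - 2 = 2 * (4 * n - 1)" for n :: nat
    by simp_all
  have "(\<lambda>n. real (square_disc_count 1 (4 * n)) / g n) \<longlonglongrightarrow> cR"
    unfolding g_def cR(1)[symmetric] by (rule square_disc_count_limits(1)[OF _ pythagorean_weight_reciprocal reciprocal_points_iff]) simp
  then have R8: "(\<lambda>n. real (card (R_set (8 * n))) / g n) \<longlonglongrightarrow> cR"
    by (rule transfer) (unfold idx(1), rule card_R_set, simp)
  have "(\<lambda>n. real (square_disc_count 1 (4 * n - 1)) / g n) \<longlonglongrightarrow> cR / 2"
    unfolding g_def cR(2)[symmetric] by (rule square_disc_count_limits(2)[OF _ pythagorean_weight_reciprocal reciprocal_points_iff]) simp
  then have R82: "(\<lambda>n. real (card (R_set (8 * n - 2))) / g n) \<longlonglongrightarrow> cR / 2"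
    by (rule transfer) (unfold idx(2), rule card_R_set, simp)
  have "(\<lambda>n. real (square_disc_count (- 1) (4 * n)) / g n) \<longlonglongrightarrow> cS"
    unfolding g_def cS(1)[symmetric] by (rule square_disc_count_limits(1)[OF _ pythagorean_weight_skew skew_points_iff]) simp
  then have S8: "(\<lambda>n. real (card (S_set (8 * n))) / g n) \<longlonglongrightarrow> cS"
    by (rule transfer) (unfold idx(1), rule card_S_set, simp)
  have "(\<lambda>n. real (square_disc_count (- 1) (4 * n - 1)) / g n) \<longlonglongrightarrow> cS / 2"
    unfolding g_def cS(2)[symmetric] by (rule square_disc_count_limits(2)[OF _ pythagorean_weight_skew skew_points_iff]) simp
  then have S82: "(\<lambda>n. real (card (S_set (8 * n - 2))) / g n) \<longlonglongrightarrow> cS / 2"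
    by (rule transfer) (unfold idx(2), rule card_S_set, simp)
  show ?thesis
    unfolding cR_def[symmetric] cS_def[symmetric]
    using bigtheta_of_limit[OF R8 c0(1) g0] bigtheta_of_limit[OF S8 c0(2) g0]
      bigtheta_of_limit[OF R82 _ g0] bigtheta_of_limit[OF S82 _ g0] R8 S8
      asymp_equiv_half_of_limits[OF R8 R82 c0(1)] asymp_equiv_half_of_limits[OF S8 S82 c0(2)] c0
    by (intro conjI) simp_all
qed

end
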